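(* (Hahn / dual Hahn.) Let $N\ge1$ and let $m^\star,s^\star,r,\mu,\sigma,\rho\in\mathbb{C}$. For $j=0,\dots,N$ let $\Phi_j=(t_x,t_x^\star(j),x=0,\dots,N-j;\ f_x(j),g_x(j),x=1,\dots,N-j)$ with $$t_x=x,\qquad t^\star_x(j)=m^\star x(x+1+s^\star+j),$$ $$f_x(j)=m^\star x(x-N+j-1)(x+r),\qquad g_x(j)=-m^\star x(x-N+j-1)(x+s^\star+j-r),$$ and for $x=0,\dots,N$ let $\Psi_x=(\theta_j(x),\theta_j^\star,j=0,\dots,N-x;\ \varphi_j(x),\phi_j(x),j=1,\dots,N-x)$ with $$\theta_j(x)=\mu j(j+1+\sigma+x),\qquad\theta^\star_j=j,$$ $$\varphi_j(x)=\mu j(j-N+x-1)(j+\rho),\qquad\phi_j(x)=\mu j(j-N+x-1)(j+\rho-\sigma-N-1).$$ Assume the parameters are such that all $\Phi_j$ and all $\Psi_x$ are parameter arrays. Then the pair $(\Phi_j,\Psi_x)$ is associated to a factorized $A_2$-Leonard pair: there exist a $\mathbb{C}$-vector space $V$ of dimension $\binom{N+2}2$, a factorized $A_2$-Leonard pair on $V$ with basis $(X,Y;X^\star,Y^\star)$, and nonzero vectors $V_{x,y}\in V_{(x,y)}$, $V^\star_{i,j}\in V^\star_{(i,j)}$ such that $XV_{x,y}=t_xV_{x,y}$, $YV_{x,y}=\theta_y(x)V_{x,y}$, $X^\star V^\star_{i,j}=t^\star_i(j)V^\star_{i,j}$, $Y^\star V^\star_{i,j}=\theta^\star_jV^\star_{i,j}$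 and $V^\star_{i,j}=\sum_{x=0}^{N-j}\sum_{y=0}^{N-x}T_{i,j}(x,y)V_{x,y}$, where $$T_{i,j}(x,y)=\binom{N-j}{i}\binom{N-x}{j}\frac{(-1)^j(r+1)_i(2+s^\star+j)_{N-j}(\rho+1)_j}{(s^\star+j-r+1)_i(s^\star+j+1+i)_i(s^\star+j+2i+2)_{N-j-i}(\rho-\sigma-N)_j}\times{}_3F_2\!\left({-i,\ i+1+s^\star+j,\ -x\atop r+1,\ -N+j};1\right){}_3F_2\!\left({-j,\ -y,\ y+1+\sigma+x\atop\rho+1,\ -N+x};1\right).$$
   Context: **Factorized $A_2$-Leonard pairs.** $N\ge1$ is an integer, $\mathcal D=\{(x,y)\in\mathbb{Z}_{\ge0}^2 : x+y\le N\}$, $A_2=\{(0,0),(1,-1),(1,0),(0,1),(-1,1),(-1,0),(0,-1)\}$; $\lambda,\chi\in\mathcal D$ are adjacent if $\lambda-\chi\in A_2$. Let $V$ be a $\mathbb{C}$-vector space. $(H,H^\star)$ is an $A_2$-Leonard pair on $\mathcal D$ if: (i) $H$ and (ii) $H^\star$ are two-dimensional subspaces of $\mathrm{End}(V)$, each consisting of diagonalizable, mutually commuting elements; (iii) there is a bijection $\lambda\mapsto V_\lambda$ from $\mathcal D$ to the common eigenspaces of $H$ with $H^\star V_\lambda\subseteq\sum_{\chi\in\mathcal D,\ \chi\text{ adjacent to }\lambda}V_\chi$; (iv) there is a bijection $\lambda\mapsto V^\star_\lambda$ from $\mathcal D$ to the common eigenspaces of $H^\star$ with $HV^\star_\lambda\subseteq\sum_{\chi\in\mathcal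 D,\ \chi\text{ adjacent to }\lambda}V^\star_\chi$; (v) there is no subspace $W\neq 0,V$ of $V$ with $HW\subseteq W$ and $H^\star W\subseteq W$; (vi) $\dim V_\lambda=\dim V^\star_\lambda=1$ for all $\lambda\in\mathcal D$; (vii) there is a non-degenerate symmetric bilinear form $\langle\,,\rangle$ on $V$ with $\langle V_\lambda,V_\chi\rangle=0=\langle V^\star_\lambda,V^\star_\chi\rangle$ for $\lambda\ne\chi$. It is a *factorized* $A_2$-Leonard pair with basis $(X,Y;X^\star,Y^\star)$ if moreover $X,Y$ is a basis of $H$, $X^\star,Y^\star$ is a basis of $H^\star$, and: (viii) $X$ acts on $V_{(x,y)}$ as a scalar $t_x$ and $Y^\star$ acts on $V^\star_{(i,j)}$ as a scalar $\theta^\star_j$, the $t_x$ ($0\le x\le N$) being pairwise distinct and the $\theta^\star_j$ ($0\le j\le N$) pairwise distinct; (ix) $[X,Y^\star]=0$; (x) each common eigenspace of $X$ and $Y^\star$ has dimension one; (xi) $\langle V^\star_{(i+1,j)},XV^\star_{(i,j)}\rangle\ne0$ and $\langle V^\star_{(i,j)},XV^\star_{(i+1,j)}\rangle\neq0$ for $(i,j),(i+1,j)\in\mathcal D$, and $\langle V_{(x,y+1)},Y^\star V_{(x,y)}\rangle\ne0$ and $\langle V_{(x,y)},Y^\star V_{(x,y+1)}\rangle\ne0$ for $(x,y),(x,y+1)\in\mathcal D$ (for subspaces, $\langle U,W\rangle\neq0$ means the form is not identically zero on $U\times W$). **Parameter arrays.** A parameter array of diameter $d\ge0$ is a tuple $(\theta_i,\theta^\star_i,i=0,\dots,d;\varphi_j,\phi_j,j=1,\dots,d)$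 of complex numbers such that: all $\varphi_i,\phi_i$ are nonzero; the $\theta_i$ are pairwise distinct and the $\theta_i^\star$ are pairwise distinct; for $1\le i\le d$, with $\vartheta_i=\sum_{h=0}^{i-1}\frac{\theta_h-\theta_{d-h}}{\theta_0-\theta_d}$, one has $\varphi_i=\phi_1\vartheta_i+(\theta^\star_i-\theta^\star_0)(\theta_{i-1}-\theta_d)$ and $\phi_i=\varphi_1\vartheta_i+(\theta^\star_i-\theta^\star_0)(\theta_{d-i+1}-\theta_0)$; and $\frac{\theta_{i-2}-\theta_{i+1}}{\theta_{i-1}-\theta_i}$ and $\frac{\theta^\star_{i-2}-\theta^\star_{i+1}}{\theta^\star_{i-1}-\theta^\star_i}$ are equal and independent of $i$ for $2\le i\le d-1$. For the arrays in the claim this amounts to the non-vanishing and distinctness conditions. **Notation.** $(a)_i=\prod_{k=0}^{i-1}(a+k)$; ${}_3F_2$ is the usual hypergeometric series; here ${}_3F_2\left({-i,\dots\atop\dots};1\right)$ is the finite sum over $k=0,\dots,\min(i,x)$ (resp. $\min(j,y)$), so that negative-integer lower parameters $-N+j$, $-N+x$ cause no division by zero. *)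

theory Defs
  imports Complex_Main "HOL-Library.Function_Algebras"
begin

section \<open>The index domain\<close>

definition dom2 :: "nat \<Rightarrow> (nat \<times> nat) set" where
  "dom2 N = {(x, y). x + y \<le> N}"

definition A2 :: "(int \<times> int) set" where
  "A2 = {(0,0), (1,-1), (1,0), (0,1), (-1,1), (-1,0), (0,-1)}"

definition A2_adjacent :: "nat \<times> nat \<Rightarrow> nat \<times> nat \<Rightarrow> bool" where
  "A2_adjacent p q \<longleftrightarrow>
     (int (fst p) - int (fst q), int (snd p) - int (snd q)) \<in> A2"


section \<open>Factorized A2-Leonard pairs\<close>

text \<open>
  The complex vector space of the definitions is an arbitrary subspace \<open>V\<close> of an ambient complex
  vector space (the whole type is allowed), so that its dimension may depend on a variable.
\<close>

locale complex_vector_space = vector_space scale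
  for scale :: "complex \<Rightarrow> 'v::ab_group_add \<Rightarrow> 'v"

sublocale complex_vector_space \<subseteq> endo: vector_space "\<lambda>c (f :: 'v \<Rightarrow> 'v) v. scale c (f v)"
  by unfold_locales (auto simp: fun_eq_iff scale_right_distrib scale_left_distrib)

context complex_vector_space
begin

text \<open>
  Endomorphisms of \<open>V\<close> are extended by zero outside of \<open>V\<close>. Thus equality of endomorphisms is
  equality of functions, and \<open>End V\<close> is a subspace of the space of all functions under pointwise
  operations (whose subspaces, dimension and independence carry the prefix \<open>endo\<close>).
\<close>

definition End :: "'v set \<Rightarrow> ('v \<Rightarrow> 'v) set" where
  "End V = {f. (\<forall>v\<in>V. f v \<in> V) \<and>
               (\<forall>u\<in>V. \<forall>v\<in>V. f (u + v) = f u + f v) \<and>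
               (\<forall>c. \<forall>v\<in>V. f (scale c v) = scale c (f v)) \<and>
               (\<forall>v. v \<notin> V \<longrightarrow> f v = 0)}"

definition diagonalizable_on :: "'v set \<Rightarrow> ('v \<Rightarrow> 'v) \<Rightarrow> bool" where
  "diagonalizable_on V f \<longleftrightarrow>
     (\<exists>B \<subseteq> V. independent B \<and> span B = V \<and> (\<forall>b\<in>B. \<exists>c. f b = scale c b))"

definition common_eigenspaces :: "'v set \<Rightarrow> ('v \<Rightarrow> 'v) set \<Rightarrow> 'v set set" where
  "common_eigenspaces V H =
     {W. W \<noteq> {0} \<and> (\<exists>\<alpha>. W = {v \<in> V. \<forall>h\<in>H. h v = scale (\<alpha> h) v})}"

definition nondegenerate_symmetric_form :: "'v set \<Rightarrow> ('v \<Rightarrow> 'v \<Rightarrow> complex) \<Rightarrow> bool" where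
  "nondegenerate_symmetric_form V B \<longleftrightarrow>
     (\<forall>u\<in>V. \<forall>v\<in>V. \<forall>w\<in>V. B (u + v) w = B u w + B v w) \<and>
     (\<forall>c. \<forall>u\<in>V. \<forall>w\<in>V. B (scale c u) w = c * B u w) \<and>
     (\<forall>u\<in>V. \<forall>w\<in>V. B u w = B w u) \<and>
     (\<forall>u\<in>V. (\<forall>w\<in>V. B u w = 0) \<longrightarrow> u = 0)"

text \<open>
  The labellings \<open>E\<close>, \<open>Es\<close> of the common eigenspaces and the form \<open>B\<close> are explicit arguments,
  because the factorization conditions below refer to the same choices.
\<close>

definition A2_Leonard_pair ::
  "nat \<Rightarrow> 'v set \<Rightarrow> ('v \<Rightarrow> 'v) set \<Rightarrow> ('v \<Rightarrow> 'v) set \<Rightarrow>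
   (nat \<times> nat \<Rightarrow> 'v set) \<Rightarrow> (nat \<times> nat \<Rightarrow> 'v set) \<Rightarrow> ('v \<Rightarrow> 'v \<Rightarrow> complex) \<Rightarrow> bool" where
  "A2_Leonard_pair N V H Hs E Es B \<longleftrightarrow>
     subspace V \<and>
     (\<forall>K\<in>{H, Hs}. K \<subseteq> End V \<and> endo.subspace K \<and> endo.dim K = 2 \<and>
        (\<forall>h\<in>K. diagonalizable_on V h) \<and>
        (\<forall>g\<in>K. \<forall>h\<in>K. g \<circ> h = h \<circ> g)) \<and>
     bij_betw E (dom2 N) (common_eigenspaces V H) \<and>
     (\<forall>p\<in>dom2 N. \<forall>h\<in>Hs. h ` E p \<subseteq> span (\<Union>q\<in>{q \<in> dom2 N. A2_adjacent q p}. E q)) \<and>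
     bij_betw Es (dom2 N) (common_eigenspaces V Hs) \<and>
     (\<forall>p\<in>dom2 N. \<forall>h\<in>H. h ` Es p \<subseteq> span (\<Union>q\<in>{q \<in> dom2 N. A2_adjacent q p}. Es q)) \<and>
     \<not> (\<exists>W. subspace W \<and> W \<subseteq> V \<and> W \<noteq> {0} \<and> W \<noteq> V \<and>
            (\<forall>h\<in>H. h ` W \<subseteq> W) \<and> (\<forall>h\<in>Hs. h ` W \<subseteq> W)) \<and>
     (\<forall>p\<in>dom2 N. dim (E p) = 1 \<and> dim (Es p) = 1) \<and>
     nondegenerate_symmetric_form V B \<and>
     (\<forall>p\<in>dom2 N. \<forall>q\<in>dom2 N. p \<noteq> q \<longrightarrow>
        (\<forall>u\<in>E p. \<forall>w\<in>E q. B u w = 0) \<and> (\<forall>u\<in>Es p. \<forall>w\<in>Es q. B u w = 0))"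

definition factorized_A2_Leonard_pair ::
  "nat \<Rightarrow> 'v set \<Rightarrow> ('v \<Rightarrow> 'v) set \<Rightarrow> ('v \<Rightarrow> 'v) set \<Rightarrow>
   (nat \<times> nat \<Rightarrow> 'v set) \<Rightarrow> (nat \<times> nat \<Rightarrow> 'v set) \<Rightarrow> ('v \<Rightarrow> 'v \<Rightarrow> complex) \<Rightarrow>
   ('v \<Rightarrow> 'v) \<Rightarrow> ('v \<Rightarrow> 'v) \<Rightarrow> ('v \<Rightarrow> 'v) \<Rightarrow> ('v \<Rightarrow> 'v) \<Rightarrow> bool" where
  "factorized_A2_Leonard_pair N V H Hs E Es B X Y Xs Ys \<longleftrightarrow>
     A2_Leonard_pair N V H Hs E Es B \<and>
     X \<noteq> Y \<and> endo.independent {X, Y} \<and> endo.span {X, Y} = H \<and>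
     Xs \<noteq> Ys \<and> endo.independent {Xs, Ys} \<and> endo.span {Xs, Ys} = Hs \<and>
     (\<exists>t :: nat \<Rightarrow> complex. inj_on t {0..N} \<and>
        (\<forall>(x, y)\<in>dom2 N. \<forall>v\<in>E (x, y). X v = scale (t x) v)) \<and>
     (\<exists>\<theta>s :: nat \<Rightarrow> complex. inj_on \<theta>s {0..N} \<and>
        (\<forall>(i, j)\<in>dom2 N. \<forall>v\<in>Es (i, j). Ys v = scale (\<theta>s j) v)) \<and>
     X \<circ> Ys = Ys \<circ> X \<and>
     (\<forall>W\<in>common_eigenspaces V {X, Ys}. dim W = 1) \<and>
     (\<forall>i j. (i, j) \<in> dom2 N \<and> (i + 1, j) \<in> dom2 N \<longrightarrow>
        (\<exists>u\<in>Es (i + 1, j). \<exists>w\<in>Es (i, j). B u (X w) \<noteq> 0) \<and>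
        (\<exists>u\<in>Es (i, j). \<exists>w\<in>Es (i + 1, j). B u (X w) \<noteq> 0)) \<and>
     (\<forall>x y. (x, y) \<in> dom2 N \<and> (x, y + 1) \<in> dom2 N \<longrightarrow>
        (\<exists>u\<in>E (x, y + 1). \<exists>w\<in>E (x, y). B u (Ys w) \<noteq> 0) \<and>
        (\<exists>u\<in>E (x, y). \<exists>w\<in>E (x, y + 1). B u (Ys w) \<noteq> 0))"

end

text \<open>
  A concrete ambient space, which contains subspaces of every finite dimension (up to isomorphism,
  all finite-dimensional complex vector spaces).
\<close>

definition fun_scale :: "complex \<Rightarrow> (nat \<times> nat \<Rightarrow> complex) \<Rightarrow> (nat \<times> nat \<Rightarrow> complex)" where
  "fun_scale c f = (\<lambda>p. c * f p)"

interpretation fun_space: complex_vector_space fun_scale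
  by unfold_locales (auto simp: fun_scale_def fun_eq_iff algebra_simps)


section \<open>Parameter arrays\<close>

text \<open>
  Sequences are total functions on \<open>nat\<close>, used only for indices \<open>0..d\<close> (\<open>\<theta>\<close>, \<open>\<theta>s\<close>) and
  \<open>1..d\<close> (\<open>\<phi>\<close>, \<open>\<psi>\<close>). The letters \<open>\<phi>\<close>, \<open>\<psi>\<close> stand for the first and the second split
  sequence, in this order. For \<open>d \<le> 2\<close> the range \<open>2..d - 1\<close> is empty.
\<close>

definition parameter_array ::
  "nat \<Rightarrow> (nat \<Rightarrow> complex) \<Rightarrow> (nat \<Rightarrow> complex) \<Rightarrow> (nat \<Rightarrow> complex) \<Rightarrow> (nat \<Rightarrow> complex) \<Rightarrow> bool" where
  "parameter_array d \<theta> \<theta>s \<phi> \<psi> \<longleftrightarrow>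
     (\<forall>i\<in>{1..d}. \<phi> i \<noteq> 0 \<and> \<psi> i \<noteq> 0) \<and>
     inj_on \<theta> {0..d} \<and> inj_on \<theta>s {0..d} \<and>
     (let vt = (\<lambda>i. \<Sum>h<i. (\<theta> h - \<theta> (d - h)) / (\<theta> 0 - \<theta> d)) in
      \<forall>i\<in>{1..d}. \<phi> i = \<psi> 1 * vt i + (\<theta>s i - \<theta>s 0) * (\<theta> (i - 1) - \<theta> d) \<and>
                 \<psi> i = \<phi> 1 * vt i + (\<theta>s i - \<theta>s 0) * (\<theta> (d - i + 1) - \<theta> 0)) \<and>
     (\<exists>\<beta>. \<forall>i\<in>{2..d - 1}. (\<theta> (i - 2) - \<theta> (i + 1)) / (\<theta> (i - 1) - \<theta> i) = \<beta> \<and>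
                        (\<theta>s (i - 2) - \<theta>s (i + 1)) / (\<theta>s (i - 1) - \<theta>s i) = \<beta>)"


section \<open>The Hahn / dual Hahn data\<close>

definition t_val :: "nat \<Rightarrow> complex" where
  "t_val x = of_nat x"

definition ts_val :: "complex \<Rightarrow> complex \<Rightarrow> nat \<Rightarrow> nat \<Rightarrow> complex" where
  "ts_val ms ss j x = ms * of_nat x * (of_nat x + 1 + ss + of_nat j)"

definition f_val :: "nat \<Rightarrow> complex \<Rightarrow> complex \<Rightarrow> nat \<Rightarrow> nat \<Rightarrow> complex" where
  "f_val N ms r j x =
     ms * of_nat x * (of_nat x - of_nat N + of_nat j - 1) * (of_nat x + r)"

definition g_val :: "nat \<Rightarrow> complex \<Rightarrow> complex \<Rightarrow> complex \<Rightarrow> nat \<Rightarrow> nat \<Rightarrow> complex" where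
  "g_val N ms ss r j x =
     - ms * of_nat x * (of_nat x - of_nat N + of_nat j - 1) * (of_nat x + ss + of_nat j - r)"

definition theta_val :: "complex \<Rightarrow> complex \<Rightarrow> nat \<Rightarrow> nat \<Rightarrow> complex" where
  "theta_val \<mu> \<sigma> x j = \<mu> * of_nat j * (of_nat j + 1 + \<sigma> + of_nat x)"

definition thetas_val :: "nat \<Rightarrow> complex" where
  "thetas_val j = of_nat j"

definition phi1_val :: "nat \<Rightarrow> complex \<Rightarrow> complex \<Rightarrow> nat \<Rightarrow> nat \<Rightarrow> complex" where
  "phi1_val N \<mu> \<rho> x j =
     \<mu> * of_nat j * (of_nat j - of_nat N + of_nat x - 1) * (of_nat j + \<rho>)"

definition phi2_val :: "nat \<Rightarrow> complex \<Rightarrow> complex \<Rightarrow> complex \<Rightarrow> nat \<Rightarrow> nat \<Rightarrow> complex" where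
  "phi2_val N \<mu> \<sigma> \<rho> x j =
     \<mu> * of_nat j * (of_nat j - of_nat N + of_nat x - 1) * (of_nat j + \<rho> - \<sigma> - of_nat N - 1)"

text \<open>
  In the terminating series below a lower parameter is a negative integer; cutting the sum at
  \<open>min i x\<close> (resp. \<open>min j y\<close>) drops only terms with zero numerator and avoids division by zero.
\<close>

definition hyp3F2_upto ::
  "nat \<Rightarrow> complex \<Rightarrow> complex \<Rightarrow> complex \<Rightarrow> complex \<Rightarrow> complex \<Rightarrow> complex \<Rightarrow> complex" where
  "hyp3F2_upto n a1 a2 a3 b1 b2 z =
     (\<Sum>k = 0..n. (pochhammer a1 k * pochhammer a2 k * pochhammer a3 k) /
                  (pochhammer b1 k * pochhammer b2 k) * (z ^ k / fact k))"

definition T_coeff ::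
  "nat \<Rightarrow> complex \<Rightarrow> complex \<Rightarrow> complex \<Rightarrow> complex \<Rightarrow> nat \<Rightarrow> nat \<Rightarrow> nat \<Rightarrow> nat \<Rightarrow> complex" where
  "T_coeff N ss r \<sigma> \<rho> i j x y =
     of_nat ((N - j) choose i) * of_nat ((N - x) choose j) *
     (((- 1) ^ j * pochhammer (r + 1) i * pochhammer (2 + ss + of_nat j) (N - j) *
         pochhammer (\<rho> + 1) j) /
      (pochhammer (ss + of_nat j - r + 1) i * pochhammer (ss + of_nat j + 1 + of_nat i) i *
         pochhammer (ss + of_nat j + 2 * of_nat i + 2) (N - j - i) *
         pochhammer (\<rho> - \<sigma> - of_nat N) j)) *
     hyp3F2_upto (min i x)
       (- of_nat i) (of_nat i + 1 + ss + of_nat j) (- of_nat x)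
       (r + 1) (- of_nat N + of_nat j) 1 *
     hyp3F2_upto (min j y)
       (- of_nat j) (- of_nat y) (of_nat y + 1 + \<sigma> + of_nat x)
       (\<rho> + 1) (- of_nat N + of_nat x) 1"

end

theory Submission
  imports Defs
begin

text \<open>
  Up to factors depending only on \<open>(x, y)\<close> or only on \<open>(i, j)\<close>, the coefficient \<open>T\<close> is the kernel
  \<open>Q\<^sub>y(j; \<rho>, \<sigma> + x, N - x) Q\<^sub>i(x; r, ss + j, N - j) / (N - x - j)!\<close> with Hahn polynomials \<open>Q\<close>,
  which is invariant under exchanging \<open>(x, y; \<rho>, \<sigma>)\<close> and \<open>(j, i; r, ss)\<close>. The contiguity relations of
  \<open>Q\<^sub>y\<close> in \<open>(x, y)\<close> give a lowering matrix \<open>L\<close> (\<open>x\<close> to \<open>x + 1\<close>) and a raising matrix \<open>R\<close> (\<open>x\<close> to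
  \<open>x - 1\<close>), acting on a kernel \<open>Q\<^sub>y(j) g(x) / (N - x - j)!\<close> by \<open>g(x) \<mapsto> (N - x - j) g(x + 1)\<close> and
  \<open>g(x) \<mapsto> g(x - 1)\<close>. Hence \<open>N - x - L R\<close> multiplies by \<open>j\<close>, and the Hahn difference equation in \<open>x\<close>
  becomes a seven-point operator in \<open>(x, y)\<close>; these are \<open>Ys\<close> and \<open>Xs\<close>. The symmetry of the kernel
  yields the action of \<open>X\<close> and \<open>Y\<close> on the dual basis. An explicit weight makes \<open>L\<close> and \<open>R\<close> adjoint up
  to a factor depending on \<open>x\<close>, so all four operators are self-adjoint and the joint eigenvectors
  of \<open>Xs, Ys\<close> are orthogonal.
\<close>

section \<open>Hahn polynomials as finite sums\<close>

text \<open>The parameters are coupled as \<open>c + x\<close>, \<open>N - x\<close> and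
  \<open>c' + j\<close>, \<open>N - j\<close> for two reasons. A contiguity step that changes
  \<open>c\<close> and the size \<open>M\<close> by opposite units is then exactly a step in
  \<open>x\<close>, for all \<open>j\<close> at once. And the difference equation of
  \<open>Q\<^sub>i(x; a', c' + j, N - j)\<close> has the coefficients
  \<open>(x + a' + 1) (x - N + j)\<close> and \<open>x (x - c' - j + a' - (N - j) - 1)\<close>: in
  the second one \<open>j\<close> cancels, in the first it enters only through the factor
  \<open>N - x - j\<close>, which \<open>L\<close> and \<open>L R\<close> create. So the seven-point
  operator does not depend on \<open>j\<close>. The factor \<open>1 / (N - x - j)!\<close> is the
  part of the binomial coefficient of \<open>N - x\<close> over \<open>j\<close> that mixes
  \<open>x\<close> and \<open>j\<close>. The obstacle throughout is degenerate denominators: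
  regularity leaves \<open>c + 1 = 0\<close> possible, and at \<open>y = N - x\<close> a contiguity
  relation meets a polynomial whose degree exceeds its size. Hence the multiplied-out identities and
  the extra cases. Norms of the joint eigenvectors are never computed; that they are nonzero follows
  from nondegeneracy of the form.\<close>

text \<open>The Hahn polynomial \<open>Q\<^sub>n(x; \<alpha>, \<beta>, M)\<close> with \<open>a = \<alpha>\<close> and \<open>c = \<alpha> + \<beta>\<close>, for \<open>n \<le> M\<close>.\<close>

definition hahn :: "nat \<Rightarrow> nat \<Rightarrow> complex \<Rightarrow> complex \<Rightarrow> complex \<Rightarrow> complex" where
  "hahn n M a c x =
     (\<Sum>k\<le>n. pochhammer (- of_nat n) k * pochhammer (of_nat n + 1 + c) k /
        (pochhammer (a + 1) k * pochhammer (- of_nat M) k * fact k) * pochhammer (- x) k)"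

section \<open>Pochhammer symbols, difference equation and contiguity relations\<close>

lemma pochhammer_neg_nat_nonzero:
  "k \<le> M \<Longrightarrow> pochhammer (- of_nat M :: complex) k \<noteq> 0"
  by (auto simp: pochhammer_eq_0_iff)

lemma pochhammer_neg_nat_eq_0:
  "M < k \<Longrightarrow> pochhammer (- of_nat M :: complex) k = 0"
  by (auto simp: pochhammer_eq_0_iff)

lemma pochhammer_nonzero:
  assumes "\<And>k. 1 \<le> k \<Longrightarrow> k \<le> n \<Longrightarrow> a + of_nat k \<noteq> (0::complex)"
  shows "pochhammer (a + 1) n \<noteq> 0"
proof
  assume "pochhammer (a + 1) n = 0"
  then obtain k where k: "k < n" "a + 1 = - of_nat k" by (auto simp: pochhammer_eq_0_iff)
  have "a + of_nat (Suc k) = (a + 1) + of_nat k" by simp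
  also have "\<dots> = 0" unfolding k(2) by simp
  finally have "a + of_nat (Suc k) = 0" .
  moreover have "a + of_nat (Suc k) \<noteq> 0" using k(1) by (intro assms) auto
  ultimately show False by contradiction
qed

lemma hahn_0: "hahn n M a c 0 = 1"
proof -
  have "hahn n M a c 0 = (\<Sum>k\<le>n. if k = 0 then 1 else 0)"
    unfolding hahn_def by (rule sum.cong) (auto simp: pochhammer_0_left)
  then show ?thesis by simp
qed

lemma hahn_degree_0 [simp]: "hahn 0 M a c x = 1"
  by (simp add: hahn_def)

text \<open>In the basis \<open>pochhammer (- x) k\<close> the difference operator is bidiagonal:
  index \<open>k\<close> goes to \<open>k (k + c + 1)\<close> times itself minus
  \<open>k (k + a) (k - 1 - M)\<close> times index \<open>k - 1\<close>. The ratio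
  \<open>q (k + 1) / q k\<close> turns the second part into \<open>(k - n) (k + n + 1 + c)\<close>
  at index \<open>k\<close>, and
  \<open>k (k + c + 1) - (k - n) (k + n + 1 + c) = n (n + c + 1)\<close>.\<close>

lemma hahn_difference:
  assumes "n \<le> M" and a: "\<And>k. 1 \<le> k \<Longrightarrow> k \<le> n \<Longrightarrow> a + of_nat k \<noteq> 0"
  shows "(x + a + 1) * (x - of_nat M) * (hahn n M a c (x + 1) - hahn n M a c x)
         - x * (x - c + a - of_nat M - 1) * (hahn n M a c x - hahn n M a c (x - 1))
         = of_nat n * (of_nat n + c + 1) * hahn n M a c x"
proof -
  define q where "q k = pochhammer (- of_nat n) k * pochhammer (of_nat n + 1 + c) k /
        (pochhammer (a + 1) k * pochhammer (- of_nat M) k * fact k)" for k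
  define \<Delta> where "\<Delta> k =
    (x + a + 1) * (x - of_nat M) * (pochhammer (- (x + 1)) k - pochhammer (- x) k)
         - x * (x - c + a - of_nat M - 1) * (pochhammer (- x) k - pochhammer (- (x - 1)) k)" for k
  have h: "hahn n M a c z = (\<Sum>k\<le>n. q k * pochhammer (- z) k)" for z
    unfolding hahn_def q_def ..
  have "(x + a + 1) * (x - of_nat M) * (hahn n M a c (x + 1) - hahn n M a c x)
         - x * (x - c + a - of_nat M - 1) * (hahn n M a c x - hahn n M a c (x - 1))
      = (\<Sum>k\<le>n. q k * \<Delta> k)"
    unfolding h \<Delta>_def
    by (simp add: sum_subtractf sum_distrib_left algebra_simps sum.distrib)
  also have "\<dots> = (\<Sum>k\<le>n. q k * (of_nat k * (of_nat k + c + 1) * pochhammer (- x) k))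
      - (\<Sum>k\<le>n. q k * (of_nat k * (of_nat k + a) * (of_nat k - 1 - of_nat M) * pochhammer (- x) (k - 1)))"
  proof -
    have "\<Delta> k = of_nat k * (of_nat k + c + 1) * pochhammer (- x) k
       - of_nat k * (of_nat k + a) * (of_nat k - 1 - of_nat M) * pochhammer (- x) (k - 1)" for k
    proof (cases k)
      case 0 then show ?thesis by (simp add: \<Delta>_def)
    next
      case (Suc m)
      have 1: "pochhammer (- x - 1) (Suc m) = (- x - 1) * pochhammer (- x) m"
        by (subst pochhammer_rec) simp
      have 2: "pochhammer (- x) (Suc m) = pochhammer (- x) m * (- x + of_nat m)"
        by (simp add: pochhammer_Suc)
      have 3: "- x * pochhammer (1 - x) m = pochhammer (- x) m * (- x + of_nat m)"
        using pochhammer_rec[of "- x" m] 2 by (simp add: algebra_simps)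
      have 4: "x * pochhammer (1 - x) (Suc m) = pochhammer (- x) m * (x - of_nat m) * (1 - x + of_nat m)"
        using 3 by (simp add: pochhammer_Suc algebra_simps)
      have "\<Delta> k = (x + a + 1) * (x - of_nat M) * ((- x - 1) * pochhammer (- x) m - pochhammer (- x) m * (- x + of_nat m))
         - (x - c + a - of_nat M - 1) * (x * pochhammer (- x) (Suc m) - x * pochhammer (1 - x) (Suc m))"
      proof -
        have e: "- (x + 1) = - x - 1" "- (x - 1) = 1 - x" by simp_all
        show ?thesis unfolding \<Delta>_def Suc e 1 unfolding 2 by (simp add: algebra_simps)
      qed
      also have "\<dots> = of_nat k * (of_nat k + c + 1) * (pochhammer (- x) m * (- x + of_nat m))
       - of_nat k * (of_nat k + a) * (of_nat k - 1 - of_nat M) * pochhammer (- x) m"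
        unfolding 4 2 Suc by (simp add: algebra_simps)
      finally show ?thesis unfolding Suc 2 by simp
    qed
    then show ?thesis by (simp add: sum_subtractf right_diff_distrib)
  qed
  also have "(\<Sum>k\<le>n. q k * (of_nat k * (of_nat k + a) * (of_nat k - 1 - of_nat M) * pochhammer (- x) (k - 1)))
     = (\<Sum>k\<le>n. q k * ((of_nat k - of_nat n) * (of_nat k + of_nat n + 1 + c) * pochhammer (- x) k))"
  proof -
    have "q (Suc k) * (of_nat (Suc k) * (of_nat (Suc k) + a) * (of_nat (Suc k) - 1 - of_nat M) * pochhammer (- x) k)
      = q k * ((of_nat k - of_nat n) * (of_nat k + of_nat n + 1 + c) * pochhammer (- x) k)" if "k < n" for k
    proof -
      have nz: "a + 1 + of_nat k \<noteq> 0" "of_nat k - of_nat M \<noteq> (0::complex)" "of_nat (Suc k) \<noteq> (0::complex)"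
        "pochhammer (- of_nat M :: complex) k \<noteq> 0" "pochhammer (a + 1) k \<noteq> 0"
      proof -
        show "a + 1 + of_nat k \<noteq> 0" using a[of "Suc k"] that by (simp add: add.assoc)
        show "of_nat k - of_nat M \<noteq> (0::complex)" using that assms(1) by simp
        show "of_nat (Suc k) \<noteq> (0::complex)" by (rule of_nat_neq_0)
        show "pochhammer (- of_nat M :: complex) k \<noteq> 0" using that assms(1) by (intro pochhammer_neg_nat_nonzero) simp
        show "pochhammer (a + 1) k \<noteq> 0" using that by (intro pochhammer_nonzero a) auto
      qed
      have qq: "q (Suc k) * (of_nat (Suc k) * (a + 1 + of_nat k) * (of_nat k - of_nat M))
         = q k * ((of_nat k - of_nat n) * (of_nat k + of_nat n + 1 + c))"
        using nz unfolding q_def pochhammer_Suc fact_Suc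
        by (simp add: divide_simps del: of_nat_Suc)
      have "q (Suc k) * (of_nat (Suc k) * (of_nat (Suc k) + a) * (of_nat (Suc k) - 1 - of_nat M) * pochhammer (- x) k)
        = (q (Suc k) * (of_nat (Suc k) * (a + 1 + of_nat k) * (of_nat k - of_nat M))) * pochhammer (- x) k"
        by (simp add: algebra_simps)
      then show ?thesis unfolding qq by (simp only: mult.assoc)
    qed
    note step = this
    have "(\<Sum>k\<le>n. q k * (of_nat k * (of_nat k + a) * (of_nat k - 1 - of_nat M) * pochhammer (- x) (k - 1)))
      = (\<Sum>k<n. q (Suc k) * (of_nat (Suc k) * (of_nat (Suc k) + a) * (of_nat (Suc k) - 1 - of_nat M) * pochhammer (- x) k))"
      unfolding lessThan_Suc_atMost[symmetric] sum.lessThan_Suc_shift by simp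
    also have "\<dots> = (\<Sum>k<n. q k * ((of_nat k - of_nat n) * (of_nat k + of_nat n + 1 + c) * pochhammer (- x) k))"
      by (intro sum.cong step) auto
    \<comment> \<open>The shifted sum stops at \<open>n - 1\<close>; the term \<open>k = n\<close>
      is added freely because of its factor \<open>k - n\<close>.\<close>
    also have "\<dots> = (\<Sum>k\<le>n. q k * ((of_nat k - of_nat n) * (of_nat k + of_nat n + 1 + c) * pochhammer (- x) k))"
      unfolding lessThan_Suc_atMost[symmetric] by simp
    finally show ?thesis .
  qed
  also have "(\<Sum>k\<le>n. q k * (of_nat k * (of_nat k + c + 1) * pochhammer (- x) k)) - \<dots>
    = of_nat n * (of_nat n + c + 1) * hahn n M a c x"
    unfolding h sum_subtractf[symmetric] sum_distrib_left
    by (rule sum.cong) (simp_all add: algebra_simps)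
  finally show ?thesis .
qed

text \<open>The relation holds for each coefficient of \<open>pochhammer (- j) k\<close>: without
  the common factors it reads \<open>A (C + k) / C + (1 - A) (y - k) / y = (M - k) / M\<close> with
  \<open>C = y + 1 + c\<close>. Both sides are linear in \<open>k\<close> and agree at
  \<open>k = 0\<close>; equality of the slopes is what fixes \<open>A\<close>. For
  \<open>y = M\<close> the coefficient \<open>A\<close> is zero, which removes the polynomial of
  degree \<open>y\<close> and size \<open>M - 1\<close>. The assumption \<open>j < M\<close> kills
  the term \<open>k = M\<close>, where the denominator \<open>pochhammer (1 - M) k\<close> is
  zero.\<close>

lemma hahn_lower:
  fixes y M j :: nat
  assumes "y \<le> M" "j < M" "c + of_nat y + 1 \<noteq> 0 \<or> y = M" "2 * of_nat y + 1 + c \<noteq> 0 \<or> y = M"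
    and "0 < y"
  defines "A \<equiv> (of_nat y + 1 + c) * (of_nat M - of_nat y) / (of_nat M * (2 * of_nat y + 1 + c))"
  shows "hahn y M a c (of_nat j) =
     A * hahn y (M - 1) a (c + 1) (of_nat j) + (1 - A) * hahn (y - 1) (M - 1) a (c + 1) (of_nat j)"
proof -
  define d where "d k = pochhammer (- of_nat j :: complex) k / (pochhammer (a + 1) k * fact k)" for k
  have M: "of_nat (M - 1) = (of_nat M :: complex) - 1" and y: "of_nat (y - 1) = (of_nat y :: complex) - 1"
    using assms by (auto simp: of_nat_diff)
  define C where "C = of_nat y + 1 + c"
  have neg: "- of_nat (M - 1) = 1 - (of_nat M :: complex)" "- of_nat (y - 1) = 1 - (of_nat y :: complex)"
    using M y by auto
  have h1: "hahn y M a c (of_nat j) = (\<Sum>k\<le>y. d k * (pochhammer (- of_nat y) k * pochhammer C k / pochhammer (- of_nat M) k))"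
    unfolding hahn_def d_def C_def by (rule sum.cong) (auto simp: mult_ac)
  have h2: "hahn y (M - 1) a (c + 1) (of_nat j)
     = (\<Sum>k\<le>y. d k * (pochhammer (- of_nat y) k * pochhammer (1 + C) k / pochhammer (1 - of_nat M) k))"
    unfolding hahn_def d_def C_def neg by (rule sum.cong) (auto simp: algebra_simps)
  have "hahn (y - 1) (M - 1) a (c + 1) (of_nat j)
     = (\<Sum>k\<le>y - 1. d k * (pochhammer (1 - of_nat y) k * pochhammer C k / pochhammer (1 - of_nat M) k))"
    unfolding hahn_def d_def C_def neg y by (rule sum.cong) (auto simp: algebra_simps)
  also have "\<dots> = (\<Sum>k\<le>y. d k * (pochhammer (1 - of_nat y) k * pochhammer C k / pochhammer (1 - of_nat M) k))"
  proof (rule sum.mono_neutral_left)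
    show "\<forall>k\<in>{..y} - {..y - 1}. d k * (pochhammer (1 - of_nat y) k * pochhammer C k / pochhammer (1 - of_nat M) k) = 0"
    proof
      fix k assume "k \<in> {..y} - {..y - 1}"
      then have "y - 1 < k" by auto
      then have "pochhammer (1 - of_nat y :: complex) k = 0" using neg(2) pochhammer_neg_nat_eq_0 by metis
      then show "d k * (pochhammer (1 - of_nat y) k * pochhammer C k / pochhammer (1 - of_nat M) k) = 0" by simp
    qed
  qed auto
  finally have h3: "hahn (y - 1) (M - 1) a (c + 1) (of_nat j) = \<dots>" .
  have "d k * (pochhammer (- of_nat y) k * pochhammer C k / pochhammer (- of_nat M) k)
     = d k * (A * (pochhammer (- of_nat y) k * pochhammer (1 + C) k / pochhammer (1 - of_nat M) k)
       + (1 - A) * (pochhammer (1 - of_nat y) k * pochhammer C k / pochhammer (1 - of_nat M) k))" (is "d k * ?l = d k * ?r")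
    if "k \<le> y" for k
  proof (cases "k < M")
    case False
    then have "d k = 0" using that assms by (auto simp: d_def pochhammer_neg_nat_eq_0)
    then show ?thesis by simp
  next
    case True
    have nz: "(of_nat k :: complex) - of_nat M \<noteq> 0" "(of_nat M :: complex) \<noteq> 0" "(of_nat y :: complex) \<noteq> 0" using True assms by auto
    have pM: "pochhammer (- of_nat M) k \<noteq> (0::complex)" using True by (simp add: pochhammer_neg_nat_nonzero)
    have e: "z * pochhammer (1 + z) k = pochhammer z k * (z + of_nat k)" for z :: complex
      using pochhammer_rec[of z k] pochhammer_Suc[of z k] by (simp add: add.commute)
    have eM: "pochhammer (1 - of_nat M) k = pochhammer (- of_nat M) k * (of_nat M - of_nat k) / (of_nat M :: complex)"
      using e[of "- of_nat M"] nz by (simp add: field_simps)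
    have ey: "pochhammer (1 - of_nat y) k = pochhammer (- of_nat y) k * (of_nat y - of_nat k) / (of_nat y :: complex)"
      using e[of "- of_nat y"] nz by (simp add: field_simps)
    have "?l = ?r"
    proof (cases "y = M")
      case True
      then have "A = 0" by (simp add: A_def)
      then show ?thesis using True pM nz by (simp add: eM)
    next
      case False
      then have C: "C \<noteq> 0" "C + of_nat y \<noteq> 0" using assms by (auto simp: C_def algebra_simps)
      have eC: "pochhammer (1 + C) k = pochhammer C k * (C + of_nat k) / C"
        using e[of "C"] C by (simp add: field_simps)
      have A: "A = C * (of_nat M - of_nat y) / (of_nat M * (C + of_nat y))"
        by (simp add: A_def C_def algebra_simps)
      have key: "A * (C + of_nat k) / C + (1 - A) * (of_nat y - of_nat k) / of_nat y = (of_nat M - of_nat k) / of_nat M"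
        using C nz unfolding A by (simp add: divide_simps) (simp add: algebra_simps)
      have "?r = pochhammer (- of_nat y) k * pochhammer C k / pochhammer (1 - of_nat M) k *
         (A * (C + of_nat k) / C + (1 - A) * (of_nat y - of_nat k) / of_nat y)"
        unfolding ey eC by (simp add: algebra_simps)
      also have "\<dots> = ?l" unfolding key eM using pM nz by (simp add: divide_simps)
      finally show ?thesis ..
    qed
    then show ?thesis by simp
  qed
  then show ?thesis
    unfolding h1 h2 h3 sum_distrib_left sum.distrib[symmetric]
    by (intro sum.cong) (auto simp: algebra_simps)
qed

text \<open>The splitting \<open>M + 1 - z = (M + 1 - k) + (k - z)\<close> in front of
  \<open>pochhammer (- z) k\<close> raises the index by at most one, so coefficients of
  \<open>pochhammer (- z) (k + 1)\<close> can be compared. The two unknown factors \<open>P\<close>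
  and \<open>Q\<close> are determined by the two linear conditions in \<open>PQ\<close>.\<close>

lemma hahn_raise:
  fixes y M :: nat
  assumes "y \<le> M" and D: "2 * of_nat y + 1 + c \<noteq> 0"
    and a: "\<And>k. 1 \<le> k \<Longrightarrow> k \<le> Suc y \<Longrightarrow> a + of_nat k \<noteq> 0"
  shows "(of_nat M + 1 - z) * hahn y M a c z =
     (of_nat M + 1) * (of_nat y + c - a) / (2 * of_nat y + 1 + c) * hahn y (Suc M) a (c - 1) z
   + (of_nat M + 1) * (of_nat y + 1 + a) / (2 * of_nat y + 1 + c) * hahn (Suc y) (Suc M) a (c - 1) z"
proof -
  define C where "C = of_nat y + 1 + c"
  define A where "A = - (of_nat y :: complex)"
  define P where "P = (of_nat M + 1) * (of_nat y + c - a) / (2 * of_nat y + 1 + c)"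
  define Q where "Q = (of_nat M + 1) * (of_nat y + 1 + a) / (2 * of_nat y + 1 + c)"
  define e where "e = - (of_nat M :: complex)"
  define d where "d k = pochhammer A k * pochhammer C k / (pochhammer (a + 1) k * pochhammer e k * fact k)" for k
  define d1 where "d1 k = pochhammer A k * pochhammer (C - 1) k / (pochhammer (a + 1) k * pochhammer (e - 1) k * fact k)" for k
  define d2 where "d2 k = pochhammer (A - 1) k * pochhammer C k / (pochhammer (a + 1) k * pochhammer (e - 1) k * fact k)" for k
  have A0: "pochhammer A (Suc y) = 0" unfolding A_def by (rule pochhammer_neg_nat_eq_0) simp
  have neg: "- of_nat (Suc M) = e - 1" "- of_nat (Suc y) = A - 1" "of_nat (Suc y) + 1 + (c - 1) = C"
    "of_nat y + 1 + (c - 1) = C - 1"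
    by (auto simp: e_def A_def C_def)
  have h: "hahn y M a c z = (\<Sum>k\<le>y. d k * pochhammer (- z) k)"
    unfolding hahn_def d_def A_def C_def e_def ..
  have h1: "hahn y (Suc M) a (c - 1) z = (\<Sum>k\<le>Suc y. d1 k * pochhammer (- z) k)"
    using A0 unfolding hahn_def neg d1_def by (simp add: A_def)
  have h2: "hahn (Suc y) (Suc M) a (c - 1) z = (\<Sum>k\<le>Suc y. d2 k * pochhammer (- z) k)"
    unfolding hahn_def neg d2_def ..
  have PQ: "P + Q = of_nat M + 1" "P * (C - 1) + Q * (A - 1) = (of_nat M + 1) * (A + C - 2 - a)"
    using D unfolding P_def Q_def A_def C_def by (simp_all add: divide_simps) (simp_all add: algebra_simps)
  have eM: "of_nat M + 1 = 1 - e" by (simp add: e_def)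
  have "(of_nat M + 1 - z) * hahn y M a c z
     = (\<Sum>k\<le>y. d k * ((of_nat M + 1 - of_nat k) * pochhammer (- z) k) + d k * pochhammer (- z) (Suc k))"
    unfolding h sum_distrib_left by (rule sum.cong) (auto simp: pochhammer_Suc algebra_simps)
  also have "\<dots> = (\<Sum>k\<le>Suc y. d k * ((of_nat M + 1 - of_nat k) * pochhammer (- z) k)) + (\<Sum>k\<le>y. d k * pochhammer (- z) (Suc k))"
    by (simp add: sum.distrib d_def A0)
  also have "\<dots> = d 0 * (of_nat M + 1) + (\<Sum>k\<le>y. (d (Suc k) * (of_nat M - of_nat k) + d k) * pochhammer (- z) (Suc k))"
    unfolding sum.atMost_Suc_shift[of _ y] add.assoc sum.distrib[symmetric]
    by (simp add: algebra_simps)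
  also have "\<dots> = (P * d1 0 + Q * d2 0) + (\<Sum>k\<le>y. (P * d1 (Suc k) + Q * d2 (Suc k)) * pochhammer (- z) (Suc k))"
  proof -
    have "d (Suc k) * (of_nat M - of_nat k) + d k = P * d1 (Suc k) + Q * d2 (Suc k)" if "k \<le> y" for k
    proof -
      have nz: "pochhammer e k \<noteq> 0" "pochhammer (a + 1) k \<noteq> 0" "a + 1 + of_nat k \<noteq> 0" "e - 1 \<noteq> 0" "of_nat (Suc k) \<noteq> (0::complex)"
      proof -
        show "pochhammer e k \<noteq> 0" using that assms(1) by (simp add: e_def pochhammer_neg_nat_nonzero)
        show "pochhammer (a + 1) k \<noteq> 0" using that by (intro pochhammer_nonzero a) auto
        show "a + 1 + of_nat k \<noteq> 0" using a[of "Suc k"] that by (simp add: add.assoc)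
        show "e - 1 \<noteq> 0" using of_nat_neq_0[of M, where 'a=complex] eM by (auto simp: algebra_simps)
        show "of_nat (Suc k) \<noteq> (0::complex)" by (rule of_nat_neq_0)
      qed
      \<comment> \<open>The common factor of all four coefficients: \<open>d k\<close> with its
        denominators extended to \<open>pochhammer (a + 1) (k + 1)\<close> and
        \<open>fact (k + 1)\<close>.\<close>
      define u where "u = d k / ((a + 1 + of_nat k) * of_nat (Suc k))"
      have du: "d k = u * ((a + 1 + of_nat k) * of_nat (Suc k))" using nz by (simp add: u_def)
      have u: "u = pochhammer A k * pochhammer C k / (pochhammer (a + 1) k * (a + 1 + of_nat k) * pochhammer e k * (of_nat (Suc k) * fact k))"
        unfolding u_def d_def by (simp add: mult_ac)
      have 1: "d (Suc k) * (of_nat M - of_nat k) = - (u * ((A + of_nat k) * (C + of_nat k)))"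
      \<comment> \<open>At \<open>k = M\<close> the denominator of \<open>d (Suc k)\<close>
        vanishes. There the left side has the factor \<open>M - k = 0\<close>, and
        \<open>k = y\<close> makes \<open>A + k = 0\<close> on the right.\<close>
      proof (cases "k = M")
        case True
        then have "k = y" using that assms(1) by simp
        then have "A + of_nat k = 0" by (simp add: A_def)
        then show ?thesis using True by simp
      next
        case False
        then have "e + of_nat k \<noteq> 0" by (simp add: e_def)
        moreover have "of_nat M - of_nat k = - (e + of_nat k)" by (simp add: e_def)
        ultimately show ?thesis using nz
          unfolding u d_def pochhammer_Suc fact_Suc by (simp add: divide_simps del: of_nat_Suc) (simp add: algebra_simps)
      qed
      have r: "pochhammer (C - 1) (Suc k) = (C - 1) * pochhammer C k" "pochhammer (e - 1) (Suc k) = (e - 1) * pochhammer e k"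
         "pochhammer (A - 1) (Suc k) = (A - 1) * pochhammer A k" by (subst pochhammer_rec; simp)+
      have 2: "d1 (Suc k) = u * ((A + of_nat k) * (C - 1)) / (e - 1)"
        unfolding d1_def r u fact_Suc using nz by (simp add: pochhammer_Suc[of A] pochhammer_Suc[of "a+1"] divide_simps del: of_nat_Suc)
      have 3: "d2 (Suc k) = u * ((A - 1) * (C + of_nat k)) / (e - 1)"
        unfolding d2_def r u fact_Suc using nz by (simp add: pochhammer_Suc[of C] pochhammer_Suc[of "a+1"] divide_simps del: of_nat_Suc)
      \<comment> \<open>Substituting \<open>A + k = (A - 1) + (k + 1)\<close> and
        \<open>C + k = (C - 1) + (k + 1)\<close> leaves only the two combinations evaluated in
        \<open>PQ\<close>.\<close>
      have "P * ((A + of_nat k) * (C - 1)) + Q * ((A - 1) * (C + of_nat k))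
        = (P + Q) * ((A - 1) * (C - 1)) + (of_nat k + 1) * (P * (C - 1) + Q * (A - 1))"
        by (simp add: algebra_simps)
      also have "\<dots> = (1 - e) * ((A - 1) * (C - 1) + (of_nat k + 1) * (A + C - 2 - a))"
        unfolding PQ eM by (simp add: algebra_simps)
      also have "\<dots> = (1 - e) * ((A + of_nat k) * (C + of_nat k) - (a + 1 + of_nat k) * of_nat (Suc k))"
        by (simp add: algebra_simps)
      finally have 4: "(P * ((A + of_nat k) * (C - 1)) + Q * ((A - 1) * (C + of_nat k))) / (e - 1)
         = (a + 1 + of_nat k) * of_nat (Suc k) - (A + of_nat k) * (C + of_nat k)"
        using nz(4) by (simp add: divide_simps del: of_nat_Suc) (simp add: algebra_simps)
      have "P * d1 (Suc k) + Q * d2 (Suc k) = u * ((P * ((A + of_nat k) * (C - 1)) + Q * ((A - 1) * (C + of_nat k))) / (e - 1))"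
        unfolding 2 3 using nz(4) by (simp add: divide_simps) (simp add: algebra_simps)
      also have "\<dots> = d (Suc k) * (of_nat M - of_nat k) + d k" unfolding 4 1 du by (simp add: algebra_simps)
      finally show ?thesis ..
    qed
    moreover have "d 0 = 1" "d1 0 = 1" "d2 0 = 1" by (auto simp: d_def d1_def d2_def)
    ultimately show ?thesis using PQ by auto
  qed
  also have "\<dots> = P * hahn y (Suc M) a (c - 1) z + Q * hahn (Suc y) (Suc M) a (c - 1) z"
    unfolding h1 h2 sum.atMost_Suc_shift[of _ y]
    by (simp add: sum.distrib sum_distrib_left algebra_simps)
  finally show ?thesis unfolding P_def Q_def .
qed

section \<open>Ladder matrices and the bispectral kernel\<close>

lemma finite_dom2 [simp]: "finite (dom2 N)"
  by (rule finite_subset[of _ "{..N} \<times> {..N}"]) (auto simp: dom2_def)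

lemma mem_dom2 [simp]: "(x, y) \<in> dom2 N \<longleftrightarrow> x + y \<le> N"
  by (simp add: dom2_def)

text \<open>The pair \<open>(a, c)\<close> is \<open>(\<rho>, \<sigma>)\<close> or
  \<open>(r, ss)\<close>. The conditions for \<open>1 \<le> k \<le> N\<close> express that the split
  sequences do not vanish. The others express that a quadratic eigenvalue sequence is injective:
  \<open>c + p + q + 1\<close> is the nontrivial factor of the difference of the eigenvalues at
  \<open>p\<close> and \<open>q\<close>, and \<open>p \<noteq> q\<close> forces
  \<open>p + q + 1 \<ge> 2\<close>.\<close>

definition regular :: "nat \<Rightarrow> complex \<Rightarrow> complex \<Rightarrow> bool" where
  "regular N a c \<longleftrightarrow>
     (\<forall>k. 1 \<le> k \<and> k \<le> N \<longrightarrow> a + of_nat k \<noteq> 0 \<and> c - a + of_nat k \<noteq> 0) \<and>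
     (\<forall>k. 2 \<le> k \<and> k \<le> 2 * N \<longrightarrow> c + of_nat k \<noteq> 0)"

text \<open>
  The case \<open>y = 0\<close> is separate because \<open>c + x + 1\<close> may vanish. For \<open>y = N - x > 0\<close> the numerator is
  zero, also when the denominator is.
\<close>

definition lower_coeff :: "nat \<Rightarrow> complex \<Rightarrow> nat \<Rightarrow> nat \<Rightarrow> complex" where
  "lower_coeff N c x y = (if y = 0 then 1 else
     (of_nat y + 1 + (c + of_nat x)) * (of_nat (N - x) - of_nat y) /
     (of_nat (N - x) * (2 * of_nat y + 1 + (c + of_nat x))))"

text \<open>Row \<open>p\<close> is the point of evaluation. The entries are \<open>A\<close> and
  \<open>1 - A\<close> of \<open>hahn_lower\<close> with \<open>N - x\<close> for \<open>M\<close>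
  and \<open>c + x\<close> for \<open>c\<close>; the columns lie at \<open>x + 1\<close>, where size
  and parameter are \<open>N - x - 1\<close> and \<open>c + x + 1\<close>.\<close>

definition lowerM :: "nat \<Rightarrow> complex \<Rightarrow> nat \<times> nat \<Rightarrow> nat \<times> nat \<Rightarrow> complex" where
  "lowerM N c p q =
     (if fst q = Suc (fst p) \<and> snd q = snd p then lower_coeff N c (fst p) (snd p)
      else if fst q = Suc (fst p) \<and> Suc (snd q) = snd p then 1 - lower_coeff N c (fst p) (snd p)
      else 0)"

text \<open>The entries are the two factors of \<open>hahn_raise\<close> with \<open>N - x\<close>
  for \<open>M\<close> and \<open>c + x\<close> for \<open>c\<close>; the columns lie at
  \<open>x - 1\<close>, so the rows with \<open>x = 0\<close> are zero.\<close>

definition raiseM :: "nat \<Rightarrow> complex \<Rightarrow> complex \<Rightarrow> nat \<times> nat \<Rightarrow> nat \<times> nat \<Rightarrow> complex" where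
  "raiseM N a c p q =
     (if fst p = Suc (fst q) \<and> snd q = snd p then
        (of_nat (N - fst p) + 1) * (of_nat (snd p) + (c + of_nat (fst p)) - a) / (2 * of_nat (snd p) + 1 + (c + of_nat (fst p)))
      else if fst p = Suc (fst q) \<and> snd q = Suc (snd p) then
        (of_nat (N - fst p) + 1) * (of_nat (snd p) + 1 + a) / (2 * of_nat (snd p) + 1 + (c + of_nat (fst p)))
      else 0)"

definition lower_raiseM :: "nat \<Rightarrow> complex \<Rightarrow> complex \<Rightarrow> nat \<times> nat \<Rightarrow> nat \<times> nat \<Rightarrow> complex" where
  "lower_raiseM N a c p q = (\<Sum>u\<in>dom2 N. lowerM N c p u * raiseM N a c u q)"

definition degreeM :: "nat \<Rightarrow> complex \<Rightarrow> complex \<Rightarrow> nat \<times> nat \<Rightarrow> nat \<times> nat \<Rightarrow> complex" where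
  "degreeM N a c p q = (if p = q then of_nat (N - fst p) else 0) - lower_raiseM N a c p q"

text \<open>This is the operator of \<open>hahn_difference\<close> in the variable \<open>x\<close>,
  with parameters \<open>a'\<close>, \<open>c' + j\<close> and size \<open>N - j\<close>, after a
  translation valid on the kernel: multiplication by \<open>N - x - j\<close> becomes
  \<open>L R\<close>, the same multiplication with the forward shift becomes \<open>L\<close>, and
  the backward shift becomes \<open>R\<close>.\<close>

definition quadraticM ::
  "nat \<Rightarrow> complex \<Rightarrow> complex \<Rightarrow> complex \<Rightarrow> complex \<Rightarrow> nat \<times> nat \<Rightarrow> nat \<times> nat \<Rightarrow> complex" where
  "quadraticM N a c a' c' p q =
     (of_nat (fst p) + a' + 1) * (lower_raiseM N a c p q - lowerM N c p q)
   + of_nat (fst p) * (of_nat (fst p) - c' + a' - of_nat N - 1) * (raiseM N a c p q - (if p = q then 1 else 0))"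

text \<open>The factor \<open>g\<close> is left arbitrary so that the ladder matrices can be
  composed: each of them maps a term to a multiple of the term with another
  \<open>g\<close>.\<close>

definition hahn_term :: "nat \<Rightarrow> complex \<Rightarrow> complex \<Rightarrow> nat \<Rightarrow> (nat \<Rightarrow> complex) \<Rightarrow> nat \<times> nat \<Rightarrow> complex" where
  "hahn_term N a c j g p = (if fst p + j \<le> N
     then hahn (snd p) (N - fst p) a (c + of_nat (fst p)) (of_nat j) * g (fst p) / fact (N - fst p - j) else 0)"

definition hahn_kernel ::
  "nat \<Rightarrow> complex \<Rightarrow> complex \<Rightarrow> complex \<Rightarrow> complex \<Rightarrow> nat \<times> nat \<Rightarrow> nat \<times> nat \<Rightarrow> complex" where
  "hahn_kernel N a c a' c' p q = (if fst p + fst q \<le> N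
     then hahn (snd p) (N - fst p) a (c + of_nat (fst p)) (of_nat (fst q))
        * hahn (snd q) (N - fst q) a' (c' + of_nat (fst q)) (of_nat (fst p)) / fact (N - fst p - fst q) else 0)"

lemma hahn_kernel_commute: "hahn_kernel N a c a' c' p q = hahn_kernel N a' c' a c q p"
  by (simp add: hahn_kernel_def add.commute mult.commute diff_diff_eq)

lemma hahn_kernel_eq_term:
  "hahn_kernel N a c a' c' p q
     = hahn_term N a c (fst q) (\<lambda>x. hahn (snd q) (N - fst q) a' (c' + of_nat (fst q)) (of_nat x)) p"
  by (simp add: hahn_kernel_def hahn_term_def)

section \<open>Action of the ladder matrices on the kernel\<close>

lemma sum_two_points:
  fixes F :: "'a \<Rightarrow> complex"
  assumes "finite S" "u \<noteq> v" "\<And>q. q \<noteq> u \<Longrightarrow> q \<noteq> v \<Longrightarrow> F q = 0"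
  shows "(\<Sum>q\<in>S. F q) = (if u \<in> S then F u else 0) + (if v \<in> S then F v else 0)"
proof -
  have "(\<Sum>q\<in>S. F q) = (\<Sum>q\<in>S. (if q = u then F u else 0) + (if q = v then F v else 0))"
    using assms by (intro sum.cong) auto
  then show ?thesis using assms(1) by (simp add: sum.distrib)
qed

lemma sum_lowerM:
  assumes "x + y \<le> N"
  shows "(\<Sum>q\<in>dom2 N. lowerM N c (x, y) q * F q) =
     (if x + y < N then lower_coeff N c x y * F (Suc x, y) else 0)
   + (if 0 < y then (1 - lower_coeff N c x y) * F (Suc x, y - 1) else 0)"
proof (cases y)
  case 0
  then have "(\<Sum>q\<in>dom2 N. lowerM N c (x, y) q * F q) =
      (\<Sum>q\<in>dom2 N. if q = (Suc x, y) then lower_coeff N c x y * F (Suc x, y) else 0)"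
    by (intro sum.cong) (auto simp: lowerM_def)
  then show ?thesis using 0 by simp
next
  case (Suc y')
  then show ?thesis using assms
    by (subst sum_two_points[where u = "(Suc x, y)" and v = "(Suc x, y')"]) (auto simp: lowerM_def)
qed

lemma sum_raiseM:
  assumes "Suc x + y \<le> N"
  shows "(\<Sum>q\<in>dom2 N. raiseM N a c (Suc x, y) q * F q) =
     raiseM N a c (Suc x, y) (x, y) * F (x, y) + raiseM N a c (Suc x, y) (x, Suc y) * F (x, Suc y)"
  using assms
  by (subst sum_two_points[where u = "(x, y)" and v = "(x, Suc y)"]) (auto simp: raiseM_def)

lemma raiseM_0 [simp]: "raiseM N a c (0, y) q = 0"
  by (simp add: raiseM_def)

text \<open>By \<open>hahn_lower\<close> the row reproduces the polynomial at \<open>x\<close>, and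
  \<open>fact (N - x - j) = (N - x - j) * fact (N - x - 1 - j)\<close> supplies the scalar. This
  scalar is zero on the edge \<open>x + j = N\<close>, where every entry at \<open>x + 1\<close> is
  already cut off. For \<open>y = N - x\<close> the point \<open>(x + 1, y)\<close> leaves the
  domain, consistently with a vanishing \<open>lower_coeff\<close>.\<close>

lemma lowerM_hahn_term:
  assumes R: "regular N a c" and p: "x + y \<le> N"
  shows "(\<Sum>q\<in>dom2 N. lowerM N c (x, y) q * hahn_term N a c j g q)
     = (of_nat N - of_nat x - of_nat j) * hahn_term N a c j (\<lambda>x. g (Suc x)) (x, y)"
proof (cases "Suc x + j \<le> N")
  case False
  then have z1: "hahn_term N a c j g (Suc x, z) = 0" for z by (simp add: hahn_term_def)
  have z2: "(of_nat N - of_nat x - of_nat j) * hahn_term N a c j (\<lambda>x. g (Suc x)) (x, y) = 0"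
  proof (cases "x + j = N")
    case True
    then have "(of_nat N :: complex) = of_nat x + of_nat j" by (metis of_nat_add)
    then show ?thesis by simp
  next
    case False
    then show ?thesis using \<open>\<not> Suc x + j \<le> N\<close> by (simp add: hahn_term_def)
  qed
  show ?thesis unfolding sum_lowerM[OF p] z1 z2 by simp
next
  case True
  define M where "M = N - x"
  have M: "j < M" "y \<le> M" "N - Suc x = M - 1" "x + M = N" using True p by (auto simp: M_def)
  have h: "hahn y M a (c + of_nat x) (of_nat j) =
     (if y < M then lower_coeff N c x y * hahn y (M - 1) a (c + of_nat (Suc x)) (of_nat j) else 0)
   + (if 0 < y then (1 - lower_coeff N c x y) * hahn (y - 1) (M - 1) a (c + of_nat (Suc x)) (of_nat j) else 0)"
  proof (cases "y = 0")
    case True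
    then show ?thesis using M by (simp add: lower_coeff_def)
  next
    case False
    have "hahn y M a (c + of_nat x) (of_nat j) =
      lower_coeff N c x y * hahn y (M - 1) a (c + of_nat x + 1) (of_nat j)
      + (1 - lower_coeff N c x y) * hahn (y - 1) (M - 1) a (c + of_nat x + 1) (of_nat j)"
    proof -
      have "c + of_nat x + of_nat y + 1 \<noteq> 0 \<or> y = M" "2 * of_nat y + 1 + (c + of_nat x) \<noteq> 0 \<or> y = M"
      proof -
        have "y = M \<or> (c + of_nat (x + y + 1) \<noteq> 0 \<and> c + of_nat (2 * y + 1 + x) \<noteq> 0)"
          using R M False by (auto simp: regular_def simp del: of_nat_add of_nat_mult of_nat_Suc)
        then show "c + of_nat x + of_nat y + 1 \<noteq> 0 \<or> y = M" "2 * of_nat y + 1 + (c + of_nat x) \<noteq> 0 \<or> y = M"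
          by (auto simp: algebra_simps)
      qed
      from hahn_lower[OF M(2,1) this] False show ?thesis
        by (simp add: lower_coeff_def M_def[symmetric])
    qed
    moreover have "lower_coeff N c x y = 0" if "\<not> y < M"
      using that M False by (simp add: lower_coeff_def M_def[symmetric])
    ultimately show ?thesis using False by (simp add: algebra_simps)
  qed
  have nj: "of_nat N - of_nat x - of_nat j = (of_nat (M - j) :: complex)"
    using M by (simp add: of_nat_diff) (metis add_diff_cancel_left' of_nat_add)
  have f: "fact (M - j) = of_nat (M - j) * (fact (M - 1 - j) :: complex)"
    using M fact_reduce[of "M - j", where 'a=complex] by (simp add: diff_commute)
  have "(\<Sum>q\<in>dom2 N. lowerM N c (x, y) q * hahn_term N a c j g q)
     = ((if y < M then lower_coeff N c x y * hahn y (M - 1) a (c + of_nat (Suc x)) (of_nat j) else 0)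
   + (if 0 < y then (1 - lower_coeff N c x y) * hahn (y - 1) (M - 1) a (c + of_nat (Suc x)) (of_nat j) else 0))
      * g (Suc x) / fact (M - 1 - j)"
    using True M p by (auto simp: sum_lowerM hahn_term_def M_def[symmetric] algebra_simps add_divide_distrib)
  also have "\<dots> = of_nat (M - j) * hahn_term N a c j (\<lambda>x. g (Suc x)) (x, y)"
    unfolding h[symmetric] using True M f by (auto simp: hahn_term_def M_def[symmetric])
  finally show ?thesis unfolding nj .
qed

text \<open>Here the factor \<open>M + 1 - j\<close> on the left of \<open>hahn_raise\<close>, with
  \<open>M = N - x\<close>, cancels against the step from \<open>fact (M + 1 - j)\<close> to
  \<open>fact (M - j)\<close>, so no scalar remains.\<close>

lemma raiseM_hahn_term:
  assumes R: "regular N a c" and p: "x + y \<le> N"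
  shows "(\<Sum>q\<in>dom2 N. raiseM N a c (x, y) q * hahn_term N a c j g q)
     = hahn_term N a c j (\<lambda>x. if x = 0 then 0 else g (x - 1)) (x, y)"
proof (cases x)
  case 0
  then show ?thesis by (simp add: hahn_term_def)
next
  case (Suc x')
  define M where "M = N - x"
  have M: "y \<le> M" "N - x' = Suc M" "x + M = N" using Suc p by (auto simp: M_def)
  have c1: "c + of_nat x - 1 = c + of_nat x'" using Suc by simp
  have h: "(of_nat M + 1 - of_nat j) * hahn y M a (c + of_nat x) (of_nat j) =
     raiseM N a c (x, y) (x', y) * hahn y (Suc M) a (c + of_nat x') (of_nat j)
   + raiseM N a c (x, y) (x', Suc y) * hahn (Suc y) (Suc M) a (c + of_nat x') (of_nat j)"
  proof -
    have 1: "2 * of_nat y + 1 + (c + of_nat x) \<noteq> 0"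
    proof -
      have "c + of_nat (2 * y + 1 + x) \<noteq> 0" using R M Suc unfolding regular_def by (simp del: of_nat_add of_nat_mult of_nat_Suc)
      then show ?thesis by (simp add: algebra_simps)
    qed
    have 2: "a + of_nat k \<noteq> 0" if "1 \<le> k" "k \<le> Suc y" for k
      using R that M Suc unfolding regular_def by auto
    from hahn_raise[OF M(1) 1 2, of "of_nat j"] show ?thesis
      unfolding c1 by (simp add: raiseM_def Suc M_def)
  qed
  show ?thesis
  proof (cases "x' + j \<le> N")
    case False
    then show ?thesis using p by (simp add: Suc sum_raiseM hahn_term_def)
  next
    case True
    have "(\<Sum>q\<in>dom2 N. raiseM N a c (x, y) q * hahn_term N a c j g q)
      = ((of_nat M + 1 - of_nat j) * hahn y M a (c + of_nat x) (of_nat j)) * g x' / fact (Suc M - j)"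
      unfolding h using True p M by (simp add: Suc sum_raiseM hahn_term_def algebra_simps add_divide_distrib)
    also have "\<dots> = hahn_term N a c j (\<lambda>x. if x = 0 then 0 else g (x - 1)) (x, y)"
    proof (cases "x + j \<le> N")
      case False
      \<comment> \<open>The one case where \<open>x - 1\<close> is still in range but
        \<open>x\<close> is not: the factor \<open>M + 1 - j\<close> vanishes, in agreement with the
        cutoff in \<open>hahn_term\<close>.\<close>
      then have "j = Suc M" using True M Suc by auto
      then show ?thesis using False by (simp add: hahn_term_def)
    next
      case True
      then have f: "fact (Suc M - j) = (of_nat M + 1 - of_nat j) * (fact (M - j) :: complex)" 
        and e: "of_nat M + 1 - of_nat j = (of_nat (Suc (M - j)) :: complex)"
        using M by (auto simp: Suc_diff_le of_nat_diff)
      have "of_nat (Suc (M - j)) \<noteq> (0 :: complex)" by (rule of_nat_neq_0)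
      then show ?thesis unfolding hahn_term_def fst_conv snd_conv M_def[symmetric] f e
        using True Suc by (simp del: of_nat_Suc)
    qed
    finally show ?thesis .
  qed
qed

text \<open>\<open>R\<close> replaces \<open>g x\<close> by \<open>g (x - 1)\<close> and
  \<open>L\<close> then evaluates this at \<open>x + 1\<close>. The value at \<open>0\<close>
  introduced by \<open>R\<close> is never read.\<close>

lemma lower_raiseM_hahn_term:
  assumes R: "regular N a c" and p: "x + y \<le> N"
  shows "(\<Sum>q\<in>dom2 N. lower_raiseM N a c (x, y) q * hahn_term N a c j g q)
     = (of_nat N - of_nat x - of_nat j) * hahn_term N a c j g (x, y)"
proof -
  let ?g = "\<lambda>x. if x = 0 then 0 else g (x - 1)"
  have "(\<Sum>q\<in>dom2 N. lower_raiseM N a c (x, y) q * hahn_term N a c j g q)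
     = (\<Sum>u\<in>dom2 N. lowerM N c (x, y) u * (\<Sum>q\<in>dom2 N. raiseM N a c u q * hahn_term N a c j g q))"
    unfolding lower_raiseM_def sum_distrib_right sum_distrib_left
    by (subst sum.swap) (simp add: mult.assoc)
  also have "\<dots> = (\<Sum>u\<in>dom2 N. lowerM N c (x, y) u * hahn_term N a c j ?g u)"
    by (intro sum.cong) (auto simp: raiseM_hahn_term[OF R])
  also have "\<dots> = (of_nat N - of_nat x - of_nat j) * hahn_term N a c j g (x, y)"
    by (simp add: lowerM_hahn_term[OF R p])
  finally show ?thesis .
qed

lemma degreeM_hahn_kernel:
  assumes R: "regular N a c" and p: "p \<in> dom2 N"
  shows "(\<Sum>u\<in>dom2 N. degreeM N a c p u * hahn_kernel N a c a' c' u q)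
     = of_nat (fst q) * hahn_kernel N a c a' c' p q"
proof -
  obtain x y where xy: "p = (x, y)" "x + y \<le> N" using p by (cases p) auto
  show ?thesis
    unfolding degreeM_def hahn_kernel_eq_term left_diff_distrib sum_subtractf xy(1) lower_raiseM_hahn_term[OF R xy(2)]
    using xy(2) by (simp add: if_distrib[of "\<lambda>z. z * _"] of_nat_diff algebra_simps cong: if_cong)
qed

text \<open>With \<open>j\<close> and \<open>i\<close> fixed, the ladder actions reduce the sum to
  differences of the second polynomial in \<open>x\<close>, and \<open>hahn_difference\<close> for
  size \<open>N - j\<close> gives the eigenvalue.\<close>

lemma quadraticM_hahn_kernel:
  assumes R: "regular N a c" and R': "regular N a' c'" and p: "p \<in> dom2 N" and q: "q \<in> dom2 N"
  shows "(\<Sum>u\<in>dom2 N. quadraticM N a c a' c' p u * hahn_kernel N a c a' c' u q)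
     = of_nat (snd q) * (of_nat (snd q) + 1 + c' + of_nat (fst q)) * hahn_kernel N a c a' c' p q"
proof -
  obtain x y where xy: "p = (x, y)" "x + y \<le> N" using p by (cases p) auto
  obtain j i where ji: "q = (j, i)" "j + i \<le> N" using q by (cases q) auto
  define h where "h z = hahn i (N - j) a' (c' + of_nat j) z" for z
  let ?t = "\<lambda>g. hahn_term N a c j g (x, y)"
  define \<kappa> where "\<kappa> = (of_nat x + a' + 1 :: complex)"
  define \<delta> where "\<delta> = (of_nat x * (of_nat x - c' + a' - of_nat N - 1) :: complex)"
  have K: "hahn_kernel N a c a' c' u q = hahn_term N a c j (\<lambda>x. h (of_nat x)) u" for u
    by (simp add: hahn_kernel_eq_term h_def ji)
  have "(\<Sum>u\<in>dom2 N. quadraticM N a c a' c' p u * hahn_kernel N a c a' c' u q)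
    = \<kappa> * ((\<Sum>u\<in>dom2 N. lower_raiseM N a c (x, y) u * hahn_term N a c j (\<lambda>x. h (of_nat x)) u)
       - (\<Sum>u\<in>dom2 N. lowerM N c (x, y) u * hahn_term N a c j (\<lambda>x. h (of_nat x)) u))
    + \<delta> * ((\<Sum>u\<in>dom2 N. raiseM N a c (x, y) u * hahn_term N a c j (\<lambda>x. h (of_nat x)) u)
       - (\<Sum>u\<in>dom2 N. (if (x, y) = u then 1 else 0) * hahn_term N a c j (\<lambda>x. h (of_nat x)) u))"
    unfolding K quadraticM_def xy fst_conv \<kappa>_def[symmetric] \<delta>_def[symmetric]
    by (simp only: sum_distrib_left sum_subtractf[symmetric] sum.distrib[symmetric])
       (rule sum.cong, simp_all add: algebra_simps)
  also have "(\<Sum>u\<in>dom2 N. (if (x, y) = u then 1 else 0) * hahn_term N a c j (\<lambda>x. h (of_nat x)) u) = ?t (\<lambda>x. h (of_nat x))"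
    using xy(2) by (simp add: if_distrib[of "\<lambda>z. z * _"] cong: if_cong)
  also have "\<kappa> * ((\<Sum>u\<in>dom2 N. lower_raiseM N a c (x, y) u * hahn_term N a c j (\<lambda>x. h (of_nat x)) u)
       - (\<Sum>u\<in>dom2 N. lowerM N c (x, y) u * hahn_term N a c j (\<lambda>x. h (of_nat x)) u))
    + \<delta> * ((\<Sum>u\<in>dom2 N. raiseM N a c (x, y) u * hahn_term N a c j (\<lambda>x. h (of_nat x)) u)
       - ?t (\<lambda>x. h (of_nat x)))
    = \<kappa> * ((of_nat N - of_nat x - of_nat j) * (?t (\<lambda>x. h (of_nat x)) - ?t (\<lambda>x. h (of_nat (Suc x)))))
      + \<delta> * (?t (\<lambda>x. if x = 0 then 0 else h (of_nat (x - 1))) - ?t (\<lambda>x. h (of_nat x)))"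
    unfolding lower_raiseM_hahn_term[OF R xy(2)] lowerM_hahn_term[OF R xy(2)] raiseM_hahn_term[OF R xy(2)]
    by (simp add: algebra_simps)
  also have "\<dots> = of_nat i * (of_nat i + 1 + c' + of_nat j) * ?t (\<lambda>x. h (of_nat x))"
  proof (cases "x + j \<le> N")
    case False
    then show ?thesis by (simp add: hahn_term_def)
  next
    case True
    define C where "C = hahn y (N - x) a (c + of_nat x) (of_nat j) / fact (N - x - j)"
    have t: "?t g = C * g x" for g using True by (simp add: hahn_term_def C_def)
    \<comment> \<open>At \<open>x = 0\<close> the cut-off value and \<open>h (- 1)\<close> may
      differ, but \<open>\<delta>\<close> contains the factor \<open>x\<close>.\<close>
    have d: "\<delta> * (if x = 0 then 0 else h (of_nat (x - 1))) = \<delta> * h (of_nat x - 1)"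
      by (cases x) (auto simp: \<delta>_def)
    have Nj: "of_nat (N - j) = (of_nat N - of_nat j :: complex)" using ji by (simp add: of_nat_diff)
    have nz: "a' + of_nat k \<noteq> 0" if "1 \<le> k" "k \<le> i" for k
      using R' that ji by (auto simp: regular_def)
    have "i \<le> N - j" using ji by simp
    have D: "(of_nat x + a' + 1) * (of_nat x - (of_nat N - of_nat j)) * (h (of_nat x + 1) - h (of_nat x))
        - of_nat x * (of_nat x - (c' + of_nat j) + a' - (of_nat N - of_nat j) - 1) * (h (of_nat x) - h (of_nat x - 1))
       = of_nat i * (of_nat i + (c' + of_nat j) + 1) * h (of_nat x)"
      unfolding h_def Nj[symmetric] by (rule hahn_difference[OF \<open>i \<le> N - j\<close> nz])
    have "\<kappa> * ((of_nat N - of_nat x - of_nat j) * (C * h (of_nat x) - C * h (of_nat (Suc x))))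
      + \<delta> * (C * (if x = 0 then 0 else h (of_nat (x - 1))) - C * h (of_nat x))
      = C * ((\<kappa> * (of_nat x - (of_nat N - of_nat j))) * (h (of_nat x + 1) - h (of_nat x))
        - (\<delta> * h (of_nat x) - \<delta> * (if x = 0 then 0 else h (of_nat (x - 1)))))"
      by (simp add: algebra_simps)
    also have "\<dots> = C * (\<kappa> * (of_nat x - (of_nat N - of_nat j)) * (h (of_nat x + 1) - h (of_nat x))
        - \<delta> * (h (of_nat x) - h (of_nat x - 1)))"
      unfolding d by (simp only: right_diff_distrib)
    also have "\<dots>
       = of_nat i * (of_nat i + 1 + c' + of_nat j) * (C * h (of_nat x))"
    proof -
      \<comment> \<open>The cancellation of \<open>j\<close> between \<open>c' + j\<close> and
        \<open>N - j\<close>: it lets one coefficient serve all dual indices.\<close>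
      have \<delta>: "\<delta> = of_nat x * (of_nat x - (c' + of_nat j) + a' - (of_nat N - of_nat j) - 1)"
        by (simp add: \<delta>_def)
      show ?thesis unfolding \<kappa>_def \<delta> D by (simp add: algebra_simps)
    qed
    finally show ?thesis unfolding t .
  qed
  finally show ?thesis unfolding K unfolding xy(1) ji(1) fst_conv snd_conv .
qed

text \<open>Both polynomials equal 1 at the origin, the first by degree 0 and the second by argument
  0. This is why no dual vector is zero.\<close>

lemma hahn_kernel_0: "fst q \<le> N \<Longrightarrow> hahn_kernel N a c a' c' (0, 0) q \<noteq> 0"
  by (simp add: hahn_kernel_def hahn_0)


text \<open>
  Inverse norms of the Hahn polynomials \<open>Q\<^sub>y(\<cdot>; a, c + x, N - x)\<close>; the factor \<open>2 y + c + x + 1\<close> of the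
  norm is cancelled against \<open>pochhammer (c + x + y + 1) (N - x + 1)\<close>, because it may be zero. The
  dependence on \<open>x\<close> is the Hahn weight belonging to \<open>a', c'\<close>.
\<close>

definition weight :: "nat \<Rightarrow> complex \<Rightarrow> complex \<Rightarrow> complex \<Rightarrow> complex \<Rightarrow> nat \<times> nat \<Rightarrow> complex" where
  "weight N a c a' c' = (\<lambda>(x, y).
     fact (N - x) ^ 2 * pochhammer (a' + 1) x * pochhammer (a + 1) y /
     (fact x * fact y * fact (N - x - y) * pochhammer (c' - a' + of_nat (N - x) + 1) x *
      pochhammer (c - a + 1) (x + y) * pochhammer (c + of_nat (x + y) + 1) y *
      pochhammer (c + of_nat (x + 2 * y + 1) + 1) (N - x - y)))"

section \<open>Symmetry of the matrices with respect to the weight\<close>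

lemma pochhammer_shift_nonzero:
  assumes "\<And>k. m < k \<Longrightarrow> k \<le> m + n \<Longrightarrow> a + of_nat k \<noteq> (0::complex)"
  shows "pochhammer (a + of_nat m + 1) n \<noteq> 0"
proof (rule pochhammer_nonzero)
  fix k :: nat assume "1 \<le> k" "k \<le> n"
  then show "a + of_nat m + of_nat k \<noteq> 0" using assms[of "m + k"] by (simp add: add.assoc)
qed

lemma weight_factors_nonzero:
  assumes R: "regular N a c" and R': "regular N a' c'" and p: "x + y \<le> N"
  shows "pochhammer (a' + 1) x \<noteq> 0" "pochhammer (a + 1) y \<noteq> 0"
    "pochhammer (c' - a' + of_nat (N - x) + 1) x \<noteq> 0" "pochhammer (c - a + 1) (x + y) \<noteq> 0"
    "pochhammer (c + of_nat (x + y) + 1) y \<noteq> 0"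
    "pochhammer (c + of_nat (x + 2 * y + 1) + 1) (N - x - y) \<noteq> 0"
proof -
  show "pochhammer (a' + 1) x \<noteq> 0" "pochhammer (a + 1) y \<noteq> 0" "pochhammer (c - a + 1) (x + y) \<noteq> 0"
    using R R' p by (auto intro!: pochhammer_nonzero simp: regular_def)
  show "pochhammer (c' - a' + of_nat (N - x) + 1) x \<noteq> 0"
    using R' p by (intro pochhammer_shift_nonzero) (auto simp: regular_def)
  show "pochhammer (c + of_nat (x + y) + 1) y \<noteq> 0"
    using R p by (intro pochhammer_shift_nonzero) (auto simp: regular_def)
  show "pochhammer (c + of_nat (x + 2 * y + 1) + 1) (N - x - y) \<noteq> 0"
    using R p by (intro pochhammer_shift_nonzero) (auto simp: regular_def)
qed

lemma weight_nonzero: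
  assumes "regular N a c" "regular N a' c'" "p \<in> dom2 N"
  shows "weight N a c a' c' p \<noteq> 0"
  using assms weight_factors_nonzero[of N a c a' c' "fst p" "snd p"]
  by (cases p) (simp add: weight_def)

text \<open>The factors in front are those of \<open>quadraticM\<close>: \<open>L\<close> occurs
  there at \<open>x\<close> with \<open>- (x + a' + 1)\<close>, and \<open>R\<close> at
  \<open>x + 1\<close> with \<open>(x + 1) (x - c' + a' - N)\<close>. The identity is thus the
  symmetry of \<open>quadraticM\<close> between the columns \<open>x\<close> and
  \<open>x + 1\<close>. It is checked on the two neighbours of \<open>p\<close> from quotients of
  weights.\<close>

lemma weight_lowerM:
  assumes R: "regular N a c" and R': "regular N a' c'" and p: "p \<in> dom2 N" and q: "q \<in> dom2 N"
  shows "(a' + of_nat (Suc (fst p))) * weight N a c a' c' p * lowerM N c p q =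
    of_nat (Suc (fst p)) * (c' - a' + of_nat (N - fst p)) * weight N a c a' c' q * raiseM N a c q p"
proof -
  obtain x y where xy: "p = (x, y)" "x + y \<le> N" using p by (cases p) auto
  consider "q = (Suc x, y)" | y' where "q = (Suc x, y')" "y = Suc y'"
    | "lowerM N c p q = 0" "raiseM N a c q p = 0"
  proof -
    have "lowerM N c p q = 0 \<and> raiseM N a c q p = 0" if "\<not> (fst q = Suc x \<and> (snd q = y \<or> Suc (snd q) = y))"
      using that by (auto simp: lowerM_def raiseM_def xy)
    then show thesis using that by (metis prod.collapse)
  qed
  then show ?thesis
  proof cases
    case 1
    define M n where "M = N - Suc x" and "n = N - Suc x - y"
    have N: "N - x = Suc M" "Suc M - y = Suc n" "N - Suc x = M" "M - y = n" and Mn: "M = n + y"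
      using q xy 1 by (auto simp: M_def n_def)
    define b where "b = c + of_nat (x + y + 1)"
    define z where "z = c' - a' + of_nat (Suc M)"
    define d where "d = c - a + of_nat (x + y + 1)"
    have c0: "c + of_nat k \<noteq> 0" if "2 \<le> k" "k \<le> 2 * N" for k
      using R that by (auto simp: regular_def)
    have b0: "y = 0 \<or> b + of_nat y \<noteq> 0" "b + of_nat y + 1 \<noteq> 0"
      using c0[of "x + y + 1 + y"] c0[of "x + y + 1 + y + 1"] xy q 1
      by (auto simp: b_def add.assoc)
    have z0: "z \<noteq> 0" using R' q 1 N unfolding z_def regular_def by (simp del: of_nat_Suc)
    have d0: "d \<noteq> 0" using R q 1 unfolding d_def regular_def by (simp del: of_nat_Suc of_nat_add)
    have e: "c + of_nat (x + y) + 1 = b" "c + of_nat (x + 2 * y + 1) + 1 = b + of_nat y + 1"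
       "c + of_nat (Suc x + y) + 1 = b + 1" "c + of_nat (Suc x + 2 * y + 1) + 1 = (b + of_nat y + 1) + 1"
       "c' - a' + of_nat M + 1 = z" "c' - a' + of_nat (Suc M) + 1 = z + 1"
       by (simp_all add: b_def z_def)
    have P: "pochhammer z (Suc x) = z * pochhammer (z + 1) x"
        "pochhammer (b + of_nat y + 1) (Suc n) = (b + of_nat y + 1) * pochhammer (b + of_nat y + 1 + 1) n"
        "pochhammer (c - a + 1) (Suc x + y) = pochhammer (c - a + 1) (x + y) * d"
        "pochhammer (a' + 1) (Suc x) = pochhammer (a' + 1) x * (a' + of_nat (Suc x))"
    proof -
      show "pochhammer z (Suc x) = z * pochhammer (z + 1) x"
        "pochhammer (b + of_nat y + 1) (Suc n) = (b + of_nat y + 1) * pochhammer (b + of_nat y + 1 + 1) n"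
        by (rule pochhammer_rec)+
    qed (simp_all add: pochhammer_Suc d_def add_ac)
    have nzp: "pochhammer b y \<noteq> 0" "pochhammer (b + 1) y \<noteq> 0"
      using weight_factors_nonzero(5)[OF R R' xy(2)] weight_factors_nonzero(5)[OF R R', of "Suc x" y] q 1
      unfolding e by simp_all
    define W where "W = fact M ^ 2 * pochhammer (a' + 1) x * pochhammer (a + 1) y /
     (fact x * fact y * fact n * pochhammer (z + 1) x *
      pochhammer (c - a + 1) (x + y) * pochhammer (b + of_nat y + 1 + 1) n)"
    have wp: "weight N a c a' c' p = of_nat (Suc M) ^ 2 * W / (of_nat (Suc n) * (b + of_nat y + 1) * pochhammer b y)"
      unfolding xy(1) weight_def prod.case N e P fact_Suc of_nat_mult power_mult_distrib W_def
      by (simp add: mult.assoc mult.left_commute del: of_nat_Suc)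
    have wq: "weight N a c a' c' q = (a' + of_nat (Suc x)) * W / (of_nat (Suc x) * z * d * pochhammer (b + 1) y)"
      unfolding 1 weight_def prod.case N e P fact_Suc of_nat_mult W_def
      by (simp add: mult.assoc mult.left_commute del: of_nat_Suc)
    \<comment> \<open>Free of division, so that it covers \<open>y = 0\<close>, where
      \<open>b = c + x + 1\<close> may be zero and \<open>lower_coeff\<close> is 1 by
      convention.\<close>
    have key: "lower_coeff N c x y * (of_nat (Suc M) * pochhammer (b + 1) y) = of_nat (Suc n) * pochhammer b y"
    proof (cases "y = 0")
      case True
      then show ?thesis using Mn by (simp add: lower_coeff_def)
    next
      case False
      have r: "b * pochhammer (b + 1) y = pochhammer b y * (b + of_nat y)"
        using pochhammer_rec[of b y] pochhammer_Suc[of b y] by simp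
      have l: "lower_coeff N c x y = b * of_nat (Suc n) / (of_nat (Suc M) * (b + of_nat y))"
        using False Mn unfolding lower_coeff_def N by (simp add: b_def algebra_simps)
      have "lower_coeff N c x y * (of_nat (Suc M) * pochhammer (b + 1) y)
         = of_nat (Suc n) * (b * pochhammer (b + 1) y) / (b + of_nat y)"
        unfolding l using of_nat_neq_0[of M, where 'a=complex] by (simp del: of_nat_Suc)
      also have "\<dots> = of_nat (Suc n) * pochhammer b y"
        unfolding r using b0(1) False by (simp del: of_nat_Suc)
      finally show ?thesis .
    qed
    have r: "raiseM N a c q p = of_nat (Suc M) * d / (b + of_nat y + 1)"
      by (simp add: raiseM_def 1 xy N b_def d_def algebra_simps)
    have "(a' + of_nat (Suc x)) * weight N a c a' c' p * lower_coeff N c x y * (of_nat (Suc n) * (b + of_nat y + 1) * pochhammer b y * pochhammer (b + 1) y)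
      = (a' + of_nat (Suc x)) * of_nat (Suc M) * W * (lower_coeff N c x y * (of_nat (Suc M) * pochhammer (b + 1) y))"
      unfolding wp using nzp b0 of_nat_neq_0[of n, where 'a=complex] by (simp add: power2_eq_square del: of_nat_Suc)
    also have "\<dots> = of_nat (Suc x) * z * weight N a c a' c' q * raiseM N a c q p * (of_nat (Suc n) * (b + of_nat y + 1) * pochhammer b y * pochhammer (b + 1) y)"
      unfolding wq r key using nzp b0 z0 d0 of_nat_neq_0[of x, where 'a=complex] by (simp del: of_nat_Suc)
    finally have "(a' + of_nat (Suc x)) * weight N a c a' c' p * lower_coeff N c x y = of_nat (Suc x) * z * weight N a c a' c' q * raiseM N a c q p"
      using nzp b0 of_nat_neq_0[of n, where 'a=complex] by (simp del: of_nat_Suc)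
    then show ?thesis unfolding z_def xy(1) fst_conv N 1 by (simp add: lowerM_def del: of_nat_Suc)
  next
    case 2
    define M n where "M = N - Suc x" and "n = N - Suc x - y'"
    have N: "N - x = Suc M" "Suc M - Suc y' = n" "N - Suc x = M" "M - y' = n" and Mn: "M = n + y'"
      using q xy 2 by (auto simp: M_def n_def)
    define b where "b = c + of_nat (x + y + 1)"
    define f where "f = b + of_nat y'"
    define z where "z = c' - a' + of_nat (Suc M)"
    have c0: "c + of_nat k \<noteq> 0" if "2 \<le> k" "k \<le> 2 * N" for k
      using R that by (auto simp: regular_def)
    have "N = Suc x + y' + n" using xy 2 by (auto simp: n_def)
    then have f0: "f \<noteq> 0" "n = 0 \<or> f + 1 \<noteq> 0"
      using c0[of "x + y + 1 + y'"] c0[of "x + y + 1 + y' + 1"] 2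
      by (auto simp: f_def b_def add.assoc)
    have z0: "z \<noteq> 0" using R' q 2 N unfolding z_def regular_def by (simp del: of_nat_Suc)
    have e: "c + of_nat (x + Suc y') + 1 = b" "c + of_nat (x + 2 * Suc y' + 1) + 1 = f + 1 + 1"
       "c + of_nat (Suc x + y') + 1 = b" "c + of_nat (Suc x + 2 * y' + 1) + 1 = f + 1"
       "c' - a' + of_nat M + 1 = z" "c' - a' + of_nat (Suc M) + 1 = z + 1" "Suc x + y' = x + Suc y'"
       by (simp_all add: b_def z_def f_def 2)
    have P: "pochhammer z (Suc x) = z * pochhammer (z + 1) x"
        "pochhammer b (Suc y') = pochhammer b y' * f"
        "pochhammer (a + 1) (Suc y') = pochhammer (a + 1) y' * (a + of_nat (Suc y'))"
        "pochhammer (a' + 1) (Suc x) = pochhammer (a' + 1) x * (a' + of_nat (Suc x))"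
    proof -
      show "pochhammer z (Suc x) = z * pochhammer (z + 1) x" by (rule pochhammer_rec)
    qed (simp_all add: pochhammer_Suc f_def add_ac)
    have nzp: "pochhammer (f + 1) n \<noteq> 0" "pochhammer (f + 1 + 1) n \<noteq> 0"
      using weight_factors_nonzero(6)[OF R R' xy(2)] weight_factors_nonzero(6)[OF R R', of "Suc x" y'] q 2
      unfolding 2(2) diff_diff_left[symmetric] N e by simp_all
    define W where "W = fact M ^ 2 * pochhammer (a' + 1) x * pochhammer (a + 1) y' /
     (fact x * fact y' * fact n * pochhammer (z + 1) x *
      pochhammer (c - a + 1) (x + Suc y') * pochhammer b y')"
    have wp: "weight N a c a' c' p = of_nat (Suc M) ^ 2 * (a + of_nat (Suc y')) * W / (of_nat (Suc y') * f * pochhammer (f + 1 + 1) n)"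
      unfolding xy(1) 2(2) weight_def prod.case N e P fact_Suc of_nat_mult power_mult_distrib W_def
      by (simp add: mult.assoc mult.left_commute del: of_nat_Suc)
    have wq: "weight N a c a' c' q = (a' + of_nat (Suc x)) * W / (of_nat (Suc x) * z * pochhammer (f + 1) n)"
      unfolding 2(1) weight_def prod.case N e P fact_Suc of_nat_mult W_def
      by (simp add: mult.assoc mult.left_commute del: of_nat_Suc)
    \<comment> \<open>For \<open>n = 0\<close>, that is \<open>x + y = N\<close>, the denominator
      factor \<open>f + 1\<close> may vanish; the numerator then makes \<open>lower_coeff\<close>
      zero, and both sides equal \<open>y\<close>.\<close>
    have key: "(1 - lower_coeff N c x y) * (of_nat (Suc M) * pochhammer (f + 1) n) = of_nat (Suc y') * pochhammer (f + 1 + 1) n"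
    proof (cases "n = 0")
      case True
      then show ?thesis using Mn 2 unfolding lower_coeff_def N by simp
    next
      case False
      then have f1: "f + 1 \<noteq> 0" using f0 by simp
      have r: "pochhammer (f + 1) n * (f + 1 + of_nat n) = (f + 1) * pochhammer (f + 1 + 1) n"
        using pochhammer_rec[of "f + 1" n] pochhammer_Suc[of "f + 1" n] by simp
      have "lower_coeff N c x y = b * of_nat n / (of_nat (Suc M) * (f + 1))"
        using Mn unfolding lower_coeff_def N by (simp add: b_def f_def 2(2) algebra_simps)
      then have l: "1 - lower_coeff N c x y = of_nat (Suc y') * (f + 1 + of_nat n) / (of_nat (Suc M) * (f + 1))"
        using f1 of_nat_neq_0[of M, where 'a=complex]
        by (simp add: divide_simps del: of_nat_Suc) (simp add: Mn f_def algebra_simps)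
      have "(1 - lower_coeff N c x y) * (of_nat (Suc M) * pochhammer (f + 1) n)
         = of_nat (Suc y') * (pochhammer (f + 1) n * (f + 1 + of_nat n)) / (f + 1)"
        unfolding l using of_nat_neq_0[of M, where 'a=complex] by (simp del: of_nat_Suc)
      also have "\<dots> = of_nat (Suc y') * pochhammer (f + 1 + 1) n"
        unfolding r using f1 by (simp del: of_nat_Suc)
      finally show ?thesis .
    qed
    have r: "raiseM N a c q p = of_nat (Suc M) * (a + of_nat (Suc y')) / f"
      by (simp add: raiseM_def 2 xy N b_def f_def algebra_simps)
    have "(a' + of_nat (Suc x)) * weight N a c a' c' p * (1 - lower_coeff N c x y) * (of_nat (Suc y') * f * pochhammer (f + 1 + 1) n * pochhammer (f + 1) n)
      = (a' + of_nat (Suc x)) * of_nat (Suc M) * (a + of_nat (Suc y')) * W * ((1 - lower_coeff N c x y) * (of_nat (Suc M) * pochhammer (f + 1) n))"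
      unfolding wp using nzp f0 of_nat_neq_0[of y', where 'a=complex] by (simp add: power2_eq_square del: of_nat_Suc)
    also have "\<dots> = of_nat (Suc x) * z * weight N a c a' c' q * raiseM N a c q p * (of_nat (Suc y') * f * pochhammer (f + 1 + 1) n * pochhammer (f + 1) n)"
      unfolding wq r key using nzp f0 z0 of_nat_neq_0[of x, where 'a=complex] by (simp del: of_nat_Suc)
    finally have "(a' + of_nat (Suc x)) * weight N a c a' c' p * (1 - lower_coeff N c x y) = of_nat (Suc x) * z * weight N a c a' c' q * raiseM N a c q p"
      using nzp f0 of_nat_neq_0[of y', where 'a=complex] by (simp del: of_nat_Suc)
    then show ?thesis unfolding z_def xy(1) fst_conv N 2 by (simp add: lowerM_def del: of_nat_Suc)
  next
    case 3 then show ?thesis by simp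
  qed
qed

text \<open>Along each intermediate point \<open>u\<close> at \<open>x + 1\<close>,
  \<open>weight_lowerM\<close> replaces the \<open>L\<close> entry by an \<open>R\<close> entry. The
  result is a multiple of \<open>raiseM N a c u p * raiseM N a c u q\<close>, symmetric in
  \<open>p\<close> and \<open>q\<close>, and the factors depend only on the common
  \<open>x\<close>.\<close>

lemma lower_raiseM_symmetric:
  assumes R: "regular N a c" and R': "regular N a' c'" and p: "p \<in> dom2 N" and q: "q \<in> dom2 N"
  shows "weight N a c a' c' p * lower_raiseM N a c p q = weight N a c a' c' q * lower_raiseM N a c q p"
proof (cases "fst p = fst q")
  case False
  then have "lowerM N c p u * raiseM N a c u q = 0" "lowerM N c q u * raiseM N a c u p = 0" for u
    by (auto simp: lowerM_def raiseM_def)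
  then have "lower_raiseM N a c p q = 0" "lower_raiseM N a c q p = 0"
    unfolding lower_raiseM_def by (simp_all add: sum.neutral)
  then show ?thesis by simp
next
  case True
  have "weight N a c a' c' p * (lowerM N c p u * raiseM N a c u q) = weight N a c a' c' q * (lowerM N c q u * raiseM N a c u p)"
    if u: "u \<in> dom2 N" for u
  proof (cases "fst u = Suc (fst p)")
    case False
    then show ?thesis using True by (simp add: lowerM_def)
  next
    case u1: True
    let ?k = "a' + of_nat (Suc (fst p))" and ?l = "of_nat (Suc (fst p)) * (c' - a' + of_nat (N - fst p)) * weight N a c a' c' u"
    have k0: "?k \<noteq> 0" using R' u u1 unfolding regular_def dom2_def by (auto simp del: of_nat_Suc)
    have 1: "?k * (weight N a c a' c' p * (lowerM N c p u * raiseM N a c u q)) = ?l * raiseM N a c u p * raiseM N a c u q"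
    proof -
      have "?k * (weight N a c a' c' p * (lowerM N c p u * raiseM N a c u q)) = ?k * weight N a c a' c' p * lowerM N c p u * raiseM N a c u q"
        by (simp only: mult.assoc)
      then show ?thesis unfolding weight_lowerM[OF R R' p u] by (simp only: mult.assoc)
    qed
    have 2: "?k * (weight N a c a' c' q * (lowerM N c q u * raiseM N a c u p)) = ?l * raiseM N a c u p * raiseM N a c u q"
    proof -
      have "?k * (weight N a c a' c' q * (lowerM N c q u * raiseM N a c u p)) = (a' + of_nat (Suc (fst q))) * weight N a c a' c' q * lowerM N c q u * raiseM N a c u p"
        unfolding True by (simp only: mult.assoc)
      then show ?thesis unfolding weight_lowerM[OF R R' q u] unfolding True by (simp only: mult_ac)
    qed
    show ?thesis by (rule mult_left_cancel[OF k0, THEN iffD1]) (rule trans[OF 1 2[symmetric]])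
  qed
  then show ?thesis unfolding lower_raiseM_def sum_distrib_left by (intro sum.cong) auto
qed

lemma degreeM_symmetric:
  assumes "regular N a c" "regular N a' c'" "p \<in> dom2 N" "q \<in> dom2 N"
  shows "weight N a c a' c' p * degreeM N a c p q = weight N a c a' c' q * degreeM N a c q p"
  by (cases "p = q") (simp_all add: degreeM_def lower_raiseM_symmetric[OF assms] del: of_nat_diff)

text \<open>Off the diagonal, three parts of the matrix are compared: inside a column only
  \<open>L R\<close> contributes, between adjacent columns the \<open>L\<close> part faces the
  \<open>R\<close> part as in \<open>weight_lowerM\<close>, and all other entries are zero.\<close>

lemma quadraticM_symmetric:
  assumes R: "regular N a c" and R': "regular N a' c'" and p: "p \<in> dom2 N" and q: "q \<in> dom2 N"
  shows "weight N a c a' c' p * quadraticM N a c a' c' p q = weight N a c a' c' q * quadraticM N a c a' c' q p"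
proof -
  have up: "weight N a c a' c' p * quadraticM N a c a' c' p q = weight N a c a' c' q * quadraticM N a c a' c' q p"
    if p: "p \<in> dom2 N" and q: "q \<in> dom2 N" and 1: "fst q = Suc (fst p)" for p q
  proof -
    have z: "lower_raiseM N a c p q = 0" "lower_raiseM N a c q p = 0"
      unfolding lower_raiseM_def by (auto intro!: sum.neutral simp: lowerM_def raiseM_def 1)
    have z2: "raiseM N a c p q = 0" "lowerM N c q p = 0" "p \<noteq> q" using 1 by (auto simp: lowerM_def raiseM_def)
    have "fst p \<le> N" using p by (auto simp: dom2_def)
    then have Np: "of_nat (N - fst p) = (of_nat N - of_nat (fst p) :: complex)" by (simp add: of_nat_diff)
    have "weight N a c a' c' p * quadraticM N a c a' c' p q = - ((a' + of_nat (Suc (fst p))) * weight N a c a' c' p * lowerM N c p q)"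
      using z z2 by (simp add: quadraticM_def algebra_simps)
    also have "\<dots> = weight N a c a' c' q * quadraticM N a c a' c' q p"
      unfolding weight_lowerM[OF R R' p q] using z z2 by (simp add: quadraticM_def 1 Np algebra_simps)
    finally show ?thesis .
  qed
  consider "fst q = Suc (fst p)" | "fst p = Suc (fst q)" | "fst p = fst q" |
    "fst q \<noteq> Suc (fst p)" "fst p \<noteq> Suc (fst q)" "fst p \<noteq> fst q" by blast
  then show ?thesis
  proof cases
    case 1 then show ?thesis using up p q by blast
  next
    case 2 then show ?thesis using up p q by metis
  next
    case 3
    then have "lowerM N c p q = 0" "raiseM N a c p q = 0" "lowerM N c q p = 0" "raiseM N a c q p = 0"
      by (auto simp: lowerM_def raiseM_def)
    then have "weight N a c a' c' p * quadraticM N a c a' c' p q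
        = (of_nat (fst q) + a' + 1) * (weight N a c a' c' p * lower_raiseM N a c p q)"
      "weight N a c a' c' q * quadraticM N a c a' c' q p
        = (of_nat (fst q) + a' + 1) * (weight N a c a' c' q * lower_raiseM N a c q p)" if "p \<noteq> q"
      using that 3 by (simp_all add: quadraticM_def mult.left_commute)
    then show ?thesis using lower_raiseM_symmetric[OF R R' p q] by (cases "p = q") auto
  next
    case 4
    then have "quadraticM N a c a' c' p q = 0" "quadraticM N a c a' c' q p = 0"
      by (auto simp: quadraticM_def lower_raiseM_def lowerM_def raiseM_def intro!: sum.neutral)
    then show ?thesis by simp
  qed
qed

section \<open>Supports and non-vanishing entries\<close>

lemma lower_raiseM_support:
  assumes "lower_raiseM N a c p q \<noteq> 0"
  shows "fst p = fst q \<and> (snd p = snd q \<or> snd p = Suc (snd q) \<or> snd q = Suc (snd p))"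
proof -
  obtain u where "lowerM N c p u * raiseM N a c u q \<noteq> 0"
    using assms unfolding lower_raiseM_def by (meson sum.neutral)
  then show ?thesis by (auto simp: lowerM_def raiseM_def split: if_splits)
qed

lemma degreeM_support:
  "degreeM N a c p q \<noteq> 0 \<Longrightarrow> fst p = fst q \<and> (snd p = snd q \<or> snd p = Suc (snd q) \<or> snd q = Suc (snd p))"
  using lower_raiseM_support[of N a c p q] by (auto simp: degreeM_def split: if_splits)

lemma A2_adjacent_iff:
  "A2_adjacent p q \<longleftrightarrow> (fst p = fst q \<and> (snd p = snd q \<or> snd p = Suc (snd q) \<or> snd q = Suc (snd p))) \<or>
     (fst p = Suc (fst q) \<and> (snd p = snd q \<or> snd q = Suc (snd p))) \<or>
     (fst q = Suc (fst p) \<and> (snd p = snd q \<or> snd p = Suc (snd q)))"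
proof -
  have z: "int a - int b = 0 \<longleftrightarrow> a = b" "int a - int b = 1 \<longleftrightarrow> a = Suc b" "int a - int b = - 1 \<longleftrightarrow> b = Suc a" for a b :: nat
    by linarith+
  show ?thesis unfolding A2_adjacent_def A2_def insert_iff empty_iff prod.inject z by blast
qed

text \<open>The product \<open>L R\<close> keeps \<open>x\<close> and changes \<open>y\<close> by at
  most one; \<open>L\<close> and \<open>R\<close> contribute the four neighbours with another
  \<open>x\<close>. Together these are exactly the seven displacements of \<open>A2\<close>.\<close>

lemma quadraticM_support:
  assumes "quadraticM N a c a' c' p q \<noteq> 0"
  shows "A2_adjacent p q"
proof -
  have "lower_raiseM N a c p q \<noteq> 0 \<or> lowerM N c p q \<noteq> 0 \<or> raiseM N a c p q \<noteq> 0 \<or> p = q"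
    using assms by (auto simp: quadraticM_def split: if_splits)
  then show ?thesis
    using lower_raiseM_support[of N a c p q]
    by (auto simp: A2_adjacent_iff lowerM_def raiseM_def split: if_splits)
qed

text \<open>Only one path leads from \<open>(x, y)\<close> to \<open>(x, y + 1)\<close>, through
  \<open>(x + 1, y)\<close>, so the entry is a single product and cannot cancel.\<close>

lemma degreeM_up_nonzero:
  assumes R: "regular N a c" and p: "x + Suc y \<le> N"
  shows "degreeM N a c (x, y) (x, Suc y) \<noteq> 0"
proof -
  have "lower_raiseM N a c (x, y) (x, Suc y) = lower_coeff N c x y * raiseM N a c (Suc x, y) (x, Suc y)"
    unfolding lower_raiseM_def using p by (subst sum_lowerM) (auto simp: raiseM_def)
  moreover have "lower_coeff N c x y \<noteq> 0"
  proof (cases "y = 0")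
    case False
    have "c + of_nat (x + y + 1) \<noteq> 0" "c + of_nat (2 * y + 1 + x) \<noteq> 0"
      using R p False unfolding regular_def by (auto simp del: of_nat_add of_nat_mult of_nat_Suc)
    moreover have "of_nat y + 1 + (c + of_nat x) = c + of_nat (x + y + 1)"
      "2 * of_nat y + 1 + (c + of_nat x) = c + of_nat (2 * y + 1 + x)" by simp_all
    moreover have "(of_nat (N - x) - of_nat y :: complex) \<noteq> 0" "(of_nat (N - x) :: complex) \<noteq> 0"
      using p by (auto simp del: of_nat_diff)
    ultimately show ?thesis using False unfolding lower_coeff_def by (simp only: if_False divide_eq_0_iff mult_eq_0_iff) simp
  qed (simp add: lower_coeff_def)
  moreover have "raiseM N a c (Suc x, y) (x, Suc y) \<noteq> 0"
  proof -
    have "a + of_nat (Suc y) \<noteq> 0" "c + of_nat (2 * y + 1 + Suc x) \<noteq> 0"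
      using R p unfolding regular_def by (auto simp del: of_nat_add of_nat_mult of_nat_Suc)
    moreover have "(of_nat (N - Suc x) + 1 :: complex) \<noteq> 0" using of_nat_neq_0[of "N - Suc x", where 'a=complex] by (simp add: add.commute del: of_nat_diff)
    moreover have e: "2 * of_nat y + 1 + (c + of_nat (Suc x)) = c + of_nat (2 * y + 1 + Suc x)"
      "of_nat y + 1 + a = a + of_nat (Suc y)" by simp_all
    ultimately show ?thesis unfolding raiseM_def fst_conv snd_conv e by (simp del: of_nat_diff of_nat_Suc of_nat_add)
  qed
  ultimately show ?thesis by (simp add: degreeM_def)
qed

lemma degreeM_down_nonzero:
  assumes R: "regular N a c" and R': "regular N a' c'" and p: "x + Suc y \<le> N"
  shows "degreeM N a c (x, Suc y) (x, y) \<noteq> 0"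
  using degreeM_symmetric[OF R R', of "(x, y)" "(x, Suc y)"] p degreeM_up_nonzero[OF R p]
    weight_nonzero[OF R R', of "(x, y)"]
  by auto

text \<open>On the edge \<open>y = 0\<close> the entry is just \<open>- (x + a' + 1)\<close>,
  because \<open>lower_coeff\<close> is 1 there. Passing from column to column along this edge is
  enough for irreducibility.\<close>

lemma quadraticM_up_nonzero:
  assumes R': "regular N a' c'" and p: "Suc x \<le> N"
  shows "quadraticM N a c a' c' (x, 0) (Suc x, 0) \<noteq> 0"
proof -
  have "lower_raiseM N a c (x, 0) (Suc x, 0) = 0" using lower_raiseM_support[of N a c "(x, 0)" "(Suc x, 0)"] by auto
  moreover have "a' + of_nat (Suc x) \<noteq> 0" using R' p unfolding regular_def by (simp del: of_nat_Suc)
  moreover have e: "of_nat x + a' + 1 = a' + of_nat (Suc x)" by simp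
  ultimately show ?thesis unfolding quadraticM_def fst_conv e by (simp add: lowerM_def raiseM_def lower_coeff_def neg_eq_iff_add_eq_0 del: of_nat_Suc)
qed

lemma quadraticM_down_nonzero:
  assumes R: "regular N a c" and R': "regular N a' c'" and p: "Suc x \<le> N"
  shows "quadraticM N a c a' c' (Suc x, 0) (x, 0) \<noteq> 0"
  using quadraticM_symmetric[OF R R', of "(x, 0)" "(Suc x, 0)"] p quadraticM_up_nonzero[OF R' p]
    weight_nonzero[OF R R', of "(x, 0)"]
  by auto

section \<open>Pairs of operators with a joint eigenbasis\<close>

context complex_vector_space
begin

section \<open>Endomorphisms of a subspace and spans of two operators\<close>

lemma End_sum:
  assumes "h \<in> End V" "subspace V" "finite S" "\<And>p. p \<in> S \<Longrightarrow> b p \<in> V"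
  shows "h (\<Sum>p\<in>S. scale (c p) (b p)) = (\<Sum>p\<in>S. scale (c p) (h (b p)))"
  using assms(3,4)
proof (induction S rule: finite_induct)
  case empty
  have "h (scale 0 0) = scale 0 (h 0)" using assms(1,2) subspace_0 unfolding End_def by blast
  then show ?case by simp
next
  case (insert p S)
  then have "scale (c p) (b p) \<in> V" "(\<Sum>p\<in>S. scale (c p) (b p)) \<in> V"
    using assms(2) by (auto intro!: subspace_sum subspace_scale)
  then show ?case using insert assms(1) unfolding End_def by simp
qed

lemma eigenvector_span:
  assumes "f \<in> End V" "b \<in> V" "f b = scale z b" "u \<in> span {b}"
  shows "f u = scale z u"
proof -
  obtain k where k: "u = scale k b" using assms(4) by (auto simp: span_singleton)
  have "f u = scale k (f b)" unfolding k using assms(1,2) by (simp add: End_def)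
  then show ?thesis unfolding assms(3) k by (simp add: mult.commute)
qed

lemma endo_span_pair:
  "endo.span {X, Y} = {h. \<exists>\<alpha> \<beta>. h = (\<lambda>v. scale \<alpha> (X v) + scale \<beta> (Y v))}"
proof -
  have "h \<in> endo.span {X, Y} \<longleftrightarrow> (\<exists>\<alpha> \<beta>. h = (\<lambda>v. scale \<alpha> (X v) + scale \<beta> (Y v)))" for h
  proof -
    have "h \<in> endo.span {X, Y} \<longleftrightarrow> (\<exists>\<alpha> \<beta>. h - (\<lambda>v. scale \<alpha> (X v)) = (\<lambda>v. scale \<beta> (Y v)))"
      by (auto simp: endo.span_insert[of X "{Y}"] endo.span_singleton)
    also have "\<dots> \<longleftrightarrow> (\<exists>\<alpha> \<beta>. h = (\<lambda>v. scale \<alpha> (X v) + scale \<beta> (Y v)))"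
      by (auto simp: fun_eq_iff algebra_simps)
    finally show ?thesis .
  qed
  then show ?thesis by blast
qed

lemma subspace_common_eigenspace:
  assumes V: "subspace V" and H: "H \<subseteq> End V"
  shows "subspace {v \<in> V. \<forall>h\<in>H. h v = scale (\<alpha> h) v}"
  unfolding subspace_def mem_Collect_eq
proof (intro conjI ballI allI)
  fix h assume "h \<in> H"
  then have h: "h \<in> End V" using H by blast
  show "h 0 = scale (\<alpha> h) 0" using End_sum[OF h V, of "{}"] by simp
  fix x y assume "x \<in> {v \<in> V. \<forall>h\<in>H. h v = scale (\<alpha> h) v}" "y \<in> {v \<in> V. \<forall>h\<in>H. h v = scale (\<alpha> h) v}"
  then have "x \<in> V" "y \<in> V" "h x = scale (\<alpha> h) x" "h y = scale (\<alpha> h) y" using \<open>h \<in> H\<close> by blast+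
  then show "h (x + y) = scale (\<alpha> h) (x + y)" using h by (simp add: End_def scale_right_distrib)
next
  fix h c x assume hx: "h \<in> H" "x \<in> {v \<in> V. \<forall>h\<in>H. h v = scale (\<alpha> h) v}"
  then have "x \<in> V" "h x = scale (\<alpha> h) x" by blast+
  moreover have "h \<in> End V" using hx H by blast
  ultimately have "h (scale c x) = scale c (scale (\<alpha> h) x)" by (simp add: End_def)
  then show "h (scale c x) = scale (\<alpha> h) (scale c x)" by (simp add: mult.commute)
qed (use V in \<open>blast intro: subspace_0 subspace_add subspace_scale\<close>)+

lemma End_comp: "g \<in> End V \<Longrightarrow> h \<in> End V \<Longrightarrow> subspace V \<Longrightarrow> g \<circ> h \<in> End V"
  by (auto simp: End_def dest: subspace_0) (metis scale_zero_left subspace_0)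

lemma endo_span_image_subset:
  assumes "subspace V" "X \<in> End V" "Y \<in> End V" "v \<in> V" "subspace S" "X v \<in> S" "Y v \<in> S" "h \<in> endo.span {X, Y}"
  shows "h ` span {v} \<subseteq> S"
proof -
  obtain \<alpha> \<beta> where h: "h = (\<lambda>v. scale \<alpha> (X v) + scale \<beta> (Y v))" using assms(8) unfolding endo_span_pair by blast
  have "h (scale k v) \<in> S" for k
  proof -
    have "X (scale k v) = scale k (X v)" "Y (scale k v) = scale k (Y v)" using assms(2-4) by (auto simp: End_def)
    then show ?thesis unfolding h using assms(5-7) by (auto intro!: subspace_add subspace_scale)
  qed
  then show ?thesis by (auto simp: span_singleton)
qed

end

section \<open>Joint eigenvectors with separated eigenvalues\<close>

locale joint_eigenvectors = complex_vector_space scale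
  for scale :: "complex \<Rightarrow> 'v::ab_group_add \<Rightarrow> 'v" +
  fixes V :: "'v set" and D :: "'i set" and b :: "'i \<Rightarrow> 'v" and X Y :: "'v \<Rightarrow> 'v" and t u :: "'i \<Rightarrow> complex"
  assumes subspace_V: "subspace V" and finite_D: "finite D"
    and b_in_V: "\<And>p. p \<in> D \<Longrightarrow> b p \<in> V" and b_nonzero: "\<And>p. p \<in> D \<Longrightarrow> b p \<noteq> 0"
    and X_End: "X \<in> End V" and Y_End: "Y \<in> End V"
    and X_b: "\<And>p. p \<in> D \<Longrightarrow> X (b p) = scale (t p) (b p)"
    and Y_b: "\<And>p. p \<in> D \<Longrightarrow> Y (b p) = scale (u p) (b p)"
    and separated: "\<And>p q. p \<in> D \<Longrightarrow> q \<in> D \<Longrightarrow> t p = t q \<Longrightarrow> u p = u q \<Longrightarrow> p = q"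
begin

text \<open>For \<open>q \<noteq> p\<close> one of \<open>X\<close>, \<open>Y\<close> has different
  eigenvalues at \<open>p\<close> and \<open>q\<close>. Subtracting its eigenvalue at
  \<open>q\<close> removes the \<open>q\<close> component, keeps the \<open>p\<close> component
  nonzero and stays in \<open>W\<close>; repeating this isolates \<open>b p\<close>.\<close>

lemma component_in_invariant_subspace:
  assumes W: "subspace W" "X ` W \<subseteq> W" "Y ` W \<subseteq> W"
  shows "S \<subseteq> D \<Longrightarrow> (\<Sum>p\<in>S. scale (c p) (b p)) \<in> W \<Longrightarrow> p \<in> S \<Longrightarrow> c p \<noteq> 0 \<Longrightarrow> b p \<in> W"
proof (induction "card S" arbitrary: S c)
  case 0
  then show ?case using finite_subset[OF _ finite_D] by auto
next
  case (Suc n)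
  have fin: "finite S" using Suc.prems(1) finite_D finite_subset by blast
  let ?v = "\<Sum>p\<in>S. scale (c p) (b p)"
  show ?case
  proof (cases "S = {p}")
    case True
    then have "scale (c p) (b p) \<in> W" using Suc.prems(2) by simp
    from subspace_scale[OF W(1) this, of "inverse (c p)"] show ?thesis using Suc.prems(4) by simp
  next
    case False
    then obtain q where q: "q \<in> S" "q \<noteq> p" using Suc.prems(3) by blast
    have pq: "p \<in> D" "q \<in> D" using q Suc.prems by auto
    have "\<exists>Z z. Z \<in> End V \<and> Z ` W \<subseteq> W \<and> (\<forall>r\<in>D. Z (b r) = scale (z r) (b r)) \<and> z p \<noteq> z q"
    proof (cases "t p = t q")
      case True
      then have "u p \<noteq> u q" using separated pq q by blast
      then show ?thesis using Y_End W Y_b by blast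
    next
      case False
      then show ?thesis using X_End W X_b by blast
    qed
    then obtain Z z where Z: "Z \<in> End V" "Z ` W \<subseteq> W" "\<And>r. r \<in> D \<Longrightarrow> Z (b r) = scale (z r) (b r)" "z p \<noteq> z q"
      by blast
    have "Z ?v = (\<Sum>r\<in>S. scale (c r) (Z (b r)))"
      using Z(1) subspace_V fin b_in_V Suc.prems(1) by (intro End_sum) auto
    also have "\<dots> = (\<Sum>r\<in>S. scale (c r * z r) (b r))"
      using Z(3) Suc.prems(1) by (intro sum.cong) auto
    finally have "Z ?v - scale (z q) ?v = (\<Sum>r\<in>S. scale (c r * (z r - z q)) (b r))"
      by (simp add: scale_sum_right sum_subtractf right_diff_distrib scale_left_diff_distrib mult.commute)
    also have "\<dots> = (\<Sum>r\<in>S - {q}. scale (c r * (z r - z q)) (b r))"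
      using fin q by (subst sum.remove[of _ q]) auto
    finally have eq: "Z ?v - scale (z q) ?v = \<dots>" .
    have "Z ?v - scale (z q) ?v \<in> W"
      using Z(2) Suc.prems(2) W(1) by (intro subspace_diff subspace_scale) auto
    moreover have "n = card (S - {q})" using Suc.hyps(2) q fin by simp
    ultimately show ?thesis
      using Suc.hyps(1)[of "S - {q}" "\<lambda>r. c r * (z r - z q)"] Suc.prems q Z(4) unfolding eq by auto
  qed
qed

text \<open>Linear independence is the case \<open>W = {0}\<close> of the previous lemma.\<close>

lemma coefficients_zero:
  assumes "(\<Sum>p\<in>D. scale (c p) (b p)) = 0" "p \<in> D"
  shows "c p = 0"
proof (rule ccontr)
  assume "c p \<noteq> 0"
  have "X 0 = 0" "Y 0 = 0" using End_sum[OF X_End subspace_V, of "{}"] End_sum[OF Y_End subspace_V, of "{}"] by auto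
  then have "b p \<in> {0}"
    using component_in_invariant_subspace[of "{0}" D c p] assms \<open>c p \<noteq> 0\<close> by auto
  then show False using b_nonzero assms(2) by auto
qed

lemma b_inj: "inj_on b D"
proof (rule inj_onI, rule ccontr)
  fix p q assume pq: "p \<in> D" "q \<in> D" "b p = b q" "p \<noteq> q"
  have "scale (t p - t q) (b p) = 0" "scale (u p - u q) (b p) = 0"
    using X_b Y_b pq by (metis scale_left_diff_distrib right_minus_eq)+
  then show False using separated b_nonzero pq by auto
qed

lemma b_independent: "independent (b ` D)"
proof (rule independent_if_scalars_zero)
  fix f v assume "(\<Sum>x\<in>b ` D. scale (f x) x) = 0" "v \<in> b ` D"
  then show "f v = 0" using coefficients_zero[of "f \<circ> b"] by (auto simp: sum.reindex[OF b_inj])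
qed (simp add: finite_D)

lemma span_eq_if_card:
  assumes "finite B" "span B = V" "card B = card D"
  shows "span (b ` D) = V"
proof -
  have sub: "b ` D \<subseteq> V" using b_in_V by auto
  have "v \<in> span (b ` D)" if "v \<in> V" for v
  proof (rule ccontr)
    assume v: "v \<notin> span (b ` D)"
    then have "independent (insert v (b ` D))" by (simp add: independent_insert b_independent)
    then have "card (insert v (b ` D)) \<le> card B"
      using independent_span_bound[OF assms(1)] assms(2) sub that by auto
    moreover have "v \<notin> b ` D" using v span_base by blast
    ultimately show False using finite_D assms(3) card_image[OF b_inj] by simp
  qed
  then show ?thesis using sub subspace_V by (metis span_minimal subset_antisym subsetI)
qed

end

text \<open>Separate from \<open>joint_eigenvectors\<close> because for the dual vectors the
  spanning property is itself a conclusion: they are independent and as numerous as the basis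
  \<open>delta\<close>.\<close>

locale joint_eigenbasis = joint_eigenvectors +
  assumes span_b: "span (b ` D) = V"
begin

lemma expansion:
  assumes "v \<in> V"
  obtains c where "v = (\<Sum>p\<in>D. scale (c p) (b p))"
proof -
  have "v \<in> range (\<lambda>c. \<Sum>x\<in>b ` D. scale (c x) x)"
    using assms finite_D span_finite[of "b ` D"] span_b by auto
  then show thesis using that by (auto simp: sum.reindex[OF b_inj])
qed

lemma dim_V: "dim V = card D"
  using dim_span[of "b ` D"] dim_eq_card_independent[OF b_independent] card_image[OF b_inj] span_b by simp

lemma End_eqI:
  assumes "g \<in> End V" "h \<in> End V" "\<And>p. p \<in> D \<Longrightarrow> g (b p) = h (b p)"
  shows "g = h"
proof
  fix v
  show "g v = h v"
  proof (cases "v \<in> V")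
    case True
    then obtain c where "v = (\<Sum>p\<in>D. scale (c p) (b p))" by (rule expansion)
    then show ?thesis using assms b_in_V finite_D subspace_V by (simp add: End_sum)
  next
    case False
    then show ?thesis using assms by (simp add: End_def)
  qed
qed

lemma eigenvector_in_span:
  assumes "v \<in> V" "p \<in> D" "X v = scale (t p) v" "Y v = scale (u p) v"
  shows "v \<in> span {b p}"
proof -
  obtain c where c: "v = (\<Sum>q\<in>D. scale (c q) (b q))" using assms(1) by (rule expansion)
  have "c q = 0" if q: "q \<in> D" "q \<noteq> p" for q
  proof -
    have "X v = (\<Sum>q\<in>D. scale (c q * t q) (b q))" "Y v = (\<Sum>q\<in>D. scale (c q * u q) (b q))"
      unfolding c using b_in_V X_b Y_b End_sum[OF X_End subspace_V finite_D] End_sum[OF Y_End subspace_V finite_D]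
      by auto
    then have "(\<Sum>q\<in>D. scale (c q * (t q - t p)) (b q)) = 0" "(\<Sum>q\<in>D. scale (c q * (u q - u p)) (b q)) = 0"
      using assms(3,4) c by (simp_all add: right_diff_distrib scale_left_diff_distrib sum_subtractf scale_sum_right mult.commute)
    then have "c q * (t q - t p) = 0" "c q * (u q - u p) = 0"
      using coefficients_zero[of "\<lambda>q. c q * (t q - t p)"] coefficients_zero[of "\<lambda>q. c q * (u q - u p)"] q by blast+
    then show ?thesis using separated[OF q(1) assms(2)] q(2) by auto
  qed
  then have "v = scale (c p) (b p)"
    unfolding c using finite_D assms(2) by (subst sum.remove[of _ p]) (auto intro!: sum.neutral)
  then show ?thesis by (simp add: span_base span_scale)
qed

lemma pair_eigenvalue:
  assumes "h \<in> endo.span {X, Y}"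
  obtains z where "\<And>p. p \<in> D \<Longrightarrow> h (b p) = scale (z p) (b p)"
proof -
  obtain \<alpha> \<beta> where h: "h = (\<lambda>v. scale \<alpha> (X v) + scale \<beta> (Y v))" using assms unfolding endo_span_pair by blast
  show thesis
    by (rule that[of "\<lambda>p. \<alpha> * t p + \<beta> * u p"]) (simp add: h X_b Y_b scale_left_distrib)
qed

lemma pair_End:
  assumes "h \<in> endo.span {X, Y}" shows "h \<in> End V"
proof -
  obtain \<alpha> \<beta> where h: "h = (\<lambda>v. scale \<alpha> (X v) + scale \<beta> (Y v))" using assms unfolding endo_span_pair by blast
  show ?thesis using X_End Y_End subspace_V unfolding h End_def
    by (auto simp: scale_right_distrib mult.commute intro!: subspace_add subspace_scale)
qed

lemma pair_commute:
  assumes "g \<in> endo.span {X, Y}" "h \<in> endo.span {X, Y}" shows "g \<circ> h = h \<circ> g"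
proof (rule End_eqI)
  obtain y where y: "\<And>p. p \<in> D \<Longrightarrow> g (b p) = scale (y p) (b p)" using pair_eigenvalue assms(1) by blast
  obtain z where z: "\<And>p. p \<in> D \<Longrightarrow> h (b p) = scale (z p) (b p)" using pair_eigenvalue assms(2) by blast
  fix p assume p: "p \<in> D"
  have "g (scale k (b p)) = scale k (g (b p))" "h (scale k (b p)) = scale k (h (b p))" for k
    using pair_End assms b_in_V[OF p] by (auto simp: End_def)
  then show "(g \<circ> h) (b p) = (h \<circ> g) (b p)" using y[OF p] z[OF p] by (simp add: mult.commute)
qed (use assms pair_End subspace_V End_comp in auto)

lemma pair_diagonalizable: "h \<in> endo.span {X, Y} \<Longrightarrow> diagonalizable_on V h"
  unfolding diagonalizable_on_def using b_in_V b_independent span_b pair_eigenvalue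
  by (intro exI[of _ "b ` D"]) (metis image_iff image_subset_iff)

lemma pair_independent:
  assumes "\<And>\<alpha> \<beta>. (\<And>p. p \<in> D \<Longrightarrow> \<alpha> * t p + \<beta> * u p = 0) \<Longrightarrow> \<alpha> = 0 \<and> \<beta> = 0"
  shows "X \<noteq> Y" "endo.independent {X, Y}"
proof -
  have *: "\<alpha> = 0 \<and> \<beta> = 0" if "\<And>v. scale \<alpha> (X v) + scale \<beta> (Y v) = 0" for \<alpha> \<beta>
  proof (rule assms)
    fix p assume p: "p \<in> D"
    have "scale (\<alpha> * t p + \<beta> * u p) (b p) = 0" using that[of "b p"] X_b[OF p] Y_b[OF p] by (simp add: scale_left_distrib)
    then show "\<alpha> * t p + \<beta> * u p = 0" using b_nonzero[OF p] by simp
  qed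
  show "X \<noteq> Y" using *[of 1 "-1"] by auto
  show "endo.independent {X, Y}"
  proof (rule endo.independent_if_scalars_zero)
    fix f Z assume f: "(\<Sum>Z\<in>{X, Y}. (\<lambda>v. scale (f Z) (Z v))) = 0" "Z \<in> {X, Y}"
    then have "scale (f X) (X v) + scale (f Y) (Y v) = 0" for v
      using \<open>X \<noteq> Y\<close> by (simp add: fun_eq_iff)
    then show "f Z = 0" using *[of "f X" "f Y"] f(2) by auto
  qed simp
qed

lemma pair_dim:
  assumes "\<And>\<alpha> \<beta>. (\<And>p. p \<in> D \<Longrightarrow> \<alpha> * t p + \<beta> * u p = 0) \<Longrightarrow> \<alpha> = 0 \<and> \<beta> = 0"
  shows "endo.dim (endo.span {X, Y}) = 2"
  using pair_independent[OF assms] endo.dim_eq_card_independent[of "{X, Y}"] by (simp add: endo.dim_span)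

lemma dim_eigenspace: "p \<in> D \<Longrightarrow> dim (span {b p}) = 1"
  using b_nonzero[of p] dim_eq_card_independent[of "{b p}"] by (simp add: dim_span independent_insert)

text \<open>For surjectivity, a common eigenspace is invariant under \<open>X\<close> and
  \<open>Y\<close>, hence contains some \<open>b p\<close>. Its eigenvalues are then those of
  \<open>b p\<close>, and separation confines it to the line through \<open>b p\<close>.\<close>

lemma bij_common_eigenspaces:
  "bij_betw (\<lambda>p. span {b p}) D (common_eigenspaces V (endo.span {X, Y}))"
proof -
  let ?H = "endo.span {X, Y}"
  have XY: "X \<in> ?H" "Y \<in> ?H" by (auto intro: endo.span_base)
  have "inj_on (\<lambda>p. span {b p}) D"
  proof (rule inj_onI)
    fix p q assume pq: "p \<in> D" "q \<in> D" "span {b p} = span {b q}"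
    then obtain k where k: "b p = scale k (b q)" by (metis insertI1 span_base span_singleton rangeE)
    have "X (b p) = scale k (X (b q))" "Y (b p) = scale k (Y (b q))"
      unfolding k using X_End Y_End b_in_V[OF pq(2)] by (auto simp: End_def)
    then have "X (b p) = scale (t q) (b p)" "Y (b p) = scale (u q) (b p)"
      unfolding X_b[OF pq(2)] Y_b[OF pq(2)] by (simp_all add: k mult.commute)
    then show "p = q" using X_b Y_b b_nonzero separated pq by (metis scale_right_imp_eq)
  qed
  moreover have "span {b p} \<in> common_eigenspaces V ?H" if p: "p \<in> D" for p
  proof -
    \<comment> \<open>A common eigenspace requires one eigenvalue function on the whole span, so an
      eigenvalue is chosen for each element.\<close>
    define \<alpha> where "\<alpha> h = (SOME z. h (b p) = scale z (b p))" for h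
    have \<alpha>: "h (b p) = scale (\<alpha> h) (b p)" if "h \<in> ?H" for h
      unfolding \<alpha>_def by (rule someI_ex) (metis pair_eigenvalue that p)
    have "span {b p} = {v \<in> V. \<forall>h\<in>?H. h v = scale (\<alpha> h) v}"
    proof (intro set_eqI iffI)
      fix v assume "v \<in> span {b p}"
      then obtain k where k: "v = scale k (b p)" by (auto simp: span_singleton)
      have "h v = scale (\<alpha> h) v" if "h \<in> ?H" for h
      proof -
        have "h v = scale k (h (b p))" unfolding k using pair_End[OF that] b_in_V[OF p] by (auto simp: End_def)
        then show ?thesis by (simp add: \<alpha>[OF that] k mult.commute)
      qed
      moreover have "v \<in> V" unfolding k by (rule subspace_scale[OF subspace_V b_in_V[OF p]])
      ultimately show "v \<in> {v \<in> V. \<forall>h\<in>?H. h v = scale (\<alpha> h) v}" by blast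
    next
      fix v assume "v \<in> {v \<in> V. \<forall>h\<in>?H. h v = scale (\<alpha> h) v}"
      then have v: "v \<in> V" "X v = scale (\<alpha> X) v" "Y v = scale (\<alpha> Y) v" using XY by blast+
      have "\<alpha> X = t p" "\<alpha> Y = u p" using \<alpha> XY X_b Y_b p b_nonzero by (metis scale_right_imp_eq)+
      then show "v \<in> span {b p}" using v p by (intro eigenvector_in_span) simp_all
    qed
    moreover have "span {b p} \<noteq> {0}" using b_nonzero[OF p] span_base[of "b p" "{b p}"] by auto
    ultimately show ?thesis unfolding common_eigenspaces_def by blast
  qed
  moreover have "\<exists>p\<in>D. W = span {b p}" if W: "W \<in> common_eigenspaces V ?H" for W
  proof -
    obtain \<alpha> where W0: "W \<noteq> {0}" and W\<alpha>: "W = {v \<in> V. \<forall>h\<in>?H. h v = scale (\<alpha> h) v}"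
      using W unfolding common_eigenspaces_def by blast
    have sub: "subspace W"
      unfolding W\<alpha> using subspace_V pair_End by (intro subspace_common_eigenspace) blast+
    have WX: "w \<in> V" "X w = scale (\<alpha> X) w" "Y w = scale (\<alpha> Y) w" if "w \<in> W" for w
      using that XY unfolding W\<alpha> by blast+
    obtain v where v: "v \<in> W" "v \<noteq> 0" using sub W0 subspace_0 by blast
    obtain c where c: "v = (\<Sum>p\<in>D. scale (c p) (b p))" by (rule expansion[OF WX(1)[OF v(1)]])
    have "\<exists>p\<in>D. c p \<noteq> 0"
    proof (rule ccontr)
      assume "\<not> (\<exists>p\<in>D. c p \<noteq> 0)"
      then show False using v(2) unfolding c by simp
    qed
    then obtain p where p: "p \<in> D" "c p \<noteq> 0" by blast
    have inv: "X ` W \<subseteq> W" "Y ` W \<subseteq> W"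
      by (auto simp only: image_subset_iff WX(2,3) intro!: subspace_scale[OF sub])
    have bp: "b p \<in> W" using component_in_invariant_subspace[OF sub inv, of D c p] v c p by auto
    have "\<alpha> X = t p" "\<alpha> Y = u p"
      using WX(2,3)[OF bp] X_b[OF p(1)] Y_b[OF p(1)] b_nonzero[OF p(1)] by auto
    then have "W \<subseteq> span {b p}" by (metis WX eigenvector_in_span p(1) subsetI)
    moreover have "span {b p} \<subseteq> W" using bp sub by (simp add: span_minimal)
    ultimately show ?thesis using p by blast
  qed
  ultimately show ?thesis unfolding bij_betw_def by blast
qed

end

section \<open>Operators given by matrices\<close>

definition functions_on :: "nat \<Rightarrow> (nat \<times> nat \<Rightarrow> complex) set" where
  "functions_on N = {f. \<forall>p. p \<notin> dom2 N \<longrightarrow> f p = 0}"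

text \<open>Rows index the output. Functions not supported on the domain are sent to zero, as
  membership in \<open>End\<close> demands.\<close>

definition matrix_op ::
  "nat \<Rightarrow> (nat \<times> nat \<Rightarrow> nat \<times> nat \<Rightarrow> complex) \<Rightarrow> (nat \<times> nat \<Rightarrow> complex) \<Rightarrow> nat \<times> nat \<Rightarrow> complex" where
  "matrix_op N C f = (\<lambda>p. if f \<in> functions_on N \<and> p \<in> dom2 N then \<Sum>q\<in>dom2 N. C p q * f q else 0)"

definition delta :: "nat \<times> nat \<Rightarrow> nat \<times> nat \<Rightarrow> complex" where
  "delta p = (\<lambda>q. if q = p then 1 else 0)"

definition diagM :: "(nat \<times> nat \<Rightarrow> complex) \<Rightarrow> nat \<times> nat \<Rightarrow> nat \<times> nat \<Rightarrow> complex" where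
  "diagM t p q = (if p = q then t p else 0)"

definition weighted_form ::
  "nat \<Rightarrow> (nat \<times> nat \<Rightarrow> complex) \<Rightarrow> (nat \<times> nat \<Rightarrow> complex) \<Rightarrow> (nat \<times> nat \<Rightarrow> complex) \<Rightarrow> complex" where
  "weighted_form N w f g = (\<Sum>p\<in>dom2 N. w p * f p * g p)"

lemma sum_fun_scale_apply: "(\<Sum>q\<in>S. fun_scale (c q) (b q)) p = (\<Sum>q\<in>S. c q * b q p)"
  by (induction S rule: infinite_finite_induct) (auto simp: fun_scale_def)

lemma subspace_functions_on: "fun_space.subspace (functions_on N)"
  by (auto simp: fun_space.subspace_def functions_on_def fun_scale_def)

lemma matrix_op_End: "matrix_op N C \<in> fun_space.End (functions_on N)"
  by (auto simp: fun_space.End_def matrix_op_def functions_on_def fun_scale_def fun_eq_iff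
      sum.distrib sum_distrib_left algebra_simps)

lemma delta_in [simp]: "p \<in> dom2 N \<Longrightarrow> delta p \<in> functions_on N"
  by (auto simp: functions_on_def delta_def)

lemma delta_expansion:
  assumes "f \<in> functions_on N"
  shows "f = (\<Sum>p\<in>dom2 N. fun_scale (f p) (delta p))"
proof
  fix q
  have "(\<Sum>p\<in>dom2 N. fun_scale (f p) (delta p)) q = (\<Sum>p\<in>dom2 N. if p = q then f p else 0)"
    unfolding sum_fun_scale_apply by (intro sum.cong) (auto simp: delta_def)
  then show "f q = (\<Sum>p\<in>dom2 N. fun_scale (f p) (delta p)) q"
    using assms by (simp add: functions_on_def del: split_paired_All)
qed

lemma matrix_op_delta_apply: "p \<in> dom2 N \<Longrightarrow> q \<in> dom2 N \<Longrightarrow> matrix_op N C (delta q) p = C p q"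
  by (simp add: matrix_op_def) (simp add: delta_def if_distrib[of "\<lambda>z. _ * z"] cong: if_cong)

lemma matrix_op_delta:
  assumes "q \<in> dom2 N"
  shows "matrix_op N C (delta q) = (\<Sum>p\<in>dom2 N. fun_scale (C p q) (delta p))"
proof -
  have "matrix_op N C (delta q) \<in> functions_on N" by (simp add: functions_on_def matrix_op_def)
  from delta_expansion[OF this] have "matrix_op N C (delta q) = (\<Sum>p\<in>dom2 N. fun_scale (matrix_op N C (delta q) p) (delta p))" .
  also have "\<dots> = (\<Sum>p\<in>dom2 N. fun_scale (C p q) (delta p))"
    using assms by (intro sum.cong) (auto simp: matrix_op_delta_apply)
  finally show ?thesis .
qed

lemma matrix_op_diagM: "f \<in> functions_on N \<Longrightarrow> matrix_op N (diagM t) f = (\<lambda>p. t p * f p)"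
  by (auto simp: matrix_op_def diagM_def fun_eq_iff functions_on_def if_distrib[of "\<lambda>z. z * _"] cong: if_cong)

lemma card_dom2: "card (dom2 N) = (N + 2) choose 2"
proof (induction N)
  case 0
  have "dom2 0 = {(0, 0)}" by (auto simp: dom2_def)
  then show ?case by (simp add: choose_two)
next
  case (Suc N)
  have "dom2 (Suc N) = dom2 N \<union> (\<lambda>x. (x, Suc N - x)) ` {..Suc N}"
    by (auto simp: dom2_def image_iff)
  moreover have "dom2 N \<inter> (\<lambda>x. (x, Suc N - x)) ` {..Suc N} = {}" by (auto simp: dom2_def)
  moreover have "card ((\<lambda>x. (x, Suc N - x)) ` {..Suc N}) = N + 2"
    by (subst card_image) (auto simp: inj_on_def)
  ultimately have "card (dom2 (Suc N)) = card (dom2 N) + (N + 2)" by (simp add: card_Un_disjoint)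
  then show ?case using Suc by (simp add: numeral_2_eq_2)
qed

lemma nondegenerate_weighted_form:
  assumes "\<And>p. p \<in> dom2 N \<Longrightarrow> w p \<noteq> 0"
  shows "fun_space.nondegenerate_symmetric_form (functions_on N) (weighted_form N w)"
  unfolding fun_space.nondegenerate_symmetric_form_def
proof (intro conjI ballI allI impI)
  fix u assume u: "u \<in> functions_on N" "\<forall>v\<in>functions_on N. weighted_form N w u v = 0"
  have "u p = 0" for p
  proof (cases "p \<in> dom2 N")
    case True
    have "weighted_form N w u (delta p) = (\<Sum>q\<in>dom2 N. if q = p then w q * u q else 0)"
      unfolding weighted_form_def by (intro sum.cong) (auto simp: delta_def)
    then show ?thesis using u(2) True assms[OF True] by auto
  qed (use u(1) in \<open>simp add: functions_on_def del: split_paired_All\<close>)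
  then show "u = 0" by auto
qed (auto simp: weighted_form_def fun_scale_def sum.distrib sum_distrib_left algebra_simps intro!: sum.cong)

lemma matrix_op_self_adjoint:
  assumes "\<And>p q. p \<in> dom2 N \<Longrightarrow> q \<in> dom2 N \<Longrightarrow> w p * C p q = w q * C q p"
    and "f \<in> functions_on N" "g \<in> functions_on N"
  shows "weighted_form N w (matrix_op N C f) g = weighted_form N w f (matrix_op N C g)"
proof -
  have "weighted_form N w (matrix_op N C f) g = (\<Sum>p\<in>dom2 N. \<Sum>q\<in>dom2 N. (w p * C p q) * f q * g p)"
    using assms unfolding weighted_form_def matrix_op_def
    by (intro sum.cong) (auto simp: sum_distrib_left sum_distrib_right algebra_simps intro!: sum.cong)
  also have "\<dots> = (\<Sum>q\<in>dom2 N. \<Sum>p\<in>dom2 N. (w q * C q p) * f q * g p)"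
    by (subst sum.swap) (use assms(1) in \<open>auto intro!: sum.cong\<close>)
  also have "\<dots> = weighted_form N w f (matrix_op N C g)"
    using assms unfolding weighted_form_def matrix_op_def
    by (intro sum.cong) (auto simp: sum_distrib_left sum_distrib_right algebra_simps intro!: sum.cong)
  finally show ?thesis .
qed

text \<open>In each column \<open>x\<close> the matrix \<open>degreeM\<close> is tridiagonal in
  \<open>y\<close> with nonzero entries above the diagonal, so an eigenvector is determined by its
  values at \<open>y = 0\<close>. The eigenvalue of the diagonal operator leaves a single such
  value, at \<open>x0\<close>.\<close>

lemma degree_common_eigenspace_dim:
  assumes R: "regular N a c"
    and W: "W \<in> fun_space.common_eigenspaces (functions_on N)
              {matrix_op N (diagM (\<lambda>p. of_nat (fst p))), matrix_op N (degreeM N a c)}"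
  shows "fun_space.dim W = 1"
proof -
  obtain \<alpha> where W0: "W \<noteq> {0}" and W\<alpha>: "W = {v \<in> functions_on N.
      \<forall>h\<in>{matrix_op N (diagM (\<lambda>p. of_nat (fst p))), matrix_op N (degreeM N a c)}. h v = fun_scale (\<alpha> h) v}"
    using W unfolding fun_space.common_eigenspaces_def by blast
  have sub: "fun_space.subspace W"
    unfolding W\<alpha> by (intro fun_space.subspace_common_eigenspace subspace_functions_on) (auto simp: matrix_op_End)
  obtain \<xi> \<eta> where We: "W = {v \<in> functions_on N.
      matrix_op N (diagM (\<lambda>p. of_nat (fst p))) v = fun_scale \<xi> v \<and> matrix_op N (degreeM N a c) v = fun_scale \<eta> v}"
    using W\<alpha> by auto
  have vanish: "v = 0" if v: "v \<in> W" and v0: "\<And>x. v (x, 0) = 0" for v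
  proof -
    have vV: "v \<in> functions_on N" and ve: "matrix_op N (degreeM N a c) v = fun_scale \<eta> v" using v We by auto
    have "v (x, y) = 0" for x y
    proof (induction y rule: less_induct)
      case (less y)
      show ?case
      proof (cases y)
        case 0 then show ?thesis using v0 by simp
      next
        case (Suc y')
        show ?thesis
        proof (cases "x + y \<le> N")
          case True
          have "(\<Sum>q\<in>dom2 N. degreeM N a c (x, y') q * v q) = 0"
            using fun_cong[OF ve, of "(x, y')"] True Suc vV less[of y'] by (simp add: matrix_op_def fun_scale_def)
          also have "(\<Sum>q\<in>dom2 N. degreeM N a c (x, y') q * v q)
              = (\<Sum>q\<in>dom2 N. if q = (x, y) then degreeM N a c (x, y') (x, y) * v (x, y) else 0)"
          proof (intro sum.cong refl)
            fix q
            show "degreeM N a c (x, y') q * v q = (if q = (x, y) then degreeM N a c (x, y') (x, y) * v (x, y) else 0)"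
              using degreeM_support[of N a c "(x, y')" q] less Suc by (cases q) force
          qed
          finally show ?thesis using degreeM_up_nonzero[OF R, of x y'] True Suc by auto
        next
          case False
          then show ?thesis using vV by (auto simp: functions_on_def)
        qed
      qed
    qed
    then show ?thesis by (auto simp: fun_eq_iff)
  qed
  have "0 \<in> W" using sub by (rule fun_space.subspace_0)
  then obtain f where f: "f \<in> W" "f \<noteq> 0" using W0 by blast
  then obtain x0 where x0: "f (x0, 0) \<noteq> 0" using vanish by blast
  have supp: "(of_nat x - \<xi>) * v (x, 0) = 0" if "v \<in> W" for v x
  proof -
    have v: "v \<in> functions_on N" "matrix_op N (diagM (\<lambda>p. of_nat (fst p))) v = fun_scale \<xi> v"
      using that We by auto
    then have "(\<lambda>p. of_nat (fst p) * v p) = fun_scale \<xi> v" by (simp add: matrix_op_diagM)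
    from fun_cong[OF this, of "(x, 0)"] show ?thesis by (simp add: fun_scale_def algebra_simps)
  qed
  have \<xi>: "\<xi> = of_nat x0" using supp[OF f(1), of x0] x0 by simp
  have "W = fun_space.span {f}"
  proof (intro subset_antisym subsetI)
    fix g assume g: "g \<in> W"
    define k where "k = g (x0, 0) / f (x0, 0)"
    have gW: "g - fun_scale k f \<in> W" using sub f g by (intro fun_space.subspace_diff fun_space.subspace_scale)
    have "g - fun_scale k f = 0"
    proof (rule vanish[OF gW])
      fix x
      show "(g - fun_scale k f) (x, 0) = 0"
      proof (cases "x = x0")
        case True then show ?thesis using x0 by (simp add: fun_scale_def k_def)
      next
        case False then show ?thesis using supp[OF gW, of x] by (simp add: \<xi>)
      qed
    qed
    then show "g \<in> fun_space.span {f}" by (auto simp: fun_space.span_singleton)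
  next
    fix g assume "g \<in> fun_space.span {f}"
    then show "g \<in> W" using f sub by (auto simp: fun_space.span_singleton intro: fun_space.subspace_scale)
  qed
  then show ?thesis
    using f fun_space.dim_eq_card_independent[of "{f}"] by (simp add: fun_space.dim_span fun_space.independent_insert)
qed

section \<open>Parameter conditions and the coefficients T\<close>

text \<open>The difference of the two sides is \<open>m (p - q) (c + p + q + 1 + j)\<close>. As
  \<open>p \<noteq> q\<close>, the integer \<open>p + q + 1 + j\<close> lies between 2 and
  \<open>2 * N\<close>.\<close>

lemma quadratic_separation:
  assumes "\<And>k. 2 \<le> k \<Longrightarrow> k \<le> 2 * N \<Longrightarrow> c + of_nat k \<noteq> (0::complex)" "m \<noteq> 0" "j + p \<le> N" "j + q \<le> N"
    and eq: "m * of_nat p * (of_nat p + 1 + c + of_nat j) = m * of_nat q * (of_nat q + 1 + c + of_nat j)"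
  shows "p = q"
proof (rule ccontr)
  assume "p \<noteq> q"
  then have "c + of_nat (p + q + 1 + j) \<noteq> 0" using assms(3,4) by (intro assms(1)) auto
  moreover have "m * (of_nat p - of_nat q) * (c + of_nat (p + q + 1 + j)) = 0"
    using eq by (simp add: algebra_simps)
  ultimately show False using \<open>p \<noteq> q\<close> assms(2) by simp
qed

text \<open>Every \<open>2 \<le> k \<le> 2 N\<close> is \<open>a + b + 1\<close> for distinct \<open>a, b \<le> N\<close>.\<close>

lemma quadratic_injective_nonzero:
  assumes inj: "inj_on (\<lambda>n. m * of_nat n * (of_nat n + 1 + c)) {0..N}" and k: "2 \<le> k" "k \<le> 2 * N"
  shows "c + of_nat k \<noteq> (0::complex)"
proof
  assume 0: "c + of_nat k = 0"
  obtain a b where ab: "a \<le> N" "b \<le> N" "a \<noteq> b" "k = a + b + 1"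
  proof (cases "k - 1 \<le> N")
    case True
    then show thesis using that[of "k - 1" 0] k by auto
  next
    case False
    then show thesis using that[of N "k - 1 - N"] k by auto
  qed
  have "m * of_nat a * (of_nat a + 1 + c) - m * of_nat b * (of_nat b + 1 + c)
     = m * (of_nat a - of_nat b) * (c + of_nat k)"
    unfolding ab(4) by (simp add: algebra_simps)
  then have "m * of_nat a * (of_nat a + 1 + c) = m * of_nat b * (of_nat b + 1 + c)" unfolding 0 by simp
  then show False using inj_onD[OF inj, of a b] ab by auto
qed

lemma regular_first_array:
  assumes "N \<ge> 1" and "parameter_array N t_val (ts_val ms ss 0) (f_val N ms r 0) (g_val N ms ss r 0)"
  shows "ms \<noteq> 0" "regular N r ss"
proof -
  have fg: "f_val N ms r 0 k \<noteq> 0" "g_val N ms ss r 0 k \<noteq> 0" if "1 \<le> k" "k \<le> N" for k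
    using assms(2)[unfolded parameter_array_def, THEN conjunct1] that by auto
  show "ms \<noteq> 0" using fg(1)[of 1] assms(1) by (auto simp: f_val_def)
  have "inj_on (ts_val ms ss 0) {0..N}" using assms(2) unfolding parameter_array_def by blast
  moreover have "ts_val ms ss 0 = (\<lambda>n. ms * of_nat n * (of_nat n + 1 + ss))" by (simp add: ts_val_def fun_eq_iff)
  ultimately have "inj_on (\<lambda>n. ms * of_nat n * (of_nat n + 1 + ss)) {0..N}" by simp
  then have "ss + of_nat k \<noteq> 0" if "2 \<le> k" "k \<le> 2 * N" for k
    using that by (rule quadratic_injective_nonzero)
  moreover have "r + of_nat k \<noteq> 0 \<and> ss - r + of_nat k \<noteq> 0" if "1 \<le> k" "k \<le> N" for k
  proof -
    have "of_nat k + r \<noteq> 0" "of_nat k + ss + of_nat 0 - r \<noteq> 0"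
      using fg[OF that] unfolding f_val_def g_val_def mult_eq_0_iff de_Morgan_disj by blast+
    moreover have "of_nat k + r = r + of_nat k" "of_nat k + ss + of_nat 0 - r = ss - r + of_nat k" by simp_all
    ultimately show ?thesis by argo
  qed
  ultimately show "regular N r ss" unfolding regular_def by blast
qed

lemma regular_second_array:
  assumes "N \<ge> 1" and "parameter_array N (theta_val \<mu> \<sigma> 0) thetas_val (phi1_val N \<mu> \<rho> 0) (phi2_val N \<mu> \<sigma> \<rho> 0)"
  shows "\<mu> \<noteq> 0" "regular N \<rho> \<sigma>"
proof -
  have fg: "phi1_val N \<mu> \<rho> 0 k \<noteq> 0" "phi2_val N \<mu> \<sigma> \<rho> 0 k \<noteq> 0" if "1 \<le> k" "k \<le> N" for k
    using assms(2)[unfolded parameter_array_def, THEN conjunct1] that by auto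
  show "\<mu> \<noteq> 0" using fg(1)[of 1] assms(1) by (auto simp: phi1_val_def)
  have "inj_on (theta_val \<mu> \<sigma> 0) {0..N}" using assms(2) unfolding parameter_array_def by blast
  moreover have "theta_val \<mu> \<sigma> 0 = (\<lambda>n. \<mu> * of_nat n * (of_nat n + 1 + \<sigma>))" by (simp add: theta_val_def fun_eq_iff)
  ultimately have "inj_on (\<lambda>n. \<mu> * of_nat n * (of_nat n + 1 + \<sigma>)) {0..N}" by simp
  then have "\<sigma> + of_nat k \<noteq> 0" if "2 \<le> k" "k \<le> 2 * N" for k
    using that by (rule quadratic_injective_nonzero)
  moreover have "\<rho> + of_nat k \<noteq> 0 \<and> \<sigma> - \<rho> + of_nat k \<noteq> 0" if k: "1 \<le> k" "k \<le> N" for k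
  proof
    have "of_nat k + \<rho> \<noteq> 0" using fg(1)[OF k] unfolding phi1_val_def mult_eq_0_iff by blast
    then show "\<rho> + of_nat k \<noteq> 0" by (subst add.commute)
    \<comment> \<open>The second split sequence is read backwards: at \<open>N + 1 - k\<close> its
      last factor is \<open>- (\<sigma> - \<rho> + k)\<close>.\<close>
    have "of_nat (N + 1 - k) = (of_nat N + 1 - of_nat k :: complex)" using k by (subst of_nat_diff) auto
    then have "of_nat (N + 1 - k) + \<rho> - \<sigma> - of_nat N - 1 = - (\<sigma> - \<rho> + of_nat k)" by simp
    moreover have "phi2_val N \<mu> \<sigma> \<rho> 0 (N + 1 - k) \<noteq> 0" using k by (intro fg(2)) auto
    then have "of_nat (N + 1 - k) + \<rho> - \<sigma> - of_nat N - 1 \<noteq> 0"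
      unfolding phi2_val_def mult_eq_0_iff by blast
    ultimately show "\<sigma> - \<rho> + of_nat k \<noteq> 0" by (simp only: neg_equal_0_iff_equal) simp
  qed
  ultimately show "regular N \<rho> \<sigma>" unfolding regular_def by blast
qed

section \<open>The coefficients as values of the kernel\<close>

lemma hyp3F2_upto_rotate: "hyp3F2_upto n a1 a2 a3 b1 b2 z = hyp3F2_upto n a2 a3 a1 b1 b2 z"
  unfolding hyp3F2_upto_def by (intro sum.cong) (simp_all add: mult_ac)

lemma hyp3F2_upto_eq_hahn:
  "hyp3F2_upto (min n x) (- of_nat n) (of_nat n + 1 + c) (- of_nat x) (a + 1) (- of_nat M) 1 = hahn n M a c (of_nat x)"
proof -
  have "hahn n M a c (of_nat x) = (\<Sum>k\<le>n. (pochhammer (- of_nat n) k * pochhammer (of_nat n + 1 + c) k * pochhammer (- of_nat x) k) /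
       (pochhammer (a + 1) k * pochhammer (- of_nat M) k) * (1 ^ k / fact k))"
    unfolding hahn_def by (intro sum.cong) auto
  also have "\<dots> = (\<Sum>k\<in>{0..min n x}. (pochhammer (- of_nat n) k * pochhammer (of_nat n + 1 + c) k * pochhammer (- of_nat x) k) /
       (pochhammer (a + 1) k * pochhammer (- of_nat M) k) * (1 ^ k / fact k))"
    by (intro sum.mono_neutral_right) (auto simp: pochhammer_neg_nat_eq_0)
  finally show ?thesis by (simp add: hyp3F2_upto_def)
qed

definition normalization_coeff ::
  "nat \<Rightarrow> complex \<Rightarrow> complex \<Rightarrow> complex \<Rightarrow> complex \<Rightarrow> nat \<times> nat \<Rightarrow> complex" where
  "normalization_coeff N ss r \<sigma> \<rho> = (\<lambda>(i, j).
     of_nat ((N - j) choose i) *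
     (((- 1) ^ j * pochhammer (r + 1) i * pochhammer (2 + ss + of_nat j) (N - j) *
         pochhammer (\<rho> + 1) j) /
      (pochhammer (ss + of_nat j - r + 1) i * pochhammer (ss + of_nat j + 1 + of_nat i) i *
         pochhammer (ss + of_nat j + 2 * of_nat i + 2) (N - j - i) *
         pochhammer (\<rho> - \<sigma> - of_nat N) j)) / fact j)"

text \<open>The binomial coefficient of \<open>N - x\<close> over \<open>j\<close> is split in
  three: \<open>(N - x)!\<close> is moved to the left side, \<open>1 / j!\<close> belongs to
  \<open>normalization_coeff\<close> and \<open>1 / (N - x - j)!\<close> to the kernel. For
  \<open>x + j > N\<close> it is zero, like the kernel.\<close>

lemma T_coeff_eq_kernel:
  assumes "x + y \<le> N" "i + j \<le> N"
  shows "T_coeff N ss r \<sigma> \<rho> i j x y / fact (N - x)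
     = normalization_coeff N ss r \<sigma> \<rho> (i, j) * hahn_kernel N \<rho> \<sigma> r ss (x, y) (j, i)"
proof (cases "x + j \<le> N")
  case False
  then have "(N - x) choose j = 0" using assms(1) by (intro binomial_eq_0) auto
  then show ?thesis using False by (simp add: T_coeff_def hahn_kernel_def)
next
  case True
  have 1: "hyp3F2_upto (min i x) (- of_nat i) (of_nat i + 1 + ss + of_nat j) (- of_nat x) (r + 1) (- of_nat N + of_nat j) 1
    = hahn i (N - j) r (ss + of_nat j) (of_nat x)"
    using hyp3F2_upto_eq_hahn[of i x "ss + of_nat j" r "N - j"] assms by (simp add: of_nat_diff add.assoc)
  \<comment> \<open>The second series is read with degree \<open>y\<close> and argument
    \<open>j\<close>; the rotation puts its upper parameters in that order.\<close>
  have 2: "hyp3F2_upto (min j y) (- of_nat j) (- of_nat y) (of_nat y + 1 + \<sigma> + of_nat x) (\<rho> + 1) (- of_nat N + of_nat x) 1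
    = hahn y (N - x) \<rho> (\<sigma> + of_nat x) (of_nat j)"
    using hyp3F2_upto_eq_hahn[of y j "\<sigma> + of_nat x" \<rho> "N - x"] assms
    by (subst hyp3F2_upto_rotate) (simp add: of_nat_diff add.assoc min.commute)
  have 3: "of_nat ((N - x) choose j) = (fact (N - x) / (fact j * fact (N - x - j)) :: complex)"
    using True by (subst binomial_fact) auto
  show ?thesis
    unfolding T_coeff_def 1 2 3 normalization_coeff_def hahn_kernel_def prod.case fst_conv snd_conv
    using True by (simp add: mult_ac)
qed

lemma normalization_coeff_nonzero:
  assumes "regular N r ss" "regular N \<rho> \<sigma>" "N \<ge> 1" "i + j \<le> N"
  shows "normalization_coeff N ss r \<sigma> \<rho> (i, j) \<noteq> 0"
proof -
  have s: "ss + of_nat k \<noteq> 0" if "2 \<le> k" "k \<le> 2 * N" for k using assms(1) that by (simp add: regular_def)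
  have "pochhammer (r + 1) i \<noteq> 0" "pochhammer (\<rho> + 1) j \<noteq> 0"
    using assms by (auto intro!: pochhammer_nonzero simp: regular_def)
  moreover have "pochhammer (2 + ss + of_nat j) (N - j) \<noteq> 0"
    using pochhammer_shift_nonzero[of "j + 1" "N - j" ss] s assms(3,4) by (simp add: add_ac)
  moreover have "pochhammer (ss + of_nat j - r + 1) i \<noteq> 0"
    using pochhammer_shift_nonzero[of j i "ss - r"] assms(1,4) by (simp add: regular_def algebra_simps)
  moreover have "pochhammer (ss + of_nat j + 1 + of_nat i) i \<noteq> 0"
    using pochhammer_shift_nonzero[of "i + j" i ss] s assms(4) by (simp add: add_ac)
  moreover have "pochhammer (ss + of_nat j + 2 * of_nat i + 2) (N - j - i) \<noteq> 0"
    using pochhammer_shift_nonzero[of "j + 2 * i + 1" "N - j - i" ss] s assms(4) by (simp add: add_ac)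
  moreover have "pochhammer (\<rho> - \<sigma> - of_nat N) j \<noteq> 0"
  proof
    assume "pochhammer (\<rho> - \<sigma> - of_nat N) j = 0"
    then obtain k where k: "k < j" "\<rho> - \<sigma> - of_nat N = - of_nat k" by (auto simp: pochhammer_eq_0_iff)
    then have "\<sigma> - \<rho> + of_nat (N - k) = 0" using assms(4) by (simp add: of_nat_diff algebra_simps)
    moreover have "1 \<le> N - k" "N - k \<le> N" using assms(4) k(1) by auto
    ultimately show False using assms(2) unfolding regular_def by blast
  qed
  ultimately show ?thesis using assms(4) by (simp add: normalization_coeff_def)
qed

section \<open>The Leonard pair\<close>

lemma weighted_form_scale:
  "weighted_form N w (fun_scale k f) (fun_scale l g) = k * l * weighted_form N w f g"
  by (simp add: weighted_form_def fun_scale_def sum_distrib_left mult_ac)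

lemma weighted_form_span_zero:
  assumes "weighted_form N w f g = 0" "u \<in> fun_space.span {f}" "v \<in> fun_space.span {g}"
  shows "weighted_form N w u v = 0"
  using assms by (auto simp: fun_space.span_singleton weighted_form_scale)

lemma sum_fun_apply: "(\<Sum>x\<in>S. g x) p = (\<Sum>x\<in>S. g x p :: complex)"
  by (induction S rule: infinite_finite_induct) auto

lemma bij_swap_dom2: "bij_betw prod.swap (dom2 N) (dom2 N)"
  by (rule bij_betw_byWitness[where f' = prod.swap]) (auto simp: dom2_def)

locale hahn_leonard =
  fixes N :: nat and ms \<mu> r ss \<rho> \<sigma> :: complex
  assumes N: "N \<ge> 1" and ms: "ms \<noteq> 0" and \<mu>: "\<mu> \<noteq> 0"
    and R: "regular N \<rho> \<sigma>" and R': "regular N r ss"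
begin

definition X where "X = matrix_op N (diagM (\<lambda>p. of_nat (fst p)))"
definition Y where "Y = matrix_op N (diagM (\<lambda>p. theta_val \<mu> \<sigma> (fst p) (snd p)))"
definition Xs where "Xs = matrix_op N (\<lambda>p q. ms * quadraticM N \<rho> \<sigma> r ss p q)"
definition Ys where "Ys = matrix_op N (degreeM N \<rho> \<sigma>)"
definition nc where "nc = normalization_coeff N ss r \<sigma> \<rho>"
text \<open>The second argument of the kernel is \<open>(j, i)\<close>, whereas the dual basis is indexed by \<open>(i, j)\<close>.\<close>

definition vs where "vs q = (\<lambda>p. if p \<in> dom2 N then nc q * hahn_kernel N \<rho> \<sigma> r ss p (prod.swap q) else 0)"
definition B where "B = weighted_form N (weight N \<rho> \<sigma> r ss)"

lemma nc_nonzero: "q \<in> dom2 N \<Longrightarrow> nc q \<noteq> 0"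
  using normalization_coeff_nonzero[OF R' R N, of "fst q" "snd q"] by (cases q) (auto simp: nc_def)

lemma vs_apply: "vs q p = (if p \<in> dom2 N then nc q * hahn_kernel N \<rho> \<sigma> r ss p (prod.swap q) else 0)"
  by (simp add: vs_def)

lemma vs_in: "vs q \<in> functions_on N"
  by (simp add: functions_on_def vs_def)

lemma vs_nonzero: "q \<in> dom2 N \<Longrightarrow> vs q \<noteq> 0"
proof
  assume q: "q \<in> dom2 N" and 0: "vs q = 0"
  have "fst (prod.swap q) \<le> N" using q by (auto simp: dom2_def)
  then have "vs q (0, 0) \<noteq> 0" using hahn_kernel_0 nc_nonzero[OF q] by (simp add: vs_def)
  then show False using 0 by simp
qed

lemma matrix_op_vs:
  assumes "\<And>p. p \<in> dom2 N \<Longrightarrow> (\<Sum>u\<in>dom2 N. C p u * hahn_kernel N \<rho> \<sigma> r ss u (prod.swap q)) = z * hahn_kernel N \<rho> \<sigma> r ss p (prod.swap q)"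
  shows "matrix_op N C (vs q) = fun_scale z (vs q)"
proof
  fix p
  have "(\<Sum>u\<in>dom2 N. C p u * vs q u) = nc q * (\<Sum>u\<in>dom2 N. C p u * hahn_kernel N \<rho> \<sigma> r ss u (prod.swap q))"
    unfolding sum_distrib_left by (intro sum.cong) (auto simp: vs_def)
  then show "matrix_op N C (vs q) p = fun_scale z (vs q) p"
    using assms[of p] by (simp add: matrix_op_def vs_in fun_scale_def) (simp add: vs_apply)
qed

lemma Ys_vs: "Ys (vs q) = fun_scale (of_nat (snd q)) (vs q)"
  unfolding Ys_def by (intro matrix_op_vs) (simp add: degreeM_hahn_kernel[OF R])

lemma Xs_vs: "q \<in> dom2 N \<Longrightarrow> Xs (vs q) = fun_scale (ts_val ms ss (snd q) (fst q)) (vs q)"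
  unfolding Xs_def
proof (intro matrix_op_vs)
  fix p assume q: "q \<in> dom2 N" and p: "p \<in> dom2 N"
  have "prod.swap q \<in> dom2 N" using q by (auto simp: dom2_def)
  from quadraticM_hahn_kernel[OF R R' p this]
  show "(\<Sum>u\<in>dom2 N. ms * quadraticM N \<rho> \<sigma> r ss p u * hahn_kernel N \<rho> \<sigma> r ss u (prod.swap q))
    = ts_val ms ss (snd q) (fst q) * hahn_kernel N \<rho> \<sigma> r ss p (prod.swap q)"
    by (simp add: mult.assoc sum_distrib_left[symmetric] ts_val_def)
qed

text \<open>Bispectrality: by the symmetry of the kernel, an eigenvalue relation for
  \<open>C\<close> in the dual index turns multiplication by \<open>z p\<close> into the action of
  \<open>C\<close> on the vectors \<open>vs\<close>. The quotient \<open>nc q / nc u\<close>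
  accounts for their normalization, and \<open>prod.swap\<close> for the order of the dual
  index.\<close>

lemma diag_vs:
  assumes "\<And>p. p \<in> dom2 N \<Longrightarrow> (\<Sum>u\<in>dom2 N. C (prod.swap q) u * hahn_kernel N r ss \<rho> \<sigma> u p) = z p * hahn_kernel N r ss \<rho> \<sigma> (prod.swap q) p"
  shows "matrix_op N (diagM z) (vs q) = (\<Sum>u\<in>dom2 N. fun_scale (nc q / nc u * C (prod.swap q) (prod.swap u)) (vs u))"
proof
  fix p
  show "matrix_op N (diagM z) (vs q) p = (\<Sum>u\<in>dom2 N. fun_scale (nc q / nc u * C (prod.swap q) (prod.swap u)) (vs u)) p"
  proof (cases "p \<in> dom2 N")
    case True
    have "(\<Sum>u\<in>dom2 N. fun_scale (nc q / nc u * C (prod.swap q) (prod.swap u)) (vs u)) p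
      = (\<Sum>u\<in>dom2 N. nc q * (C (prod.swap q) (prod.swap u) * hahn_kernel N r ss \<rho> \<sigma> (prod.swap u) p))"
      unfolding sum_fun_scale_apply using True nc_nonzero
      by (intro sum.cong) (auto simp: vs_def hahn_kernel_commute[of N \<rho> \<sigma>])
    also have "\<dots> = (\<Sum>u\<in>dom2 N. nc q * (C (prod.swap q) u * hahn_kernel N r ss \<rho> \<sigma> u p))"
      by (rule sum.reindex_bij_betw[OF bij_swap_dom2])
    also have "\<dots> = nc q * (z p * hahn_kernel N r ss \<rho> \<sigma> (prod.swap q) p)"
      unfolding sum_distrib_left[symmetric] assms[OF True] ..
    also have "\<dots> = matrix_op N (diagM z) (vs q) p"
      using True by (simp add: matrix_op_diagM vs_in vs_apply hahn_kernel_commute[of N \<rho> \<sigma>])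
    finally show ?thesis by simp
  next
    case False
    then show ?thesis by (simp add: matrix_op_def sum_fun_scale_apply vs_def)
  qed
qed

lemma X_vs:
  assumes "q \<in> dom2 N"
  shows "X (vs q) = (\<Sum>u\<in>dom2 N. fun_scale (nc q / nc u * degreeM N r ss (prod.swap q) (prod.swap u)) (vs u))"
  unfolding X_def
proof (rule diag_vs)
  fix p assume "p \<in> dom2 N"
  have "prod.swap q \<in> dom2 N" using assms by (auto simp: dom2_def)
  from degreeM_hahn_kernel[OF R' this]
  show "(\<Sum>u\<in>dom2 N. degreeM N r ss (prod.swap q) u * hahn_kernel N r ss \<rho> \<sigma> u p) = of_nat (fst p) * hahn_kernel N r ss \<rho> \<sigma> (prod.swap q) p"
    by simp
qed

lemma Y_vs:
  assumes "q \<in> dom2 N"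
  shows "Y (vs q) = (\<Sum>u\<in>dom2 N. fun_scale (nc q / nc u * (\<mu> * quadraticM N r ss \<rho> \<sigma> (prod.swap q) (prod.swap u))) (vs u))"
  unfolding Y_def
proof (rule diag_vs)
  fix p assume "p \<in> dom2 N"
  have "prod.swap q \<in> dom2 N" using assms by (auto simp: dom2_def)
  from quadraticM_hahn_kernel[OF R' R this \<open>p \<in> dom2 N\<close>]
  show "(\<Sum>u\<in>dom2 N. \<mu> * quadraticM N r ss \<rho> \<sigma> (prod.swap q) u * hahn_kernel N r ss \<rho> \<sigma> u p)
     = theta_val \<mu> \<sigma> (fst p) (snd p) * hahn_kernel N r ss \<rho> \<sigma> (prod.swap q) p"
    by (simp add: mult.assoc sum_distrib_left[symmetric] theta_val_def)
qed

lemma regular_c: "regular N a c \<Longrightarrow> 2 \<le> k \<Longrightarrow> k \<le> 2 * N \<Longrightarrow> c + of_nat k \<noteq> 0"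
  by (simp add: regular_def)

sublocale e: joint_eigenbasis fun_scale "functions_on N" "dom2 N" delta X Y
  "\<lambda>p. of_nat (fst p)" "\<lambda>p. theta_val \<mu> \<sigma> (fst p) (snd p)"
proof unfold_locales
  show "fun_space.subspace (functions_on N)" by (rule subspace_functions_on)
  show "X \<in> fun_space.End (functions_on N)" "Y \<in> fun_space.End (functions_on N)"
    by (simp_all add: X_def Y_def matrix_op_End)
  fix p assume p: "p \<in> dom2 N"
  have "delta p p = 1" by (simp add: delta_def)
  then show "delta p \<noteq> 0" by auto
  show "X (delta p) = fun_scale (of_nat (fst p)) (delta p)"
    "Y (delta p) = fun_scale (theta_val \<mu> \<sigma> (fst p) (snd p)) (delta p)"
    using p by (simp_all add: X_def Y_def matrix_op_diagM) (auto simp: delta_def fun_scale_def fun_eq_iff)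
  fix q assume q: "q \<in> dom2 N" and 1: "of_nat (fst p) = (of_nat (fst q) :: complex)"
    and 2: "theta_val \<mu> \<sigma> (fst p) (snd p) = theta_val \<mu> \<sigma> (fst q) (snd q)"
  have x: "fst p = fst q" using 1 by simp
  have "snd p = snd q"
    by (rule quadratic_separation[of N \<sigma> \<mu> "fst p"]) (use regular_c[OF R] p q x 2 \<mu> in \<open>auto simp: theta_val_def dom2_def add.assoc\<close>)
  then show "p = q" using x by (rule prod_eqI[rotated])
next
  show "fun_space.span (delta ` dom2 N) = functions_on N"
  proof (intro subset_antisym)
    show "fun_space.span (delta ` dom2 N) \<subseteq> functions_on N"
      by (intro fun_space.span_minimal subspace_functions_on) auto
    show "functions_on N \<subseteq> fun_space.span (delta ` dom2 N)"
    proof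
      fix f assume "f \<in> functions_on N"
      then show "f \<in> fun_space.span (delta ` dom2 N)"
        by (subst delta_expansion)
           (assumption, rule fun_space.span_sum, rule fun_space.span_scale, rule fun_space.span_base, rule imageI)
    qed
  qed
qed auto

lemma dim_functions_on: "fun_space.dim (functions_on N) = (N + 2) choose 2"
  using e.dim_V card_dom2 by simp

sublocale s0: joint_eigenvectors fun_scale "functions_on N" "dom2 N" vs Xs Ys
  "\<lambda>q. ts_val ms ss (snd q) (fst q)" "\<lambda>q. of_nat (snd q)"
proof unfold_locales
  show "Xs \<in> fun_space.End (functions_on N)" "Ys \<in> fun_space.End (functions_on N)"
    by (simp_all add: Xs_def Ys_def matrix_op_End)
  fix p q assume p: "p \<in> dom2 N" and q: "q \<in> dom2 N" and 1: "of_nat (snd p) = (of_nat (snd q) :: complex)"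
    and 2: "ts_val ms ss (snd p) (fst p) = ts_val ms ss (snd q) (fst q)"
  have x: "snd p = snd q" using 1 by simp
  have "fst p = fst q"
    by (rule quadratic_separation[of N ss ms "snd p"]) (use regular_c[OF R'] p q x 2 ms in \<open>auto simp: ts_val_def dom2_def add.assoc\<close>)
  then show "p = q" using x by (rule prod_eqI)
qed (simp_all add: subspace_functions_on vs_in vs_nonzero Xs_vs Ys_vs)

sublocale s: joint_eigenbasis fun_scale "functions_on N" "dom2 N" vs Xs Ys
  "\<lambda>q. ts_val ms ss (snd q) (fst q)" "\<lambda>q. of_nat (snd q)"
proof unfold_locales
  show "fun_space.span (vs ` dom2 N) = functions_on N"
    by (rule s0.span_eq_if_card[of "delta ` dom2 N"]) (simp_all add: e.span_b card_image e.b_inj)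
qed


section \<open>Verification of the Leonard pair conditions\<close>

definition H where "H = fun_space.endo.span {X, Y}"
definition Hs where "Hs = fun_space.endo.span {Xs, Ys}"
definition E where "E p = fun_space.span {delta p}"
definition Es where "Es q = fun_space.span {vs q}"

lemma XY_in_H: "X \<in> H" "Y \<in> H" "Xs \<in> Hs" "Ys \<in> Hs"
  by (auto simp: H_def Hs_def intro: fun_space.endo.span_base)

lemma pair_coefficients_e:
  assumes "\<And>p. p \<in> dom2 N \<Longrightarrow> \<alpha> * of_nat (fst p) + \<beta> * theta_val \<mu> \<sigma> (fst p) (snd p) = 0"
  shows "\<alpha> = 0 \<and> \<beta> = 0"
proof -
  \<comment> \<open>The points \<open>(1, 0)\<close> and \<open>(0, 1)\<close> decide:
    \<open>theta_val\<close> is zero at the first and \<open>\<mu> (2 + \<sigma>)\<close> at the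
    second.\<close>
  have "\<sigma> + of_nat 2 \<noteq> 0" using N by (intro regular_c[OF R]) auto
  then have "2 + \<sigma> \<noteq> 0" by (simp add: add.commute)
  then show ?thesis using assms[of "(1, 0)"] assms[of "(0, 1)"] N \<mu> by (simp add: theta_val_def)
qed

lemma pair_coefficients_s:
  assumes "\<And>q. q \<in> dom2 N \<Longrightarrow> \<alpha> * ts_val ms ss (snd q) (fst q) + \<beta> * of_nat (snd q) = 0"
  shows "\<alpha> = 0 \<and> \<beta> = 0"
proof -
  have "ss + of_nat 2 \<noteq> 0" using N by (intro regular_c[OF R']) auto
  then have "2 + ss \<noteq> 0" by (simp add: add.commute)
  then show ?thesis using assms[of "(1, 0)"] assms[of "(0, 1)"] N ms by (simp add: ts_val_def)
qed

lemma B_delta: "p \<noteq> q \<Longrightarrow> B (delta p) (delta q) = 0"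
  by (auto simp: B_def weighted_form_def delta_def intro!: sum.neutral)

lemma B_delta_left: "p \<in> dom2 N \<Longrightarrow> B (delta p) g = weight N \<rho> \<sigma> r ss p * g p"
proof -
  assume p: "p \<in> dom2 N"
  have "B (delta p) g = (\<Sum>q\<in>dom2 N. if q = p then weight N \<rho> \<sigma> r ss q * g q else 0)"
    unfolding B_def weighted_form_def by (intro sum.cong) (auto simp: delta_def)
  then show ?thesis using p by simp
qed

lemma B_scale: "B (fun_scale k f) g = k * B f g" "B f (fun_scale k g) = k * B f g"
  by (simp_all add: B_def weighted_form_def fun_scale_def sum_distrib_left mult_ac)

lemma B_sum: "B f (\<Sum>u\<in>S. fun_scale (c u) (g u)) = (\<Sum>u\<in>S. c u * B f (g u))"
  unfolding B_def weighted_form_def sum_fun_scale_apply sum_distrib_left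
  by (subst sum.swap) (simp add: mult_ac)

lemma B_vs:
  assumes p: "p \<in> dom2 N" and q: "q \<in> dom2 N" and pq: "p \<noteq> q"
  shows "B (vs p) (vs q) = 0"
proof -
  have "B (Ys (vs p)) (vs q) = B (vs p) (Ys (vs q))"
    unfolding B_def Ys_def by (intro matrix_op_self_adjoint degreeM_symmetric R R' vs_in)
  then have 1: "(of_nat (snd p) - of_nat (snd q)) * B (vs p) (vs q) = 0"
    unfolding Ys_vs B_scale by (simp add: left_diff_distrib)
  have "B (Xs (vs p)) (vs q) = B (vs p) (Xs (vs q))"
    unfolding B_def Xs_def by (intro matrix_op_self_adjoint vs_in) (simp add: mult.left_commute quadraticM_symmetric[OF R R'])
  then have 2: "(ts_val ms ss (snd p) (fst p) - ts_val ms ss (snd q) (fst q)) * B (vs p) (vs q) = 0"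
    unfolding Xs_vs[OF p] Xs_vs[OF q] B_scale by (simp add: left_diff_distrib)
  show ?thesis using 1 2 s0.separated[OF p q] pq by auto
qed

lemma B_nondegenerate: "fun_space.nondegenerate_symmetric_form (functions_on N) B"
  unfolding B_def by (intro nondegenerate_weighted_form weight_nonzero R R')

text \<open>A vector \<open>vs q\<close> with vanishing norm would be orthogonal to the whole dual
  basis, against nondegeneracy.\<close>

lemma B_vs_self:
  assumes q: "q \<in> dom2 N" shows "B (vs q) (vs q) \<noteq> 0"
proof
  assume 0: "B (vs q) (vs q) = 0"
  have "B (vs q) g = 0" if g: "g \<in> functions_on N" for g
  proof -
    obtain c where c: "g = (\<Sum>u\<in>dom2 N. fun_scale (c u) (vs u))" using g by (rule s.expansion)
    have "B (vs q) (vs u) = 0" if "u \<in> dom2 N" for u using B_vs[OF q that] 0 by (cases "q = u") auto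
    then show ?thesis unfolding c B_sum by simp
  qed
  then have "vs q = 0"
    using B_nondegenerate vs_in unfolding fun_space.nondegenerate_symmetric_form_def by blast
  then show False using vs_nonzero[OF q] by simp
qed

text \<open>Orthogonality extracts the coefficient of \<open>vs p\<close> in
  \<open>X (vs q)\<close>, which reduces the pairing conditions to entries of
  \<open>degreeM\<close>.\<close>

lemma B_X_vs:
  assumes p: "p \<in> dom2 N" and q: "q \<in> dom2 N" and nz: "degreeM N r ss (prod.swap q) (prod.swap p) \<noteq> 0"
  shows "B (vs p) (X (vs q)) \<noteq> 0"
proof -
  let ?c = "\<lambda>u. nc q / nc u * degreeM N r ss (prod.swap q) (prod.swap u)"
  have "B (vs p) (X (vs q)) = (\<Sum>u\<in>dom2 N. ?c u * B (vs p) (vs u))"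
    unfolding X_vs[OF q] by (rule B_sum)
  also have "\<dots> = (\<Sum>u\<in>dom2 N. if u = p then ?c p * B (vs p) (vs p) else 0)"
    using B_vs[OF p] by (intro sum.cong) auto
  finally show ?thesis using p nz nc_nonzero[OF p] nc_nonzero[OF q] B_vs_self[OF p] by simp
qed

lemma adjacent_sum_in_span:
  assumes "\<And>u. u \<in> dom2 N \<Longrightarrow> c u \<noteq> 0 \<Longrightarrow> A2_adjacent u p"
  shows "(\<Sum>u\<in>dom2 N. fun_scale (c u) (b u)) \<in> fun_space.span (\<Union>q\<in>{q \<in> dom2 N. A2_adjacent q p}. fun_space.span {b q})"
proof (rule fun_space.span_sum)
  fix u assume u: "u \<in> dom2 N"
  show "fun_scale (c u) (b u) \<in> fun_space.span (\<Union>q\<in>{q \<in> dom2 N. A2_adjacent q p}. fun_space.span {b q})"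
  proof (cases "c u = 0")
    case True
    then show ?thesis by (simp add: fun_space.span_zero)
  next
    case False
    then have "A2_adjacent u p" using assms u by blast
    moreover have "b u \<in> fun_space.span {b u}" by (simp add: fun_space.span_base)
    ultimately have "b u \<in> (\<Union>q\<in>{q \<in> dom2 N. A2_adjacent q p}. fun_space.span {b q})" using u by blast
    then show ?thesis by (intro fun_space.span_scale fun_space.span_base)
  qed
qed

lemma degreeM_adjacent: "degreeM N a c p q \<noteq> 0 \<Longrightarrow> A2_adjacent p q"
  using degreeM_support by (auto simp: A2_adjacent_iff)

lemma Hs_E:
  assumes p: "p \<in> dom2 N" and h: "h \<in> Hs"
  shows "h ` E p \<subseteq> fun_space.span (\<Union>q\<in>{q \<in> dom2 N. A2_adjacent q p}. E q)"
  unfolding E_def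
proof (rule fun_space.endo_span_image_subset[OF subspace_functions_on s0.X_End s0.Y_End])
  show "Xs (delta p) \<in> fun_space.span (\<Union>q\<in>{q \<in> dom2 N. A2_adjacent q p}. fun_space.span {delta q})"
    unfolding Xs_def matrix_op_delta[OF p] by (rule adjacent_sum_in_span) (auto dest: quadraticM_support)
  show "Ys (delta p) \<in> fun_space.span (\<Union>q\<in>{q \<in> dom2 N. A2_adjacent q p}. fun_space.span {delta q})"
    unfolding Ys_def matrix_op_delta[OF p] by (rule adjacent_sum_in_span) (auto dest: degreeM_adjacent)
qed (use p h in \<open>auto simp: Hs_def\<close>)

lemma H_Es:
  assumes q: "q \<in> dom2 N" and h: "h \<in> H"
  shows "h ` Es q \<subseteq> fun_space.span (\<Union>u\<in>{u \<in> dom2 N. A2_adjacent u q}. Es u)"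
  unfolding Es_def
proof (rule fun_space.endo_span_image_subset[OF subspace_functions_on e.X_End e.Y_End])
  \<comment> \<open>\<open>A2\<close> is invariant under negation and under exchange of
    coordinates.\<close>
  have swap: "A2_adjacent u q" if "A2_adjacent (prod.swap q) (prod.swap u)" for u
    using that unfolding A2_adjacent_iff by auto
  show "X (vs q) \<in> fun_space.span (\<Union>u\<in>{u \<in> dom2 N. A2_adjacent u q}. fun_space.span {vs u})"
    unfolding X_vs[OF q] by (rule adjacent_sum_in_span) (auto intro!: swap dest: degreeM_adjacent)
  show "Y (vs q) \<in> fun_space.span (\<Union>u\<in>{u \<in> dom2 N. A2_adjacent u q}. fun_space.span {vs u})"
    unfolding Y_vs[OF q] by (rule adjacent_sum_in_span) (auto intro!: swap dest: quadraticM_support)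
qed (use h in \<open>auto simp: H_def vs_in\<close>)

text \<open>Eigenvalue separation puts some \<open>delta p\<close> into \<open>W\<close>. Nonzero
  matrix entries then connect it to every other one: down its column to \<open>y = 0\<close>, along
  this edge to the origin and back to each column, and up again.\<close>

lemma irreducible:
  assumes W: "fun_space.subspace W" "W \<subseteq> functions_on N" "W \<noteq> {0}"
    and HW: "\<forall>h\<in>H. h ` W \<subseteq> W" and HsW: "\<forall>h\<in>Hs. h ` W \<subseteq> W"
  shows "W = functions_on N"
proof -
  have XY: "X ` W \<subseteq> W" "Y ` W \<subseteq> W" and XsYs: "Xs ` W \<subseteq> W" "Ys ` W \<subseteq> W"
    using HW HsW XY_in_H by blast+
  have component: "delta p \<in> W" if "f \<in> W" "p \<in> dom2 N" "f p \<noteq> 0" for f p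
  proof (rule e.component_in_invariant_subspace[OF W(1) XY, of "dom2 N" f])
    show "(\<Sum>p\<in>dom2 N. fun_scale (f p) (delta p)) \<in> W" 
      by (subst delta_expansion[of f N, symmetric]) (use that(1) W(2) in blast)+
  qed (use that in auto)
  \<comment> \<open>The image of \<open>delta q\<close> is column \<open>q\<close>. Hence the entry
    with row \<open>(x, y)\<close> and column \<open>(x, y + 1)\<close>, nonzero by
    \<open>degreeM_up_nonzero\<close>, is the one that descends.\<close>
  have stepY: "delta p \<in> W" if "delta q \<in> W" "p \<in> dom2 N" "q \<in> dom2 N" "degreeM N \<rho> \<sigma> p q \<noteq> 0" for p q
    using that XsYs(2) by (intro component[of "Ys (delta q)"]) (auto simp: Ys_def matrix_op_delta_apply)
  have stepX: "delta p \<in> W" if "delta q \<in> W" "p \<in> dom2 N" "q \<in> dom2 N" "quadraticM N \<rho> \<sigma> r ss p q \<noteq> 0" for p q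
    using that XsYs(1) ms by (intro component[of "Xs (delta q)"]) (auto simp: Xs_def matrix_op_delta_apply)
  obtain f where f: "f \<in> W" "f \<noteq> 0" using W fun_space.subspace_0 by blast
  then obtain p where p: "f p \<noteq> 0" by (auto simp: fun_eq_iff)
  then have "p \<in> dom2 N" using f W(2) unfolding functions_on_def by blast
  then have "delta p \<in> W" using f p by (intro component)
  then obtain x y where xy: "delta (x, y) \<in> W" "x + y \<le> N" using \<open>p \<in> dom2 N\<close> by (cases p) auto
  have down: "x + y \<le> N \<Longrightarrow> delta (x, y) \<in> W \<Longrightarrow> delta (x, 0) \<in> W" for x y
  proof (induction y)
    case (Suc y)
    have "delta (x, y) \<in> W"
      by (rule stepY[OF Suc.prems(2) _ _ degreeM_up_nonzero[OF R Suc.prems(1)]]) (use Suc.prems(1) in simp_all)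
    then show ?case using Suc.IH Suc.prems(1) by simp
  qed
  have left: "x \<le> N \<Longrightarrow> delta (x, 0) \<in> W \<Longrightarrow> delta (0, 0) \<in> W" for x
  proof (induction x)
    case (Suc x)
    have "delta (x, 0) \<in> W"
      by (rule stepX[OF Suc.prems(2) _ _ quadraticM_up_nonzero[OF R' Suc.prems(1)]]) (use Suc.prems(1) in simp_all)
    then show ?case using Suc.IH Suc.prems(1) by simp
  qed
  have 0: "delta (0, 0) \<in> W" using left[of x] down[of x y] xy by simp
  have right: "x \<le> N \<Longrightarrow> delta (x, 0) \<in> W" for x
  proof (induction x)
    case (Suc x)
    then have "delta (x, 0) \<in> W" by simp
    then show ?case
      by (rule stepX[OF _ _ _ quadraticM_down_nonzero[OF R R' Suc.prems]]) (use Suc.prems in simp_all)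
  qed (use 0 in simp)
  have up: "x + y \<le> N \<Longrightarrow> delta (x, y) \<in> W" for x y
  proof (induction y)
    case (Suc y)
    then have "delta (x, y) \<in> W" by simp
    then show ?case
      by (rule stepY[OF _ _ _ degreeM_down_nonzero[OF R R' Suc.prems]]) (use Suc.prems in simp_all)
  qed (use right in simp)
  have "delta ` dom2 N \<subseteq> W" using up by auto
  then have "functions_on N \<subseteq> W" using e.span_b W(1) fun_space.span_minimal by metis
  then show ?thesis using W(2) by blast
qed

lemma A2_Leonard_pair: "fun_space.A2_Leonard_pair N (functions_on N) H Hs E Es B"
  unfolding fun_space.A2_Leonard_pair_def
proof (intro conjI)
  show "fun_space.subspace (functions_on N)" by (rule subspace_functions_on)
  show "\<forall>K\<in>{H, Hs}. K \<subseteq> fun_space.End (functions_on N) \<and> fun_space.endo.subspace K \<and> fun_space.endo.dim K = 2 \<and>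
        (\<forall>h\<in>K. fun_space.diagonalizable_on (functions_on N) h) \<and> (\<forall>g\<in>K. \<forall>h\<in>K. g \<circ> h = h \<circ> g)"
    unfolding H_def Hs_def
    using e.pair_End e.pair_dim[OF pair_coefficients_e] e.pair_diagonalizable e.pair_commute
      s.pair_End s.pair_dim[OF pair_coefficients_s] s.pair_diagonalizable s.pair_commute
    by (auto simp: fun_space.endo.subspace_span)
  show "bij_betw E (dom2 N) (fun_space.common_eigenspaces (functions_on N) H)"
    using e.bij_common_eigenspaces unfolding E_def[abs_def] H_def .
  show "bij_betw Es (dom2 N) (fun_space.common_eigenspaces (functions_on N) Hs)"
    using s.bij_common_eigenspaces unfolding Es_def[abs_def] Hs_def .
  show "\<not> (\<exists>W. fun_space.subspace W \<and> W \<subseteq> functions_on N \<and> W \<noteq> {0} \<and> W \<noteq> functions_on N \<and>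
            (\<forall>h\<in>H. h ` W \<subseteq> W) \<and> (\<forall>h\<in>Hs. h ` W \<subseteq> W))"
    using irreducible by blast
  show "\<forall>p\<in>dom2 N. \<forall>q\<in>dom2 N. p \<noteq> q \<longrightarrow>
        (\<forall>u\<in>E p. \<forall>w\<in>E q. B u w = 0) \<and> (\<forall>u\<in>Es p. \<forall>w\<in>Es q. B u w = 0)"
    using B_delta B_vs weighted_form_span_zero unfolding E_def Es_def B_def by blast
qed (use Hs_E H_Es e.dim_eigenspace s.dim_eigenspace B_nondegenerate in \<open>auto simp: E_def Es_def\<close>)

text \<open>\<open>degreeM\<close> links only points with equal first coordinate, and on their span
  \<open>X\<close> is a scalar.\<close>

lemma X_Ys_commute: "X \<circ> Ys = Ys \<circ> X"
proof (rule e.End_eqI)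
  fix p assume p: "p \<in> dom2 N"
  have "X (Ys (delta p)) = (\<Sum>q\<in>dom2 N. fun_scale (degreeM N \<rho> \<sigma> q p) (X (delta q)))"
    unfolding Ys_def matrix_op_delta[OF p] using e.X_End
    by (intro fun_space.End_sum[OF _ subspace_functions_on]) auto
  also have "\<dots> = (\<Sum>q\<in>dom2 N. fun_scale (of_nat (fst p)) (fun_scale (degreeM N \<rho> \<sigma> q p) (delta q)))"
    using degreeM_support[of N \<rho> \<sigma> _ p] by (intro sum.cong) (auto simp: e.X_b fun_scale_def fun_eq_iff)
  also have "\<dots> = fun_scale (of_nat (fst p)) (Ys (delta p))"
    unfolding Ys_def matrix_op_delta[OF p] by (rule fun_space.scale_sum_right[symmetric])
  also have "\<dots> = Ys (X (delta p))"
    using s0.Y_End p by (simp add: e.X_b fun_space.End_def)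
  finally show "(X \<circ> Ys) (delta p) = (Ys \<circ> X) (delta p)" by simp
qed (use e.X_End s0.Y_End subspace_functions_on fun_space.End_comp in auto)

lemma factorized: "fun_space.factorized_A2_Leonard_pair N (functions_on N) H Hs E Es B X Y Xs Ys"
  unfolding fun_space.factorized_A2_Leonard_pair_def
proof (intro conjI)
  have E_eigen: "X v = fun_scale (of_nat (fst p)) v" if "p \<in> dom2 N" "v \<in> E p" for p v
    by (rule fun_space.eigenvector_span[OF e.X_End delta_in e.X_b]) (use that in \<open>auto simp: E_def\<close>)
  have Es_eigen: "Ys v = fun_scale (of_nat (snd q)) v" if "q \<in> dom2 N" "v \<in> Es q" for q v
    by (rule fun_space.eigenvector_span[OF s0.Y_End vs_in Ys_vs]) (use that in \<open>auto simp: Es_def\<close>)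
  show "\<exists>t :: nat \<Rightarrow> complex. inj_on t {0..N} \<and> (\<forall>(x, y)\<in>dom2 N. \<forall>v\<in>E (x, y). X v = fun_scale (t x) v)"
    using E_eigen by (intro exI[of _ of_nat]) (auto simp: inj_on_def)
  show "\<exists>\<theta>s :: nat \<Rightarrow> complex. inj_on \<theta>s {0..N} \<and> (\<forall>(i, j)\<in>dom2 N. \<forall>v\<in>Es (i, j). Ys v = fun_scale (\<theta>s j) v)"
    using Es_eigen by (intro exI[of _ of_nat]) (auto simp: inj_on_def)
  show "X \<noteq> Y" "fun_space.endo.independent {X, Y}" 
    using e.pair_independent[OF pair_coefficients_e] by blast+
  show "Xs \<noteq> Ys" "fun_space.endo.independent {Xs, Ys}" 
    using s.pair_independent[OF pair_coefficients_s] by blast+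
  show "\<forall>W\<in>fun_space.common_eigenspaces (functions_on N) {X, Ys}. fun_space.dim W = 1"
    using degree_common_eigenspace_dim[OF R] unfolding X_def Ys_def by blast
  have base: "vs q \<in> Es q" "delta q \<in> E q" for q by (auto simp: E_def Es_def fun_space.span_base)
  show "\<forall>i j. (i, j) \<in> dom2 N \<and> (i + 1, j) \<in> dom2 N \<longrightarrow>
        (\<exists>u\<in>Es (i + 1, j). \<exists>w\<in>Es (i, j). B u (X w) \<noteq> 0) \<and>
        (\<exists>u\<in>Es (i, j). \<exists>w\<in>Es (i + 1, j). B u (X w) \<noteq> 0)"
  proof (intro allI impI)
    fix i j assume ij: "(i, j) \<in> dom2 N \<and> (i + 1, j) \<in> dom2 N"
    \<comment> \<open>The labels enter \<open>degreeM\<close> swapped: a step in \<open>i\<close> is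
      a step in the second coordinate of \<open>(j, i)\<close>, with parameters \<open>r\<close> and
      \<open>ss\<close>.\<close>
    have "B (vs (i + 1, j)) (X (vs (i, j))) \<noteq> 0" "B (vs (i, j)) (X (vs (i + 1, j))) \<noteq> 0"
      using ij B_X_vs[of "(i + 1, j)" "(i, j)"] B_X_vs[of "(i, j)" "(i + 1, j)"]
        degreeM_up_nonzero[OF R', of j i] degreeM_down_nonzero[OF R' R, of j i]
      by simp_all
    then show "(\<exists>u\<in>Es (i + 1, j). \<exists>w\<in>Es (i, j). B u (X w) \<noteq> 0) \<and>
        (\<exists>u\<in>Es (i, j). \<exists>w\<in>Es (i + 1, j). B u (X w) \<noteq> 0)" using base by blast
  qed
  show "\<forall>x y. (x, y) \<in> dom2 N \<and> (x, y + 1) \<in> dom2 N \<longrightarrow>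
        (\<exists>u\<in>E (x, y + 1). \<exists>w\<in>E (x, y). B u (Ys w) \<noteq> 0) \<and>
        (\<exists>u\<in>E (x, y). \<exists>w\<in>E (x, y + 1). B u (Ys w) \<noteq> 0)"
  proof (intro allI impI)
    fix x y assume xy: "(x, y) \<in> dom2 N \<and> (x, y + 1) \<in> dom2 N"
    have "B (delta (x, y + 1)) (Ys (delta (x, y))) \<noteq> 0" "B (delta (x, y)) (Ys (delta (x, y + 1))) \<noteq> 0"
      using xy degreeM_up_nonzero[OF R, of x y] degreeM_down_nonzero[OF R R', of x y] weight_nonzero[OF R R']
      by (auto simp: B_delta_left Ys_def matrix_op_delta_apply)
    then show "(\<exists>u\<in>E (x, y + 1). \<exists>w\<in>E (x, y). B u (Ys w) \<noteq> 0) \<and>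
        (\<exists>u\<in>E (x, y). \<exists>w\<in>E (x, y + 1). B u (Ys w) \<noteq> 0)" using base by blast
  qed
qed (use A2_Leonard_pair X_Ys_commute in \<open>auto simp: H_def Hs_def\<close>)

text \<open>The factor \<open>(N - x)!\<close> separates \<open>T\<close> from the symmetric kernel.\<close>

definition v where "v p = fun_scale (1 / fact (N - fst p)) (delta p)"

lemma v_eigen:
  assumes "p \<in> dom2 N"
  shows "v p \<in> E p" "v p \<noteq> 0" "X (v p) = fun_scale (t_val (fst p)) (v p)"
    "Y (v p) = fun_scale (theta_val \<mu> \<sigma> (fst p) (snd p)) (v p)"
proof -
  show "v p \<in> E p" by (simp add: v_def E_def fun_space.span_base fun_space.span_scale)
  show "v p \<noteq> 0" using e.b_nonzero[OF assms] by (simp add: v_def)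
  have "X (v p) = fun_scale (1 / fact (N - fst p)) (X (delta p))" "Y (v p) = fun_scale (1 / fact (N - fst p)) (Y (delta p))"
    using e.X_End e.Y_End assms unfolding v_def by (auto simp: fun_space.End_def)
  then show "X (v p) = fun_scale (t_val (fst p)) (v p)" "Y (v p) = fun_scale (theta_val \<mu> \<sigma> (fst p) (snd p)) (v p)"
    using assms by (simp_all add: e.X_b e.Y_b t_val_def) (simp_all add: v_def mult.commute)
qed

lemma vs_expansion:
  assumes ij: "i + j \<le> N"
  shows "vs (i, j) = (\<Sum>x = 0..N - j. \<Sum>y = 0..N - x. fun_scale (T_coeff N ss r \<sigma> \<rho> i j x y) (v (x, y)))"
proof
  fix p :: "nat \<times> nat"
  obtain x0 y0 where p: "p = (x0, y0)" by (cases p)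
  have "(\<Sum>x = 0..N - j. \<Sum>y = 0..N - x. fun_scale (T_coeff N ss r \<sigma> \<rho> i j x y) (v (x, y))) p
    = (\<Sum>x = 0..N - j. \<Sum>y = 0..N - x. T_coeff N ss r \<sigma> \<rho> i j x y * v (x, y) p)"
    by (simp add: sum_fun_apply fun_scale_def)
  also have "\<dots> = (\<Sum>x = 0..N - j. if x = x0 then (\<Sum>y = 0..N - x. if y = y0 then T_coeff N ss r \<sigma> \<rho> i j x0 y0 / fact (N - x0) else 0) else 0)"
  proof (intro sum.cong refl)
    fix x
    have "v (x, y) p = (if x = x0 \<and> y = y0 then 1 / fact (N - x0) else 0)" for y
      by (auto simp: v_def delta_def fun_scale_def p)
    then show "(\<Sum>y = 0..N - x. T_coeff N ss r \<sigma> \<rho> i j x y * v (x, y) p)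
      = (if x = x0 then (\<Sum>y = 0..N - x. if y = y0 then T_coeff N ss r \<sigma> \<rho> i j x0 y0 / fact (N - x0) else 0) else 0)"
      by (auto simp: if_distrib[of "\<lambda>z. _ * z"] cong: if_cong)
  qed
  also have "\<dots> = (if x0 + j \<le> N \<and> x0 + y0 \<le> N then T_coeff N ss r \<sigma> \<rho> i j x0 y0 / fact (N - x0) else 0)"
    using ij by auto
  \<comment> \<open>The bound \<open>N - j\<close> of the outer sum corresponds to the vanishing of
    the kernel for \<open>x0 + j > N\<close>.\<close>
  also have "\<dots> = vs (i, j) p"
  proof (cases "x0 + y0 \<le> N")
    case True
    show ?thesis
      unfolding T_coeff_eq_kernel[OF True ij]
      using True by (auto simp: vs_apply p nc_def hahn_kernel_def)
  next
    case False
    then show ?thesis by (simp add: vs_apply p)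
  qed
  finally show "vs (i, j) p = (\<Sum>x = 0..N - j. \<Sum>y = 0..N - x. fun_scale (T_coeff N ss r \<sigma> \<rho> i j x y) (v (x, y))) p"
    by simp
qed

end

theorem mainTheorem3:
  fixes N :: nat and ms ss r \<mu> \<sigma> \<rho> :: complex
  assumes "N \<ge> 1"
    and "\<And>j. j \<le> N \<Longrightarrow>
           parameter_array (N - j) t_val (ts_val ms ss j) (f_val N ms r j) (g_val N ms ss r j)"
    and "\<And>x. x \<le> N \<Longrightarrow>
           parameter_array (N - x) (theta_val \<mu> \<sigma> x) thetas_val
             (phi1_val N \<mu> \<rho> x) (phi2_val N \<mu> \<sigma> \<rho> x)"
  shows "\<exists>(V :: (nat \<times> nat \<Rightarrow> complex) set) H Hs E Es B X Y Xs Ys v vs.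
           fun_space.factorized_A2_Leonard_pair N V H Hs E Es B X Y Xs Ys \<and>
           fun_space.dim V = (N + 2) choose 2 \<and>
           (\<forall>(x, y)\<in>dom2 N.
              v (x, y) \<in> E (x, y) \<and> v (x, y) \<noteq> 0 \<and>
              X (v (x, y)) = fun_scale (t_val x) (v (x, y)) \<and>
              Y (v (x, y)) = fun_scale (theta_val \<mu> \<sigma> x y) (v (x, y))) \<and>
           (\<forall>(i, j)\<in>dom2 N.
              vs (i, j) \<in> Es (i, j) \<and> vs (i, j) \<noteq> 0 \<and>
              Xs (vs (i, j)) = fun_scale (ts_val ms ss j i) (vs (i, j)) \<and>
              Ys (vs (i, j)) = fun_scale (thetas_val j) (vs (i, j)) \<and>
              vs (i, j) = (\<Sum>x = 0..N - j. \<Sum>y = 0..N - x.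
                             fun_scale (T_coeff N ss r \<sigma> \<rho> i j x y) (v (x, y))))"
proof -
  have arrays: "parameter_array N t_val (ts_val ms ss 0) (f_val N ms r 0) (g_val N ms ss r 0)"
    "parameter_array N (theta_val \<mu> \<sigma> 0) thetas_val (phi1_val N \<mu> \<rho> 0) (phi2_val N \<mu> \<sigma> \<rho> 0)"
    using assms(2)[of 0] assms(3)[of 0] by simp_all
  interpret hahn_leonard N ms \<mu> r ss \<rho> \<sigma>
    using assms(1) regular_first_array[OF assms(1) arrays(1)] regular_second_array[OF assms(1) arrays(2)]
    by unfold_locales
  show ?thesis
  proof (intro exI conjI)
    show "fun_space.factorized_A2_Leonard_pair N (functions_on N) H Hs E Es B X Y Xs Ys" by (rule factorized)
    show "fun_space.dim (functions_on N) = (N + 2) choose 2" by (rule dim_functions_on)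
    show "\<forall>(x, y)\<in>dom2 N. v (x, y) \<in> E (x, y) \<and> v (x, y) \<noteq> 0 \<and>
        X (v (x, y)) = fun_scale (t_val x) (v (x, y)) \<and>
        Y (v (x, y)) = fun_scale (theta_val \<mu> \<sigma> x y) (v (x, y))"
      using v_eigen by fastforce
    show "\<forall>(i, j)\<in>dom2 N. vs (i, j) \<in> Es (i, j) \<and> vs (i, j) \<noteq> 0 \<and>
        Xs (vs (i, j)) = fun_scale (ts_val ms ss j i) (vs (i, j)) \<and>
        Ys (vs (i, j)) = fun_scale (thetas_val j) (vs (i, j)) \<and>
        vs (i, j) = (\<Sum>x = 0..N - j. \<Sum>y = 0..N - x. fun_scale (T_coeff N ss r \<sigma> \<rho> i j x y) (v (x, y)))"
      using vs_nonzero Xs_vs Ys_vs vs_expansion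
      by (auto simp: Es_def thetas_val_def fun_space.span_base)
  qed
qed

end
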